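(* Let $(R,\mathfrak m)$ be a Noetherian graded ring over a field $R_0=K$ of positive characteristic $p$. Let $I$ be a homogeneous ideal of $R$ with $\dim(R/I)=1$. Then: (1) If $R$ is equidimensional, then $I$ satisfies both $(LC^* )$ and $(LC)$. (2) $(I^* )_W=(I_W)^*$ for every multiplicatively closed set $W$ of $R$.
   Context: A Noetherian graded ring over a field $R_0=K$ is a commutative Noetherian ring $R=\bigoplus_{i\ge 0}R_i$ graded by the nonnegative integers with degree-zero part the field $K$; its irrelevant ideal is $\mathfrak m=\bigoplus_{i\ge1}R_i$. $R$ is equidimensional if $\dim R/P=\dim R$ for every minimal prime $P$. The letter $q$ always denotes a varying power of the characteristic $p$. For an ideal $I$ of a Noetherian ring $S$ of characteristic $p$, $I^{[q]}$ is the ideal generated by the $q$th powers of all elements of $I$; $S^o$ is the set of elements of $S$ not in any minimal prime of $S$; the tight closure $I^*$ is the set of $x\in S$ for which there is $c\in S^o$ with $cx^q\in I^{[q]}$ for all large $q$. The subscript $W$ denotes localization at $W$, and $(I_W)^*$ is the tight closure of $I_W$ computed in the ring $R_W$. $R_{\ge N}$ denotes the ideal of $R$ generated by all homogeneous elements of degree at least $N$. A homogeneous ideal $I$ satisfies condition $(LC)$ if there is a constant $N$ such that for all $q$, $R_{\ge Nq}\cdot H^0_{\mathfrak m}(R/I^{[q]})=0$. A homogeneous ideal $I$ satisfies condition $(LC^* )$ if there is a constant $N$ such that for all $q$, $R_{\ge Nq}\cdot H^0_{\mathfrak m}(R/(I^{[q]})^* )=0$. Here $H^0_{\mathfrak m}(M)$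 is the submodule of elements of $M$ killed by some power of $\mathfrak m$. *)

theory Defs
  imports "HOL-Algebra.Algebra" "HOL-Library.Extended_Nat"
begin

section \<open>Dimension and minimal primes\<close>

text \<open>The supremum of the lengths of chains of prime ideals. The zero ring, which has no prime
  ideals, gets dimension \<open>0\<close> rather than \<open>-\<infinity>\<close> or \<open>-1\<close>.\<close>

definition krull_dim :: "('a, 'b) ring_scheme \<Rightarrow> enat" where
  "krull_dim R = (SUP n \<in> {n :: nat. \<exists>P. (\<forall>i\<le>n. primeideal (P i) R) \<and> (\<forall>i<n. P i \<subset> P (Suc i))}.
     enat n)"

definition minimal_primes :: "('a, 'b) ring_scheme \<Rightarrow> 'a set set" where
  "minimal_primes R = {P. primeideal P R \<and> (\<forall>Q. primeideal Q R \<and> Q \<subseteq> P \<longrightarrow> Q = P)}"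

definition equidimensional :: "('a, 'b) ring_scheme \<Rightarrow> bool" where
  "equidimensional R \<longleftrightarrow> (\<forall>P \<in> minimal_primes R. krull_dim (R Quot P) = krull_dim R)"

definition has_char :: "('a, 'b) ring_scheme \<Rightarrow> nat \<Rightarrow> bool" where
  "has_char R p \<longleftrightarrow> (\<forall>n :: nat. [n] \<cdot>\<^bsub>R\<^esub> \<one>\<^bsub>R\<^esub> = \<zero>\<^bsub>R\<^esub> \<longleftrightarrow> p dvd n)"

section \<open>Graded rings\<close>

text \<open>The homogeneous components \<open>\<G> i\<close> are subgroups of the ring, and the ring is their internal
  direct sum.\<close>

locale nat_graded_ring = cring R for R (structure) +
  fixes \<G> :: "nat \<Rightarrow> 'a set"
  assumes component_subgroup: "additive_subgroup (\<G> i) R"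
    and component_mult: "\<lbrakk>a \<in> \<G> i; b \<in> \<G> j\<rbrakk> \<Longrightarrow> a \<otimes> b \<in> \<G> (i + j)"
    and decomposition: "x \<in> carrier R \<Longrightarrow>
      \<exists>!f. (\<forall>i. f i \<in> \<G> i) \<and> finite {i. f i \<noteq> \<zero>} \<and> x = (\<Oplus>i \<in> {i. f i \<noteq> \<zero>}. f i)"

locale noetherian_graded_ring_over_field = nat_graded_ring + noetherian_ring R +
  assumes component_zero_field: "subfield (\<G> 0) R"

definition irrelevant_ideal :: "('a, 'b) ring_scheme \<Rightarrow> (nat \<Rightarrow> 'a set) \<Rightarrow> 'a set" where
  "irrelevant_ideal R \<G> =
     {\<Oplus>\<^bsub>R\<^esub>i \<in> S. f i | S f. finite S \<and> S \<subseteq> {1..} \<and> (\<forall>i \<in> S. f i \<in> \<G> i)}"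

definition ideal_degree_ge :: "('a, 'b) ring_scheme \<Rightarrow> (nat \<Rightarrow> 'a set) \<Rightarrow> nat \<Rightarrow> 'a set" where
  "ideal_degree_ge R \<G> N = Idl\<^bsub>R\<^esub> (\<Union>i \<in> {N..}. \<G> i)"

definition homogeneous_ideal :: "('a, 'b) ring_scheme \<Rightarrow> (nat \<Rightarrow> 'a set) \<Rightarrow> 'a set \<Rightarrow> bool" where
  "homogeneous_ideal R \<G> I \<longleftrightarrow> (\<exists>S \<subseteq> (\<Union>i. \<G> i). I = Idl\<^bsub>R\<^esub> S)"

section \<open>Tight closure\<close>

definition frobenius_power :: "('a, 'b) ring_scheme \<Rightarrow> 'a set \<Rightarrow> nat \<Rightarrow> 'a set" where
  "frobenius_power R I q = Idl\<^bsub>R\<^esub> ((\<lambda>x. x [^]\<^bsub>R\<^esub> q) ` I)"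

definition off_minimal_primes :: "('a, 'b) ring_scheme \<Rightarrow> 'a set" where
  "off_minimal_primes R = carrier R - \<Union>(minimal_primes R)"

text \<open>The characteristic \<open>p\<close> is a parameter, because it cannot be recovered from the ring when a
  localization is the zero ring. The power \<open>q\<close> of \<open>p\<close> is written \<open>p ^ e\<close>.\<close>

definition tight_closure :: "('a, 'b) ring_scheme \<Rightarrow> nat \<Rightarrow> 'a set \<Rightarrow> 'a set" where
  "tight_closure R p I = {x \<in> carrier R. \<exists>c \<in> off_minimal_primes R. \<exists>e\<^sub>0. \<forall>e\<ge>e\<^sub>0.
     c \<otimes>\<^bsub>R\<^esub> x [^]\<^bsub>R\<^esub> (p ^ e) \<in> frobenius_power R I (p ^ e)}"

section \<open>Zeroth local cohomology and the conditions (LC) and (LC*)\<close>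

text \<open>\<open>R/J\<close> as an \<open>R\<close>-module, where \<open>r\<close> acts as multiplication by its residue class.\<close>

definition quot_module :: "('a, 'b) ring_scheme \<Rightarrow> 'a set \<Rightarrow> ('a, 'a set) module" where
  "quot_module R J = ring.extend (R Quot J)
     (module.fields (\<lambda>r A. (J +>\<^bsub>R\<^esub> r) \<otimes>\<^bsub>R Quot J\<^esub> A))"

lemma quot_module_smult:
  assumes "ideal J R" "r \<in> carrier R" "a \<in> carrier R"
  shows "r \<odot>\<^bsub>quot_module R J\<^esub> (J +>\<^bsub>R\<^esub> a) = J +>\<^bsub>R\<^esub> (r \<otimes>\<^bsub>R\<^esub> a)"
  using ideal.rcoset_mult_add[OF assms] by (simp add: quot_module_def ring.defs module.defs FactRing_def)

lemma quot_module_simps: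
  "carrier (quot_module R J) = carrier (R Quot J)"
  "\<zero>\<^bsub>quot_module R J\<^esub> = J"
  "x \<oplus>\<^bsub>quot_module R J\<^esub> y = x \<oplus>\<^bsub>R Quot J\<^esub> y"
  by (simp_all add: quot_module_def ring.defs module.defs FactRing_def)

definition H0 :: "('a, 'b) ring_scheme \<Rightarrow> 'a set \<Rightarrow> ('a, 'c, 'd) module_scheme \<Rightarrow> 'c set" where
  "H0 R I M = {x \<in> carrier M. \<exists>n :: nat. \<forall>r \<in> (I [^]\<^bsub>ideals_set R\<^esub> n). r \<odot>\<^bsub>M\<^esub> x = \<zero>\<^bsub>M\<^esub>}"

definition LC :: "('a, 'b) ring_scheme \<Rightarrow> (nat \<Rightarrow> 'a set) \<Rightarrow> nat \<Rightarrow> 'a set \<Rightarrow> bool" where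
  "LC R \<G> p I \<longleftrightarrow> (\<exists>N. \<forall>e. let M = quot_module R (frobenius_power R I (p ^ e)) in
     \<forall>r \<in> ideal_degree_ge R \<G> (N * p ^ e). \<forall>x \<in> H0 R (irrelevant_ideal R \<G>) M.
       r \<odot>\<^bsub>M\<^esub> x = \<zero>\<^bsub>M\<^esub>)"

definition LC_star :: "('a, 'b) ring_scheme \<Rightarrow> (nat \<Rightarrow> 'a set) \<Rightarrow> nat \<Rightarrow> 'a set \<Rightarrow> bool" where
  "LC_star R \<G> p I \<longleftrightarrow>
     (\<exists>N. \<forall>e. let M = quot_module R (tight_closure R p (frobenius_power R I (p ^ e))) in
       \<forall>r \<in> ideal_degree_ge R \<G> (N * p ^ e). \<forall>x \<in> H0 R (irrelevant_ideal R \<G>) M.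
         r \<odot>\<^bsub>M\<^esub> x = \<zero>\<^bsub>M\<^esub>)"

section \<open>Localization\<close>

definition fraction_rel :: "('a, 'b) ring_scheme \<Rightarrow> 'a set \<Rightarrow> (('a \<times> 'a) \<times> ('a \<times> 'a)) set" where
  "fraction_rel R W = {((a, s), (b, t)). a \<in> carrier R \<and> s \<in> W \<and> b \<in> carrier R \<and> t \<in> W \<and>
     (\<exists>u \<in> W. u \<otimes>\<^bsub>R\<^esub> (t \<otimes>\<^bsub>R\<^esub> a) = u \<otimes>\<^bsub>R\<^esub> (s \<otimes>\<^bsub>R\<^esub> b))}"

definition fraction :: "('a, 'b) ring_scheme \<Rightarrow> 'a set \<Rightarrow> 'a \<Rightarrow> 'a \<Rightarrow> ('a \<times> 'a) set" where
  "fraction R W a s = fraction_rel R W `` {(a, s)}"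

text \<open>As for \<^const>\<open>rcoset_mult\<close>, the operations on classes are unions over all representatives; see
  \<open>localization_mult\<close> and \<open>localization_add\<close> below.\<close>

definition localization :: "('a, 'b) ring_scheme \<Rightarrow> 'a set \<Rightarrow> ('a \<times> 'a) set ring" where
  "localization R W =
     \<lparr>carrier = (carrier R \<times> W) // fraction_rel R W,
      monoid.mult = (\<lambda>A B. \<Union>(a, s) \<in> A. \<Union>(b, t) \<in> B. fraction R W (a \<otimes>\<^bsub>R\<^esub> b) (s \<otimes>\<^bsub>R\<^esub> t)),
      one = fraction R W \<one>\<^bsub>R\<^esub> \<one>\<^bsub>R\<^esub>,
      ring.zero = fraction R W \<zero>\<^bsub>R\<^esub> \<one>\<^bsub>R\<^esub>,
      add = (\<lambda>A B. \<Union>(a, s) \<in> A. \<Union>(b, t) \<in> B.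
        fraction R W (t \<otimes>\<^bsub>R\<^esub> a \<oplus>\<^bsub>R\<^esub> s \<otimes>\<^bsub>R\<^esub> b) (s \<otimes>\<^bsub>R\<^esub> t))\<rparr>"

definition localize_ideal :: "('a, 'b) ring_scheme \<Rightarrow> 'a set \<Rightarrow> 'a set \<Rightarrow> ('a \<times> 'a) set set" where
  "localize_ideal R W I = {fraction R W a s | a s. a \<in> I \<and> s \<in> W}"

lemma equiv_fraction_rel:
  assumes "cring R" "submonoid W R"
  shows "equiv (carrier R \<times> W) (fraction_rel R W)"
proof -
  interpret cring R by fact
  interpret W: submonoid W R by fact
  have W: "\<And>s. s \<in> W \<Longrightarrow> s \<in> carrier R" using W.subset by blast
  show ?thesis
  proof (rule equivI)
    show "fraction_rel R W \<subseteq> (carrier R \<times> W) \<times> (carrier R \<times> W)"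
      by (auto simp: fraction_rel_def)
    show "refl_on (carrier R \<times> W) (fraction_rel R W)"
      by (auto simp: refl_on_def fraction_rel_def)
    show "sym (fraction_rel R W)"
      by (auto simp: sym_def fraction_rel_def) metis
    show "trans (fraction_rel R W)"
    proof (rule transI, clarsimp simp: fraction_rel_def)
      fix a s b t c r u v
      assume *: "a \<in> carrier R" "s \<in> W" "b \<in> carrier R" "t \<in> W" "c \<in> carrier R" "r \<in> W"
        "u \<in> W" "v \<in> W"
        and 1: "u \<otimes>\<^bsub>R\<^esub> (t \<otimes>\<^bsub>R\<^esub> a) = u \<otimes>\<^bsub>R\<^esub> (s \<otimes>\<^bsub>R\<^esub> b)"
        and 2: "v \<otimes>\<^bsub>R\<^esub> (r \<otimes>\<^bsub>R\<^esub> b) = v \<otimes>\<^bsub>R\<^esub> (t \<otimes>\<^bsub>R\<^esub> c)"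
      have "(u \<otimes>\<^bsub>R\<^esub> v \<otimes>\<^bsub>R\<^esub> t) \<otimes>\<^bsub>R\<^esub> (r \<otimes>\<^bsub>R\<^esub> a) = (v \<otimes>\<^bsub>R\<^esub> r) \<otimes>\<^bsub>R\<^esub> (u \<otimes>\<^bsub>R\<^esub> (t \<otimes>\<^bsub>R\<^esub> a))"
        using * by (simp add: W m_ac)
      also have "\<dots> = (u \<otimes>\<^bsub>R\<^esub> s) \<otimes>\<^bsub>R\<^esub> (v \<otimes>\<^bsub>R\<^esub> (r \<otimes>\<^bsub>R\<^esub> b))"
        unfolding 1 using * by (simp add: W m_ac)
      also have "\<dots> = (u \<otimes>\<^bsub>R\<^esub> v \<otimes>\<^bsub>R\<^esub> t) \<otimes>\<^bsub>R\<^esub> (s \<otimes>\<^bsub>R\<^esub> c)"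
        unfolding 2 using * by (simp add: W m_ac)
      finally show "\<exists>w\<in>W. w \<otimes>\<^bsub>R\<^esub> (r \<otimes>\<^bsub>R\<^esub> a) = w \<otimes>\<^bsub>R\<^esub> (s \<otimes>\<^bsub>R\<^esub> c)"
        using * by (intro bexI[of _ "u \<otimes>\<^bsub>R\<^esub> v \<otimes>\<^bsub>R\<^esub> t"]) auto
    qed
  qed
qed

lemma fraction_eq_iff:
  assumes "cring R" "submonoid W R" "a \<in> carrier R" "s \<in> W" "b \<in> carrier R" "t \<in> W"
  shows "fraction R W a s = fraction R W b t \<longleftrightarrow>
    (\<exists>u \<in> W. u \<otimes>\<^bsub>R\<^esub> (t \<otimes>\<^bsub>R\<^esub> a) = u \<otimes>\<^bsub>R\<^esub> (s \<otimes>\<^bsub>R\<^esub> b))"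
proof -
  have "fraction R W a s = fraction R W b t \<longleftrightarrow> ((a, s), (b, t)) \<in> fraction_rel R W"
    unfolding fraction_def by (rule eq_equiv_class_iff[OF equiv_fraction_rel]) (use assms in auto)
  then show ?thesis using assms(3-6) by (simp add: fraction_rel_def)
qed

lemma localization_mult:
  assumes "cring R" "submonoid W R" "a \<in> carrier R" "s \<in> W" "b \<in> carrier R" "t \<in> W"
  shows "fraction R W a s \<otimes>\<^bsub>localization R W\<^esub> fraction R W b t =
    fraction R W (a \<otimes>\<^bsub>R\<^esub> b) (s \<otimes>\<^bsub>R\<^esub> t)"
proof -
  interpret cring R by fact
  interpret W: submonoid W R by fact
  have W: "\<And>s. s \<in> W \<Longrightarrow> s \<in> carrier R" using W.subset by blast
  let ?f = "\<lambda>x y. fraction R W (fst x \<otimes>\<^bsub>R\<^esub> fst y) (snd x \<otimes>\<^bsub>R\<^esub> snd y)"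
  have "congruent2 (fraction_rel R W) (fraction_rel R W) ?f"
  proof (rule congruent2I', clarsimp simp: fraction_rel_def)
    fix a s a' s' u b t b' t' v
    assume *: "a \<in> carrier R" "s \<in> W" "a' \<in> carrier R" "s' \<in> W" "u \<in> W"
      "b \<in> carrier R" "t \<in> W" "b' \<in> carrier R" "t' \<in> W" "v \<in> W"
      and 1: "u \<otimes>\<^bsub>R\<^esub> (s' \<otimes>\<^bsub>R\<^esub> a) = u \<otimes>\<^bsub>R\<^esub> (s \<otimes>\<^bsub>R\<^esub> a')"
      and 2: "v \<otimes>\<^bsub>R\<^esub> (t' \<otimes>\<^bsub>R\<^esub> b) = v \<otimes>\<^bsub>R\<^esub> (t \<otimes>\<^bsub>R\<^esub> b')"
    have "u \<otimes>\<^bsub>R\<^esub> v \<otimes>\<^bsub>R\<^esub> (s' \<otimes>\<^bsub>R\<^esub> t' \<otimes>\<^bsub>R\<^esub> (a \<otimes>\<^bsub>R\<^esub> b)) =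
        (u \<otimes>\<^bsub>R\<^esub> (s' \<otimes>\<^bsub>R\<^esub> a)) \<otimes>\<^bsub>R\<^esub> (v \<otimes>\<^bsub>R\<^esub> (t' \<otimes>\<^bsub>R\<^esub> b))"
      using * by (simp add: W m_ac)
    also have "\<dots> = u \<otimes>\<^bsub>R\<^esub> v \<otimes>\<^bsub>R\<^esub> (s \<otimes>\<^bsub>R\<^esub> t \<otimes>\<^bsub>R\<^esub> (a' \<otimes>\<^bsub>R\<^esub> b'))"
      unfolding 1 2 using * by (simp add: W m_ac)
    finally show "fraction R W (a \<otimes>\<^bsub>R\<^esub> b) (s \<otimes>\<^bsub>R\<^esub> t) =
        fraction R W (a' \<otimes>\<^bsub>R\<^esub> b') (s' \<otimes>\<^bsub>R\<^esub> t')"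
      using * by (subst fraction_eq_iff[OF assms(1,2)]) (auto intro: bexI[of _ "u \<otimes>\<^bsub>R\<^esub> v"])
  qed
  from UN_equiv_class2[OF equiv_fraction_rel equiv_fraction_rel this, of "(a, s)" "(b, t)"] assms
  show ?thesis by (simp add: localization_def fraction_def split_def)
qed

lemma localization_add:
  assumes "cring R" "submonoid W R" "a \<in> carrier R" "s \<in> W" "b \<in> carrier R" "t \<in> W"
  shows "fraction R W a s \<oplus>\<^bsub>localization R W\<^esub> fraction R W b t =
    fraction R W (t \<otimes>\<^bsub>R\<^esub> a \<oplus>\<^bsub>R\<^esub> s \<otimes>\<^bsub>R\<^esub> b) (s \<otimes>\<^bsub>R\<^esub> t)"
proof -
  interpret cring R by fact
  interpret W: submonoid W R by fact
  have W: "\<And>s. s \<in> W \<Longrightarrow> s \<in> carrier R" using W.subset by blast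
  let ?f = "\<lambda>x y. fraction R W (snd y \<otimes>\<^bsub>R\<^esub> fst x \<oplus>\<^bsub>R\<^esub> snd x \<otimes>\<^bsub>R\<^esub> fst y) (snd x \<otimes>\<^bsub>R\<^esub> snd y)"
  have "congruent2 (fraction_rel R W) (fraction_rel R W) ?f"
  proof (rule congruent2I', clarsimp simp: fraction_rel_def)
    fix a s a' s' u b t b' t' v
    assume *: "a \<in> carrier R" "s \<in> W" "a' \<in> carrier R" "s' \<in> W" "u \<in> W"
      "b \<in> carrier R" "t \<in> W" "b' \<in> carrier R" "t' \<in> W" "v \<in> W"
      and 1: "u \<otimes>\<^bsub>R\<^esub> (s' \<otimes>\<^bsub>R\<^esub> a) = u \<otimes>\<^bsub>R\<^esub> (s \<otimes>\<^bsub>R\<^esub> a')"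
      and 2: "v \<otimes>\<^bsub>R\<^esub> (t' \<otimes>\<^bsub>R\<^esub> b) = v \<otimes>\<^bsub>R\<^esub> (t \<otimes>\<^bsub>R\<^esub> b')"
    have "u \<otimes>\<^bsub>R\<^esub> v \<otimes>\<^bsub>R\<^esub> (s' \<otimes>\<^bsub>R\<^esub> t' \<otimes>\<^bsub>R\<^esub> (t \<otimes>\<^bsub>R\<^esub> a \<oplus>\<^bsub>R\<^esub> s \<otimes>\<^bsub>R\<^esub> b)) =
        (v \<otimes>\<^bsub>R\<^esub> (t \<otimes>\<^bsub>R\<^esub> t')) \<otimes>\<^bsub>R\<^esub> (u \<otimes>\<^bsub>R\<^esub> (s' \<otimes>\<^bsub>R\<^esub> a)) \<oplus>\<^bsub>R\<^esub>
        (u \<otimes>\<^bsub>R\<^esub> (s \<otimes>\<^bsub>R\<^esub> s')) \<otimes>\<^bsub>R\<^esub> (v \<otimes>\<^bsub>R\<^esub> (t' \<otimes>\<^bsub>R\<^esub> b))"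
      using * by (simp add: W m_ac r_distr)
    also have "\<dots> = u \<otimes>\<^bsub>R\<^esub> v \<otimes>\<^bsub>R\<^esub> (s \<otimes>\<^bsub>R\<^esub> t \<otimes>\<^bsub>R\<^esub> (t' \<otimes>\<^bsub>R\<^esub> a' \<oplus>\<^bsub>R\<^esub> s' \<otimes>\<^bsub>R\<^esub> b'))"
      unfolding 1 2 using * by (simp add: W m_ac r_distr)
    finally show "fraction R W (t \<otimes>\<^bsub>R\<^esub> a \<oplus>\<^bsub>R\<^esub> s \<otimes>\<^bsub>R\<^esub> b) (s \<otimes>\<^bsub>R\<^esub> t) =
        fraction R W (t' \<otimes>\<^bsub>R\<^esub> a' \<oplus>\<^bsub>R\<^esub> s' \<otimes>\<^bsub>R\<^esub> b') (s' \<otimes>\<^bsub>R\<^esub> t')"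
      using * by (subst fraction_eq_iff[OF assms(1,2)]) (auto intro: bexI[of _ "u \<otimes>\<^bsub>R\<^esub> v"] simp: W)
  qed
  from UN_equiv_class2[OF equiv_fraction_rel equiv_fraction_rel this, of "(a, s)" "(b, t)"] assms
  show ?thesis by (simp add: localization_def fraction_def split_def)
qed

end

theory Submission
  imports Defs "HOL-Library.Poly_Mapping" "HOL-Library.Product_Lexorder"
    "HOL-Computational_Algebra.Primes"
begin

text \<open>Let \<open>f\<^sub>1, \<dots>, f\<^sub>n\<close> be homogeneous generators of \<open>I\<close> of degrees \<open>d\<^sub>1, \<dots>, d\<^sub>n\<close>, and let \<open>x\<close> be a
  homogeneous parameter modulo \<open>I\<close>. As \<open>R\<close> is a finite graded module over the weighted polynomial ring
  whose variables act as \<open>x, f\<^sub>1, \<dots>, f\<^sub>n\<close>, the first Koszul homology of \<open>x\<^sup>s, f\<^sub>1\<^sup>q, \<dots>, f\<^sub>n\<^sup>q\<close> on \<open>R\<close> vanishes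
  in degrees at least \<open>s deg x + q (d\<^sub>1 + \<dots> + d\<^sub>n) + B\<close>, with \<open>B\<close> independent of \<open>s\<close> and \<open>q\<close>. Hence a
  homogeneous \<open>u\<close> of degree at least \<open>q (d\<^sub>1 + \<dots> + d\<^sub>n) + B\<close> with \<open>x\<^sup>s u \<in> I\<^bsup>[q]\<^esup>\<close> lies in \<open>I\<^bsup>[q]\<^esup>\<close>; this
  gives (LC).

  If \<open>x\<^sup>s u\<close> is in the tight closure of \<open>I\<^bsup>[q]\<^esup>\<close> through \<open>c\<close>, then \<open>c u\<^bsup>q'\<^esup>\<close> is in the saturation of
  \<open>I\<^bsup>[qq']\<^esup>\<close>, and (LC) yields \<open>c (r u)\<^bsup>q'\<^esup> \<in> I\<^bsup>[qq']\<^esup>\<close> for \<open>r\<close> of degree at least \<open>Nq\<close>; this is (LC*).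
  For the localization, suppose \<open>w\<^sub>q c u\<^sup>q \<in> I\<^bsup>[q]\<^esup>\<close> with \<open>w\<^sub>q \<in> W\<close> for all large \<open>q\<close>. A product of elements
  of \<open>W\<close> lying in the minimal primes of \<open>I\<close> that meet \<open>W\<close>, times a power of an element of \<open>W\<close> in the
  irrelevant ideal, is a single \<open>w\<close> with \<open>w\<^sup>q c u\<^sup>q \<in> I\<^bsup>[q]\<^esup>\<close>, so that \<open>w u \<in> I\<^sup>*\<close>.\<close>

section \<open>Ideals and the Frobenius map\<close>

text \<open>The obstacle in (2) is that the multiplier in W depends on q, and so may the associated
  primes of the Frobenius powers. Dimension one removes this dependence: after saturation with
  respect to x, a homogeneous associated prime Q contains I but not x, so it lies strictly inside
  the irrelevant ideal, and a prime of the finite list for I strictly inside Q would give a chain of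
  three primes above I. Hence only that list matters, and it does not change with q. What remains is
  the irrelevant ideal, where the linear shape Nq of the bound in (LC) is decisive: for v in W and
  in the irrelevant ideal, v^(Nq) is the qth power of the fixed element v^N of W, and can be
  absorbed into u. Elements of W need not be homogeneous while the primes in play are, which forces
  arguments with lowest components. The constant B depends only on the relations among monomials in
  R: their leading indices have finitely many minimal ones, and B bounds the degrees of
  these.\<close>

context ring
begin

lemma ideal_mem_carrier: "ideal J R \<Longrightarrow> a \<in> J \<Longrightarrow> a \<in> carrier R"
  by (rule ideal.Icarr)

lemma ideal_zero_mem: "ideal J R \<Longrightarrow> \<zero> \<in> J"
  by (simp add: additive_subgroup.zero_closed ideal.axioms(1))

lemma ideal_add_mem: "ideal J R \<Longrightarrow> a \<in> J \<Longrightarrow> b \<in> J \<Longrightarrow> a \<oplus> b \<in> J"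
  by (simp add: additive_subgroup.a_closed ideal.axioms(1))

lemma ideal_neg_mem: "ideal J R \<Longrightarrow> a \<in> J \<Longrightarrow> \<ominus> a \<in> J"
  by (simp add: additive_subgroup.a_inv_closed ideal.axioms(1))

lemma ideal_minus_mem: "ideal J R \<Longrightarrow> a \<in> J \<Longrightarrow> b \<in> J \<Longrightarrow> a \<ominus> b \<in> J"
  by (simp add: a_minus_def ideal_add_mem ideal_neg_mem)

lemma ideal_lmult_mem: "ideal J R \<Longrightarrow> a \<in> J \<Longrightarrow> r \<in> carrier R \<Longrightarrow> r \<otimes> a \<in> J"
  by (rule ideal.I_l_closed)

lemma ideal_rmult_mem: "ideal J R \<Longrightarrow> a \<in> J \<Longrightarrow> r \<in> carrier R \<Longrightarrow> a \<otimes> r \<in> J"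
  by (rule ideal.I_r_closed)

lemma ideal_finsum_mem:
  assumes "ideal J R" "\<And>i. i \<in> A \<Longrightarrow> f i \<in> J"
  shows "(\<Oplus>i\<in>A. f i) \<in> J"
  using assms(2)
proof (induction A rule: infinite_finite_induct)
  case (insert x F)
  then show ?case
    using ideal_mem_carrier[OF assms(1)] ideal_add_mem[OF assms(1)] by (subst finsum_insert) auto
qed (use ideal_zero_mem[OF assms(1)] in auto)

lemma ideal_add_cancel:
  assumes "ideal J R" "a \<in> J" "b \<in> carrier R"
  shows "a \<oplus> b \<in> J \<longleftrightarrow> b \<in> J"
proof
  assume *: "a \<oplus> b \<in> J"
  have a: "a \<in> carrier R" using assms ideal_mem_carrier by blast
  have "\<ominus> a \<oplus> (a \<oplus> b) \<in> J" using * assms ideal_neg_mem ideal_add_mem by blast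
  then show "b \<in> J" using a assms by (simp add: r_neg1)
qed (use assms ideal_add_mem in blast)

lemma ideal_minus_iff:
  assumes "ideal J R" "a \<in> carrier R" "b \<in> carrier R" "a \<ominus> b \<in> J"
  shows "a \<in> J \<longleftrightarrow> b \<in> J"
proof -
  have "a = (a \<ominus> b) \<oplus> b" using assms(2,3) by (simp add: a_minus_def a_assoc l_neg)
  then show ?thesis using ideal_add_cancel[OF assms(1,4,3)] by simp
qed

lemma finsum_single:
  assumes "finite A" "k \<in> A" "x \<in> carrier R"
  shows "(\<Oplus>i\<in>A. if i = k then x else \<zero>) = x"
  using add.finprod_singleton[of k A "\<lambda>_. x"] assms by (simp add: eq_commute[of _ k])

end

context cring
begin

lemma idealI':
  assumes "J \<subseteq> carrier R" "\<zero> \<in> J" "\<And>a b. a \<in> J \<Longrightarrow> b \<in> J \<Longrightarrow> a \<oplus> b \<in> J"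
    "\<And>a r. a \<in> J \<Longrightarrow> r \<in> carrier R \<Longrightarrow> r \<otimes> a \<in> J"
  shows "ideal J R"
proof (rule idealI)
  show "subgroup J (add_monoid R)"
  proof (rule add.subgroupI)
    show "\<And>a. a \<in> J \<Longrightarrow> \<ominus> a \<in> J"
    proof -
      fix a assume a: "a \<in> J"
      then have "a \<in> carrier R" using assms(1) by blast
      then have "\<ominus> a = (\<ominus> \<one>) \<otimes> a" by (simp add: l_minus)
      then show "\<ominus> a \<in> J" using assms(4)[OF a] by simp
    qed
  qed (use assms in auto)
qed (use assms ring_axioms m_comm in \<open>auto simp: subset_iff\<close>)

lemma colon_ideal:
  assumes "ideal J R" "z \<in> carrier R"
  shows "ideal {r \<in> carrier R. r \<otimes> z \<in> J} R"
  using assms ideal_zero_mem[OF assms(1)] ideal_add_mem[OF assms(1)] ideal_lmult_mem[OF assms(1)]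
  by (intro idealI') (auto simp: l_distr m_assoc)

text \<open>Coefficients are indexed by \<open>A\<close> rather than by the values of
  \<open>g\<close>, so repeated generators are harmless and each generator keeps the degree attached
  to its index.\<close>

lemma Idl_image_memE:
  assumes "finite A" "\<And>i. i \<in> A \<Longrightarrow> g i \<in> carrier R" "y \<in> Idl (g ` A)"
  obtains r where "\<And>i. i \<in> A \<Longrightarrow> r i \<in> carrier R" "y = (\<Oplus>i\<in>A. r i \<otimes> g i)"
proof -
  let ?K = "{(\<Oplus>i\<in>A. r i \<otimes> g i) | r. r \<in> A \<rightarrow> carrier R}"
  have "ideal ?K R"
  proof (rule idealI')
    show "?K \<subseteq> carrier R" using assms by (auto intro!: finsum_closed)
    show "\<zero> \<in> ?K" using assms by (auto intro!: exI[of _ "\<lambda>_. \<zero>"] simp: add.finprod_one_eqI)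
    show "a \<oplus> b \<in> ?K" if ab: "a \<in> ?K" "b \<in> ?K" for a b
    proof -
      obtain r s where rs: "r \<in> A \<rightarrow> carrier R" "s \<in> A \<rightarrow> carrier R"
        "a = (\<Oplus>i\<in>A. r i \<otimes> g i)" "b = (\<Oplus>i\<in>A. s i \<otimes> g i)" using ab by auto
      have "(\<Oplus>i\<in>A. (r i \<oplus> s i) \<otimes> g i) = (\<Oplus>i\<in>A. r i \<otimes> g i \<oplus> s i \<otimes> g i)"
        using rs(1,2) assms by (intro finsum_cong') (auto simp: l_distr Pi_iff)
      also have "\<dots> = a \<oplus> b"
        unfolding rs using rs(1,2) assms by (intro finsum_addf) (auto simp: Pi_iff)
      finally have "a \<oplus> b = (\<Oplus>i\<in>A. (r i \<oplus> s i) \<otimes> g i)" by simp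
      then show ?thesis using rs by (auto intro!: exI[of _ "\<lambda>i. r i \<oplus> s i"])
    qed
    show "c \<otimes> a \<in> ?K" if ab: "a \<in> ?K" "c \<in> carrier R" for a c
    proof -
      obtain r where rs: "r \<in> A \<rightarrow> carrier R" "a = (\<Oplus>i\<in>A. r i \<otimes> g i)" using ab by auto
      have "c \<otimes> a = (\<Oplus>i\<in>A. (c \<otimes> r i) \<otimes> g i)"
        unfolding rs using rs(1) assms ab
        by (subst finsum_rdistr) (auto intro!: finsum_cong' simp: m_assoc Pi_iff)
      then show ?thesis using rs ab by (auto intro!: exI[of _ "\<lambda>i. c \<otimes> r i"])
    qed
  qed
  moreover have "g ` A \<subseteq> ?K"
  proof safe
    fix k assume k: "k \<in> A"
    have "(\<Oplus>i\<in>A. (if i = k then \<one> else \<zero>) \<otimes> g i) = (\<Oplus>i\<in>A. if i = k then g k else \<zero>)"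
      using assms k by (intro finsum_cong') auto
    also have "\<dots> = g k" using assms k by (intro finsum_single) auto
    finally show "\<exists>r. g k = (\<Oplus>i\<in>A. r i \<otimes> g i) \<and> r \<in> A \<rightarrow> carrier R"
      by (intro exI[of _ "\<lambda>i. if i = k then \<one> else \<zero>"]) auto
  qed
  ultimately have "y \<in> ?K" using assms(3) genideal_minimal by blast
  then show ?thesis using that by auto
qed

section \<open>Frobenius powers of ideals and additivity of the Frobenius map\<close>

lemma frobenius_power_ideal:
  assumes "ideal J R"
  shows "ideal (frobenius_power R J q) R"
  unfolding frobenius_power_def using ideal_mem_carrier[OF assms] by (intro genideal_ideal) auto

lemma frobenius_power_mem:
  assumes "ideal J R" "x \<in> J"
  shows "x [^] q \<in> frobenius_power R J q"
  unfolding frobenius_power_def using ideal_mem_carrier[OF assms(1)] assms(2)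
  by (intro set_mp[OF genideal_self]) auto

lemma binomial_expansion:
  assumes x: "x \<in> carrier R" and y: "y \<in> carrier R"
  shows "(x \<oplus> y) [^] n = (\<Oplus>k\<in>{..n}. [(n choose k)] \<cdot> (x [^] k \<otimes> y [^] (n - k)))"
proof (induction n)
  case 0
  then show ?case using assms by simp
next
  case (Suc n)
  define t where "t = (\<lambda>n k. [(n choose k)] \<cdot> (x [^] k \<otimes> y [^] (n - k)))"
  \<comment> \<open>\<open>u\<close> and \<open>v\<close> are the summands of the product with
    \<open>x\<close>, shifted up by one, and of the product with \<open>y\<close>. The value zero of
    \<open>u\<close> at 0 and the vanishing binomial coefficient in \<open>v\<close> at
    \<open>Suc n\<close> let both sums run over \<open>{..Suc n}\<close>, where Pascal's rule adds
    them termwise.\<close>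
  define u where "u = (\<lambda>k. if k = 0 then \<zero> else [(n choose (k - 1))] \<cdot> (x [^] k \<otimes> y [^] (Suc n - k)))"
  define v where "v = (\<lambda>k. [(n choose k)] \<cdot> (x [^] k \<otimes> y [^] (Suc n - k)))"
  have c [simp]: "t n k \<in> carrier R" "u k \<in> carrier R" "v k \<in> carrier R" for n k
    using assms by (simp_all add: t_def u_def v_def)
  have "t n k \<otimes> x = u (Suc k)" for k
  proof -
    have "x [^] k \<otimes> y [^] (n - k) \<otimes> x = x [^] Suc k \<otimes> y [^] (n - k)"
      using assms m_assoc m_comm by simp
    then show ?thesis using assms by (simp add: t_def u_def add_pow_ldistr)
  qed
  then have "(\<Oplus>k\<in>{..n}. t n k) \<otimes> x = (\<Oplus>k\<in>{..n}. u (Suc k))"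
    using x by (subst finsum_ldistr) auto
  also have "\<dots> = (\<Oplus>k\<in>{..Suc n}. u k)"
    by (subst finsum_Suc2) (simp_all, simp add: u_def)
  finally have 1: "(\<Oplus>k\<in>{..n}. t n k) \<otimes> x = (\<Oplus>k\<in>{..Suc n}. u k)" .
  have "t n k \<otimes> y = v k" if "k \<le> n" for k
    using assms that by (simp add: t_def v_def add_pow_ldistr Suc_diff_le m_assoc)
  then have "(\<Oplus>k\<in>{..n}. t n k) \<otimes> y = (\<Oplus>k\<in>{..n}. v k)"
    using y by (subst finsum_ldistr) (auto intro!: finsum_cong')
  also have "\<dots> = (\<Oplus>k\<in>{..Suc n}. v k)"
    by simp (simp add: v_def x binomial_eq_0)
  finally have 2: "(\<Oplus>k\<in>{..n}. t n k) \<otimes> y = (\<Oplus>k\<in>{..Suc n}. v k)" .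
  have 3: "u k \<oplus> v k = t (Suc n) k" for k
    using assms by (cases k) (auto simp: u_def v_def t_def add.nat_pow_mult)
  have "(x \<oplus> y) [^] Suc n = (\<Oplus>k\<in>{..n}. t n k) \<otimes> x \<oplus> (\<Oplus>k\<in>{..n}. t n k) \<otimes> y"
    using assms Suc by (simp add: r_distr t_def)
  also have "\<dots> = (\<Oplus>k\<in>{..Suc n}. u k \<oplus> v k)"
    unfolding 1 2 by (rule finsum_addf[symmetric]) auto
  finally show ?case by (simp only: 3 t_def)
qed

lemma add_pow_dvd_zero:
  assumes "[(p::nat)] \<cdot> \<one> = \<zero>" "p dvd n" "a \<in> carrier R"
  shows "[n] \<cdot> a = \<zero>"
proof -
  obtain k where "n = p * k" using assms by blast
  then have "[n] \<cdot> \<one> = [k] \<cdot> ([p] \<cdot> \<one>)" by (simp add: add.nat_pow_pow)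
  then have "[n] \<cdot> \<one> = \<zero>" using assms by simp
  then have "([n] \<cdot> \<one>) \<otimes> a = \<zero>" using assms(3) by simp
  then show ?thesis using assms(3) by (simp add: add_pow_ldistr)
qed

lemma frobenius_add_prime:
  assumes p: "Factorial_Ring.prime (p::nat)" "[p] \<cdot> \<one> = \<zero>"
    and x: "x \<in> carrier R" and y: "y \<in> carrier R"
  shows "(x \<oplus> y) [^] p = x [^] p \<oplus> y [^] p"
proof -
  define t where "t = (\<lambda>k. [(p choose k)] \<cdot> (x [^] k \<otimes> y [^] (p - k)))"
  have c [simp]: "t k \<in> carrier R" for k
    using x y by (simp add: t_def)
  have p1: "p > 0" using p(1) prime_gt_0_nat by blast
  then obtain m where m: "p = Suc m" using gr0_implies_Suc by blast
  have mid: "t k = \<zero>" if "0 < k" "k < p" for k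
  proof -
    have "p dvd (p choose k)" using that p(1) by (intro dvd_choose_prime) auto
    then show ?thesis unfolding t_def using x y by (intro add_pow_dvd_zero[OF p(2)]) auto
  qed
  have "(\<Oplus>k\<in>{..m}. t k) = (\<Oplus>k\<in>{..m}. if k = 0 then t 0 else \<zero>)"
    using mid m by (intro finsum_cong') auto
  also have "\<dots> = t 0" by (intro finsum_single) auto
  finally have "(\<Oplus>k\<in>{..p}. t k) = t p \<oplus> t 0" unfolding m by simp
  then show ?thesis using x y by (simp add: binomial_expansion t_def)
qed

lemma frobenius_add:
  assumes p: "Factorial_Ring.prime (p::nat)" "[p] \<cdot> \<one> = \<zero>"
    and x: "x \<in> carrier R" and y: "y \<in> carrier R"
  shows "(x \<oplus> y) [^] (p ^ e) = x [^] (p ^ e) \<oplus> y [^] (p ^ e)"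
proof (induction e)
  case 0
  show ?case using x y by simp
next
  case (Suc e)
  have *: "z [^] (p ^ Suc e) = (z [^] (p ^ e)) [^] p" if "z \<in> carrier R" for z
    using that by (simp add: nat_pow_pow mult.commute)
  show ?case unfolding *[OF a_closed[OF x y]] *[OF x] *[OF y] Suc
    using x y by (intro frobenius_add_prime[OF p]) auto
qed

text \<open>Since Frobenius is additive, the elements whose qth power lies in a given ideal form an
  ideal, and testing generators is enough. This gives access to finitely many homogeneous generators
  of a Frobenius power.\<close>

lemma frobenius_power_Idl:
  assumes p: "Factorial_Ring.prime (p::nat)" "[p] \<cdot> \<one> = \<zero>" and S: "S \<subseteq> carrier R"
  shows "frobenius_power R (Idl S) (p ^ e) = Idl ((\<lambda>x. x [^] (p ^ e)) ` S)"
proof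
  let ?J = "Idl ((\<lambda>x. x [^] (p ^ e)) ` S)"
  have J: "ideal ?J R" using S by (intro genideal_ideal) auto
  have SJ: "(\<lambda>x. x [^] (p ^ e)) ` S \<subseteq> ?J" using S by (intro genideal_self) auto
  let ?K = "{x \<in> carrier R. x [^] (p ^ e) \<in> ?J}"
  have pe: "p ^ e > 0" using p(1) prime_gt_0_nat by simp
  have "ideal ?K R"
  proof (rule idealI')
    show "\<zero> \<in> ?K" using pe ideal_zero_mem[OF J] by (simp add: nat_pow_zero)
    show "a \<oplus> b \<in> ?K" if "a \<in> ?K" "b \<in> ?K" for a b
      using that ideal_add_mem[OF J] frobenius_add[OF p, of a b e] by simp
    show "r \<otimes> a \<in> ?K" if "a \<in> ?K" "r \<in> carrier R" for a r
      using that ideal_lmult_mem[OF J] by (simp add: nat_pow_distrib)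
  qed auto
  moreover have "S \<subseteq> ?K" using SJ S by auto
  ultimately have "Idl S \<subseteq> ?K" by (rule genideal_minimal)
  then show "frobenius_power R (Idl S) (p ^ e) \<subseteq> ?J"
    unfolding frobenius_power_def by (intro genideal_minimal J) auto
  have I: "ideal (Idl S) R" using S by (rule genideal_ideal)
  show "?J \<subseteq> frobenius_power R (Idl S) (p ^ e)"
    using frobenius_power_mem[OF I] frobenius_power_ideal[OF I] genideal_self[OF S]
    by (intro genideal_minimal) blast+
qed

lemma frobenius_power_frobenius_power:
  assumes p: "Factorial_Ring.prime (p::nat)" "[p] \<cdot> \<one> = \<zero>" and J: "ideal J R"
  shows "frobenius_power R (frobenius_power R J (p ^ d)) (p ^ e) = frobenius_power R J (p ^ (d + e))"
proof -
  have J': "J \<subseteq> carrier R" using J ideal_mem_carrier by blast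
  have "frobenius_power R (frobenius_power R J (p ^ d)) (p ^ e) =
      Idl ((\<lambda>x. x [^] (p ^ e)) ` (\<lambda>x. x [^] (p ^ d)) ` J)"
    unfolding frobenius_power_def[of R J] using J' by (intro frobenius_power_Idl p) auto
  also have "(\<lambda>x. x [^] (p ^ e)) ` (\<lambda>x. x [^] (p ^ d)) ` J = (\<lambda>x. x [^] (p ^ (d + e))) ` J"
    unfolding image_image using J' by (intro image_cong) (auto simp: nat_pow_pow power_add)
  finally show ?thesis by (simp add: frobenius_power_def)
qed

end

section \<open>Homogeneous components and homogeneous ideals\<close>

context nat_graded_ring
begin

definition hcomp :: "'a \<Rightarrow> nat \<Rightarrow> 'a" where
  "hcomp x = (THE f. (\<forall>i. f i \<in> \<G> i) \<and> finite {i. f i \<noteq> \<zero>} \<and> x = (\<Oplus>i \<in> {i. f i \<noteq> \<zero>}. f i))"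

lemma component_carrier: "a \<in> \<G> i \<Longrightarrow> a \<in> carrier R"
  by (rule additive_subgroup.a_Hcarr[OF component_subgroup])

lemma component_zero [simp]: "\<zero> \<in> \<G> i"
  by (rule additive_subgroup.zero_closed[OF component_subgroup])

lemma component_add: "a \<in> \<G> i \<Longrightarrow> b \<in> \<G> i \<Longrightarrow> a \<oplus> b \<in> \<G> i"
  by (rule additive_subgroup.a_closed[OF component_subgroup])

lemma component_neg: "a \<in> \<G> i \<Longrightarrow> \<ominus> a \<in> \<G> i"
  by (rule additive_subgroup.a_inv_closed[OF component_subgroup])

lemma hcomp_spec:
  assumes "x \<in> carrier R"
  shows "(\<forall>i. hcomp x i \<in> \<G> i) \<and> finite {i. hcomp x i \<noteq> \<zero>} \<and>
    x = (\<Oplus>i \<in> {i. hcomp x i \<noteq> \<zero>}. hcomp x i)"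
  unfolding hcomp_def by (rule theI'[OF decomposition[OF assms]])

lemma hcomp_mem: "x \<in> carrier R \<Longrightarrow> hcomp x i \<in> \<G> i"
  using hcomp_spec by blast

lemma hcomp_closed [simp]: "x \<in> carrier R \<Longrightarrow> hcomp x i \<in> carrier R"
  using hcomp_mem component_carrier by blast

lemma hcomp_finite: "x \<in> carrier R \<Longrightarrow> finite {i. hcomp x i \<noteq> \<zero>}"
  using hcomp_spec by blast

lemma finsum_support:
  assumes "finite S" "\<And>i. i \<in> S \<Longrightarrow> f i \<in> carrier R" "\<And>i. i \<notin> S \<Longrightarrow> f i = \<zero>"
  shows "(\<Oplus>i\<in>S. f i) = (\<Oplus>i\<in>{i. f i \<noteq> \<zero>}. f i)"
  using assms by (intro add.finprod_mono_neutral_cong_right) auto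

lemma hcomp_sum:
  assumes "x \<in> carrier R" "finite S" "\<And>i. i \<notin> S \<Longrightarrow> hcomp x i = \<zero>"
  shows "(\<Oplus>i\<in>S. hcomp x i) = x"
  using finsum_support[of S "hcomp x"] hcomp_spec[OF assms(1)] assms by auto

lemma hcomp_unique:
  assumes "finite S" "\<And>i. f i \<in> \<G> i" "\<And>i. i \<notin> S \<Longrightarrow> f i = \<zero>" "x = (\<Oplus>i\<in>S. f i)"
  shows "hcomp x = f"
proof -
  have fc: "f i \<in> carrier R" for i using assms(2) component_carrier by blast
  have x: "x \<in> carrier R" unfolding assms(4) using fc by (intro finsum_closed) auto
  have fin: "finite {i. f i \<noteq> \<zero>}" using assms(3) by (intro finite_subset[OF _ assms(1)]) auto
  have "x = (\<Oplus>i\<in>{i. f i \<noteq> \<zero>}. f i)"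
    unfolding assms(4) using assms(1,3) fc by (intro finsum_support) auto
  then show ?thesis
    unfolding hcomp_def
    by (intro the1_equality[OF decomposition[OF x]] conjI allI assms(2) fin)
qed

lemma hcomp_hom:
  assumes "y \<in> \<G> k"
  shows "hcomp y i = (if i = k then y else \<zero>)"
proof -
  have "hcomp y = (\<lambda>i. if i = k then y else \<zero>)"
    using assms component_carrier[OF assms]
    by (intro hcomp_unique[of "{k}"]) (auto simp: finsum_single)
  then show ?thesis by simp
qed

lemma hcomp_zero [simp]: "hcomp \<zero> i = \<zero>"
  by (simp add: hcomp_hom[OF component_zero[of 0]])

lemma hcomp_add:
  assumes "x \<in> carrier R" "y \<in> carrier R"
  shows "hcomp (x \<oplus> y) i = hcomp x i \<oplus> hcomp y i"
proof -
  define S where "S = {i. hcomp x i \<noteq> \<zero>} \<union> {i. hcomp y i \<noteq> \<zero>}"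
  have S: "finite S" "\<And>i. i \<notin> S \<Longrightarrow> hcomp x i = \<zero>" "\<And>i. i \<notin> S \<Longrightarrow> hcomp y i = \<zero>"
    using hcomp_finite assms by (auto simp: S_def)
  have "(\<Oplus>i\<in>S. hcomp x i \<oplus> hcomp y i) = (\<Oplus>i\<in>S. hcomp x i) \<oplus> (\<Oplus>i\<in>S. hcomp y i)"
    using assms by (intro finsum_addf) auto
  also have "\<dots> = x \<oplus> y" using S assms by (simp add: hcomp_sum)
  finally have "hcomp (x \<oplus> y) = (\<lambda>i. hcomp x i \<oplus> hcomp y i)"
    using S assms hcomp_mem component_add by (intro hcomp_unique[of S]) auto
  then show ?thesis by simp
qed

lemma hcomp_finsum:
  assumes "\<And>a. a \<in> A \<Longrightarrow> f a \<in> carrier R"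
  shows "hcomp (\<Oplus>a\<in>A. f a) i = (\<Oplus>a\<in>A. hcomp (f a) i)"
  using assms
proof (induction A rule: infinite_finite_induct)
  case (insert x F)
  then show ?case by (subst (1 2) finsum_insert) (auto simp: hcomp_add)
qed auto

lemma hcomp_mult_hom:
  assumes h: "h \<in> \<G> k" and y: "y \<in> carrier R"
  shows "hcomp (h \<otimes> y) i = (if k \<le> i then h \<otimes> hcomp y (i - k) else \<zero>)"
proof -
  define S where "S = {i. hcomp y i \<noteq> \<zero>}"
  have S: "finite S" "\<And>i. i \<notin> S \<Longrightarrow> hcomp y i = \<zero>"
    using hcomp_finite y by (auto simp: S_def)
  have hc: "h \<in> carrier R" using h component_carrier by blast
  have "h \<otimes> y = h \<otimes> (\<Oplus>j\<in>S. hcomp y j)" using S y by (simp add: hcomp_sum)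
  also have "\<dots> = (\<Oplus>j\<in>S. h \<otimes> hcomp y j)" using S hc y by (subst finsum_rdistr) auto
  finally have "hcomp (h \<otimes> y) i = (\<Oplus>j\<in>S. hcomp (h \<otimes> hcomp y j) i)"
    using hc y by (simp add: hcomp_finsum)
  also have "\<dots> = (\<Oplus>j\<in>S. if k + j = i then h \<otimes> hcomp y j else \<zero>)"
    using hc y hcomp_hom[OF component_mult[OF h hcomp_mem[OF y]]] by (intro finsum_cong') auto
  also have "\<dots> = (\<Oplus>j\<in>S. if k \<le> i \<and> j = i - k then h \<otimes> hcomp y (i - k) else \<zero>)"
    using hc y by (intro finsum_cong') auto
  also have "\<dots> = (if k \<le> i then h \<otimes> hcomp y (i - k) else \<zero>)"
  proof (cases "i - k \<in> S")
    case True
    then show ?thesis using S hc y by (auto simp: finsum_single add.finprod_one_eqI)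
  next
    case False
    then have "(\<Oplus>j\<in>S. if k \<le> i \<and> j = i - k then h \<otimes> hcomp y (i - k) else \<zero>) = \<zero>"
      by (intro add.finprod_one_eqI) auto
    then show ?thesis using False S hc by simp
  qed
  finally show ?thesis .
qed

text \<open>Stability under components amounts to generation by homogeneous elements
  (\<open>hideal_Idl\<close>, \<open>hideal_eq_Idl\<close>), but can be used degree by degree
  without choosing generators.\<close>

definition hideal :: "'a set \<Rightarrow> bool" where
  "hideal J \<longleftrightarrow> ideal J R \<and> (\<forall>x\<in>J. \<forall>i. hcomp x i \<in> J)"

lemma hideal_ideal: "hideal J \<Longrightarrow> ideal J R"
  by (simp add: hideal_def)

lemma hideal_hcomp: "hideal J \<Longrightarrow> x \<in> J \<Longrightarrow> hcomp x i \<in> J"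
  by (simp add: hideal_def)

lemma mem_of_hcomp_mem:
  assumes "ideal J R" "x \<in> carrier R" "\<And>i. hcomp x i \<in> J"
  shows "x \<in> J"
proof -
  have "(\<Oplus>i\<in>{i. hcomp x i \<noteq> \<zero>}. hcomp x i) \<in> J"
    using assms by (intro ideal_finsum_mem) auto
  then show ?thesis using hcomp_spec[OF assms(2)] by simp
qed

lemma hcomp_mult_mem:
  assumes "ideal J R" "x \<in> carrier R" "r \<in> carrier R"
    "\<And>i j. hcomp r j \<otimes> hcomp x i \<in> J"
  shows "hcomp (r \<otimes> x) k \<in> J"
proof -
  define S where "S = {i. hcomp r i \<noteq> \<zero>}"
  have S: "finite S" "\<And>i. i \<notin> S \<Longrightarrow> hcomp r i = \<zero>"
    using hcomp_finite assms by (auto simp: S_def)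
  have "r \<otimes> x = (\<Oplus>j\<in>S. hcomp r j) \<otimes> x" using S assms by (simp add: hcomp_sum)
  also have "\<dots> = (\<Oplus>j\<in>S. hcomp r j \<otimes> x)" using S assms by (subst finsum_ldistr) auto
  finally have "hcomp (r \<otimes> x) k = (\<Oplus>j\<in>S. hcomp (hcomp r j \<otimes> x) k)"
    using assms by (simp add: hcomp_finsum)
  also have "\<dots> \<in> J"
    using assms ideal_zero_mem[OF assms(1)]
    by (intro ideal_finsum_mem) (auto simp: hcomp_mult_hom[OF hcomp_mem[OF assms(3)]])
  finally show ?thesis .
qed

lemma hideal_Idl:
  assumes "S \<subseteq> (\<Union>i. \<G> i)"
  shows "hideal (Idl S)"
proof -
  have Sc: "S \<subseteq> carrier R" using assms component_carrier by blast
  let ?J = "Idl S"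
  have J: "ideal ?J R" using Sc by (rule genideal_ideal)
  let ?K = "{x \<in> carrier R. \<forall>i. hcomp x i \<in> ?J}"
  have "ideal ?K R"
  proof (rule idealI')
    show "r \<otimes> a \<in> ?K" if "a \<in> ?K" "r \<in> carrier R" for a r
      using that ideal_lmult_mem[OF J] by (auto intro!: hcomp_mult_mem[OF J])
  qed (use ideal_zero_mem[OF J] ideal_add_mem[OF J] in \<open>auto simp: hcomp_add\<close>)
  moreover have "S \<subseteq> ?K"
    using assms Sc genideal_self[OF Sc] ideal_zero_mem[OF J] by (fastforce simp: hcomp_hom)
  ultimately have "?J \<subseteq> ?K" by (rule genideal_minimal)
  then show ?thesis using J by (auto simp: hideal_def)
qed

lemma homogeneous_ideal_imp_hideal: "homogeneous_ideal R \<G> J \<Longrightarrow> hideal J"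
  unfolding homogeneous_ideal_def using hideal_Idl by blast

lemma hideal_colon:
  assumes J: "hideal J" and z: "z \<in> \<G> k"
  shows "hideal {r \<in> carrier R. r \<otimes> z \<in> J}"
proof -
  have zc: "z \<in> carrier R" using z component_carrier by blast
  have "hcomp r i \<otimes> z \<in> J" if r: "r \<in> carrier R" "r \<otimes> z \<in> J" for r i
  proof -
    have "z \<otimes> r \<in> J" using r zc by (simp only: m_comm)
    then have "hcomp (z \<otimes> r) (k + i) \<in> J" by (rule hideal_hcomp[OF J])
    then have "z \<otimes> hcomp r i \<in> J" using r by (simp add: hcomp_mult_hom[OF z])
    then show ?thesis using r zc m_comm[of z "hcomp r i"] by simp
  qed
  then show ?thesis
    unfolding hideal_def using colon_ideal[OF hideal_ideal[OF J] zc] by auto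
qed

lemma hideal_eq_Idl:
  assumes J: "hideal J"
  shows "J = Idl (J \<inter> (\<Union>i. \<G> i))"
proof
  have Jc: "J \<subseteq> carrier R" using J hideal_ideal ideal_mem_carrier by blast
  let ?H = "J \<inter> (\<Union>i. \<G> i)"
  have H: "?H \<subseteq> carrier R" using Jc by auto
  show "J \<subseteq> Idl ?H"
  proof
    fix x assume x: "x \<in> J"
    have "hcomp x i \<in> ?H" for i using J x Jc hcomp_mem[of x i] hideal_hcomp by blast
    then have "hcomp x i \<in> Idl ?H" for i using genideal_self[OF H] by blast
    then show "x \<in> Idl ?H" by (rule mem_of_hcomp_mem[OF genideal_ideal[OF H] set_mp[OF Jc x]])
  qed
  show "Idl ?H \<subseteq> J" by (rule genideal_minimal[OF hideal_ideal[OF J]]) blast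
qed

lemma hideal_add_principal:
  assumes J: "hideal J" and z: "z \<in> \<G> k"
  shows "hideal (Idl (insert z J))"
proof -
  have Jc: "J \<subseteq> carrier R" using J hideal_ideal ideal_mem_carrier by blast
  have zc: "z \<in> carrier R" using z component_carrier by blast
  let ?H = "J \<inter> (\<Union>i. \<G> i)"
  have H: "insert z ?H \<subseteq> carrier R" using Jc zc by auto
  have "J \<subseteq> Idl (insert z ?H)"
    using hideal_eq_Idl[OF J] subset_Idl_subset[OF H, of ?H] by blast
  then have "insert z J \<subseteq> Idl (insert z ?H)" using genideal_self[OF H] by blast
  then have "Idl (insert z J) \<subseteq> Idl (insert z ?H)"
    by (rule genideal_minimal[OF genideal_ideal[OF H]])
  moreover have "Idl (insert z ?H) \<subseteq> Idl (insert z J)" using Jc zc by (intro subset_Idl_subset) auto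
  ultimately have "Idl (insert z J) = Idl (insert z ?H)" by blast
  then show ?thesis using z by (auto intro!: hideal_Idl)
qed

lemma Idl_insert_memE:
  assumes J: "ideal J R" and z: "z \<in> carrier R" and y: "y \<in> Idl (insert z J)"
  obtains r j where "r \<in> carrier R" "j \<in> J" "y = r \<otimes> z \<oplus> j"
proof -
  let ?K = "{r \<otimes> z \<oplus> j | r j. r \<in> carrier R \<and> j \<in> J}"
  have Jc: "\<And>j. j \<in> J \<Longrightarrow> j \<in> carrier R" using J ideal_mem_carrier by blast
  have "ideal ?K R"
  proof (rule idealI')
    show "?K \<subseteq> carrier R" using z Jc by auto
    show "\<zero> \<in> ?K" using z ideal_zero_mem[OF J] by (auto intro!: exI[of _ \<zero>])
    show "a \<oplus> b \<in> ?K" if ab: "a \<in> ?K" "b \<in> ?K" for a b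
    proof -
      obtain r s j k where *: "r \<in> carrier R" "s \<in> carrier R" "j \<in> J" "k \<in> J"
        "a = r \<otimes> z \<oplus> j" "b = s \<otimes> z \<oplus> k" using ab by auto
      then have "a \<oplus> b = (r \<oplus> s) \<otimes> z \<oplus> (j \<oplus> k)" using Jc z by (simp add: l_distr a_ac)
      then show ?thesis using * ideal_add_mem[OF J] by blast
    qed
    show "c \<otimes> a \<in> ?K" if ac: "a \<in> ?K" "c \<in> carrier R" for a c
    proof -
      obtain r j where *: "r \<in> carrier R" "j \<in> J" "a = r \<otimes> z \<oplus> j" using ac by auto
      then have "c \<otimes> a = (c \<otimes> r) \<otimes> z \<oplus> (c \<otimes> j)" using Jc z ac by (simp add: r_distr m_assoc)
      then show ?thesis using * ac ideal_lmult_mem[OF J] by blast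
    qed
  qed
  moreover have "insert z J \<subseteq> ?K"
  proof -
    have "z = \<one> \<otimes> z \<oplus> \<zero>" using z by simp
    then have "z \<in> ?K" using ideal_zero_mem[OF J] one_closed by blast
    moreover have "j \<in> ?K" if "j \<in> J" for j
    proof -
      have "j = \<zero> \<otimes> z \<oplus> j" using z Jc that by simp
      then show ?thesis using that zero_closed by blast
    qed
    ultimately show ?thesis by blast
  qed
  ultimately have "y \<in> ?K" using y genideal_minimal by blast
  then show ?thesis using that by auto
qed

text \<open>The component of degree \<open>i + j\<close> of a product is a sum over all splittings
  of the degree, and the hypothesis puts every term but one into \<open>J\<close>. It is made for
  arguments about lowest components.\<close>

lemma hcomp_mult_mem_iff:
  assumes J: "ideal J R" and a: "a \<in> carrier R" and b: "b \<in> carrier R"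
    and other: "\<And>k. k \<noteq> i \<Longrightarrow> k \<le> i + j \<Longrightarrow> hcomp a k \<otimes> hcomp b (i + j - k) \<in> J"
  shows "hcomp (a \<otimes> b) (i + j) \<in> J \<longleftrightarrow> hcomp a i \<otimes> hcomp b j \<in> J"
proof -
  define S where "S = {i. hcomp a i \<noteq> \<zero>} - {i}"
  have S: "finite S" "i \<notin> S" "\<And>k. k \<notin> insert i S \<Longrightarrow> hcomp a k = \<zero>"
    using hcomp_finite a by (auto simp: S_def)
  have "a \<otimes> b = (\<Oplus>k\<in>insert i S. hcomp a k) \<otimes> b"
    using S a hcomp_sum[of a "insert i S"] by simp
  also have "\<dots> = (\<Oplus>k\<in>insert i S. hcomp a k \<otimes> b)" using S a b by (subst finsum_ldistr) auto
  finally have "hcomp (a \<otimes> b) (i + j) = (\<Oplus>k\<in>insert i S. hcomp (hcomp a k \<otimes> b) (i + j))"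
    using a b hcomp_finsum[of "insert i S" "\<lambda>k. hcomp a k \<otimes> b"] by simp
  also have "\<dots> = hcomp (hcomp a i \<otimes> b) (i + j) \<oplus> (\<Oplus>k\<in>S. hcomp (hcomp a k \<otimes> b) (i + j))"
    using S a b by (intro finsum_insert) auto
  also have "hcomp (hcomp a i \<otimes> b) (i + j) = hcomp a i \<otimes> hcomp b j"
    using hcomp_mult_hom[OF hcomp_mem[OF a] b, of i "i + j"] by simp
  finally have eq: "hcomp (a \<otimes> b) (i + j) =
    hcomp a i \<otimes> hcomp b j \<oplus> (\<Oplus>k\<in>S. hcomp (hcomp a k \<otimes> b) (i + j))" .
  have rest: "(\<Oplus>k\<in>S. hcomp (hcomp a k \<otimes> b) (i + j)) \<in> J"
  proof (rule ideal_finsum_mem[OF J])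
    fix k assume "k \<in> S"
    then have "k \<noteq> i" using S by blast
    then show "hcomp (hcomp a k \<otimes> b) (i + j) \<in> J"
      using other b ideal_zero_mem[OF J] by (simp add: hcomp_mult_hom[OF hcomp_mem[OF a] b])
  qed
  show ?thesis
    using ideal_add_cancel[OF J rest, of "hcomp a i \<otimes> hcomp b j"] eq a b ideal_mem_carrier[OF J rest]
    by (simp add: a_comm)
qed

lemma hideal_primeI:
  assumes J: "hideal J" and ne: "J \<noteq> carrier R"
    and pr: "\<And>a b i j. a \<in> \<G> i \<Longrightarrow> b \<in> \<G> j \<Longrightarrow> a \<otimes> b \<in> J \<Longrightarrow> a \<in> J \<or> b \<in> J"
  shows "primeideal J R"
proof (rule primeidealI)
  have J': "ideal J R" using J by (rule hideal_ideal)
  show "ideal J R" by fact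
  show "cring R" by (rule cring_axioms)
  show "carrier R \<noteq> J" using ne by blast
  fix a b assume a: "a \<in> carrier R" and b: "b \<in> carrier R" and ab: "a \<otimes> b \<in> J"
  show "a \<in> J \<or> b \<in> J"
  proof (rule ccontr)
    assume "\<not> (a \<in> J \<or> b \<in> J)"
    then have "\<exists>i. hcomp a i \<notin> J" "\<exists>i. hcomp b i \<notin> J"
      using mem_of_hcomp_mem[OF J' a] mem_of_hcomp_mem[OF J' b] by blast+
    \<comment> \<open>These are the lowest components outside \<open>J\<close>. In degree
      \<open>i + j\<close> every other term has a factor of degree below \<open>i\<close> in
      \<open>a\<close> or below \<open>j\<close> in \<open>b\<close>, which is in
      \<open>J\<close>.\<close>
    then obtain i j where i: "hcomp a i \<notin> J" "\<And>k. k < i \<Longrightarrow> hcomp a k \<in> J"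
      and j: "hcomp b j \<notin> J" "\<And>k. k < j \<Longrightarrow> hcomp b k \<in> J"
      using exists_least_iff[of "\<lambda>i. hcomp a i \<notin> J"] exists_least_iff[of "\<lambda>i. hcomp b i \<notin> J"]
      by auto
    have "hcomp a k \<otimes> hcomp b (i + j - k) \<in> J" if "k \<noteq> i" "k \<le> i + j" for k
    proof (cases "k < i")
      case False
      then have "i + j - k < j" using that by linarith
      then show ?thesis using j a by (intro ideal_lmult_mem[OF J']) auto
    qed (use i b in \<open>auto intro: ideal_rmult_mem[OF J']\<close>)
    then have "hcomp a i \<otimes> hcomp b j \<in> J"
      using hcomp_mult_mem_iff[OF J' a b] hideal_hcomp[OF J ab, of "i + j"] by blast
    then show False using pr[OF hcomp_mem[OF a] hcomp_mem[OF b]] i j by blast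
  qed
qed

end

section \<open>Homogeneous primes and parameters\<close>

lemma (in noetherian_ring) ideal_maximal_element:
  assumes "S \<noteq> {}" "\<And>J. J \<in> S \<Longrightarrow> ideal J R"
  shows "\<exists>M\<in>S. \<forall>J\<in>S. M \<subseteq> J \<longrightarrow> J = M"
proof -
  have "\<Union>C \<in> S" if C: "C \<noteq> {}" "subset.chain S C" for C
  proof -
    have "subset.chain {J. ideal J R} C"
      using C(2) assms(2) unfolding pred_on.chain_def by blast
    then have "\<Union>C \<in> C" using C(1) ideal_chain_is_trivial by blast
    then show ?thesis using C(2) unfolding pred_on.chain_def by blast
  qed
  then show ?thesis using assms(1) by (intro subset_Zorn_nonempty) auto
qed

text \<open>Among the ideals generated by finite subsets of \<open>S\<close>, a largest possible one
  absorbs every element of \<open>S\<close>. The generators are drawn from \<open>S\<close> itself,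
  so they inherit homogeneity or a common degree.\<close>

lemma (in noetherian_ring) Idl_finite_subset:
  assumes S: "S \<subseteq> carrier R"
  obtains A where "finite A" "A \<subseteq> S" "Idl S = Idl A"
proof -
  let ?S = "{Idl A | A. finite A \<and> A \<subseteq> S}"
  have "?S \<noteq> {}" by blast
  moreover have "ideal J R" if J: "J \<in> ?S" for J
  proof -
    obtain A where A: "J = Idl A" "A \<subseteq> S" using J by blast
    then show ?thesis using S genideal_ideal[of A] by (metis order_trans)
  qed
  ultimately have "\<exists>M\<in>?S. \<forall>J\<in>?S. M \<subseteq> J \<longrightarrow> J = M" by (rule ideal_maximal_element)
  then obtain M where M: "M \<in> ?S" "\<forall>J\<in>?S. M \<subseteq> J \<longrightarrow> J = M" by (elim bexE)
  obtain A where A: "finite A" "A \<subseteq> S" "M = Idl A" using M(1) by auto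
  have max: "Idl B = Idl A" if "finite B" "B \<subseteq> S" "Idl A \<subseteq> Idl B" for B
  proof -
    have "Idl B \<in> ?S" using that by blast
    then show ?thesis using M(2) that A by simp
  qed
  have Ac: "A \<subseteq> carrier R" using A S by blast
  have "S \<subseteq> Idl A"
  proof
    fix s assume s: "s \<in> S"
    have c: "insert s A \<subseteq> carrier R" using s S Ac by blast
    have "Idl A \<subseteq> Idl (insert s A)" using c by (intro subset_Idl_subset) auto
    then have "Idl (insert s A) = Idl A" using A s by (intro max) auto
    then show "s \<in> Idl A" using genideal_self[OF c] by blast
  qed
  then have "Idl S \<subseteq> Idl A" by (rule genideal_minimal[OF genideal_ideal[OF Ac]])
  moreover have "Idl A \<subseteq> Idl S" using S A by (intro subset_Idl_subset) auto
  ultimately show ?thesis using A that by blast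
qed

lemma (in primeideal) pow_mem:
  assumes "a \<in> carrier R" "a [^] (n::nat) \<in> I"
  shows "a \<in> I"
  using assms(2)
proof (induction n)
  case 0
  then show ?case using one_imp_carrier I_notcarr by simp
next
  case (Suc n)
  then show ?case using I_prime[of "a [^] n" a] assms(1) by auto
qed

lemma (in cring) ideal_pow_mem:
  assumes "ideal J R" "a \<in> J" "n > 0"
  shows "a [^] (n::nat) \<in> J"
proof -
  obtain m where "n = Suc m" using assms(3) gr0_implies_Suc by blast
  then show ?thesis using ideal_lmult_mem[OF assms(1,2)] ideal_mem_carrier[OF assms(1,2)] by simp
qed

text \<open>In degree \<open>n\<close> only the components of degree \<open>n - d i\<close> of the
  coefficients contribute. Subtraction of naturals truncates, so the case \<open>d i > n\<close>
  gets the coefficient zero explicitly.\<close>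

lemma (in nat_graded_ring) component_mem_Idl_imageE:
  assumes A: "finite A" "\<And>i. i \<in> A \<Longrightarrow> g i \<in> \<G> (d i)" and y: "y \<in> Idl (g ` A)" "y \<in> \<G> n"
  obtains r where "\<And>i. i \<in> A \<Longrightarrow> d i \<le> n \<Longrightarrow> r i \<in> \<G> (n - d i)"
    "\<And>i. i \<in> A \<Longrightarrow> \<not> d i \<le> n \<Longrightarrow> r i = \<zero>" "y = (\<Oplus>i\<in>A. r i \<otimes> g i)"
proof -
  have gc: "g i \<in> carrier R" if "i \<in> A" for i using A that component_carrier by blast
  obtain s where s: "\<And>i. i \<in> A \<Longrightarrow> s i \<in> carrier R" "y = (\<Oplus>i\<in>A. s i \<otimes> g i)"
    using Idl_image_memE[OF A(1) gc y(1)] by blast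
  define r where "r = (\<lambda>i. if d i \<le> n then hcomp (s i) (n - d i) else \<zero>)"
  have "y = hcomp y n" using hcomp_hom[OF y(2)] by simp
  also have "\<dots> = (\<Oplus>i\<in>A. hcomp (s i \<otimes> g i) n)"
    unfolding s(2) using s gc by (intro hcomp_finsum) auto
  also have "\<dots> = (\<Oplus>i\<in>A. r i \<otimes> g i)"
  proof (rule finsum_cong')
    fix i assume i: "i \<in> A"
    have "s i \<otimes> g i = g i \<otimes> s i" using s gc i m_comm by blast
    then show "hcomp (s i \<otimes> g i) n = r i \<otimes> g i"
      using s(1)[OF i] gc[OF i] m_comm hcomp_mult_hom[OF A(2)[OF i] s(1)[OF i]] by (simp add: r_def)
  qed (use s gc in \<open>auto simp: r_def\<close>)
  finally show ?thesis
    using s by (intro that[of r]) (auto simp: r_def intro!: hcomp_mem)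
qed

context noetherian_graded_ring_over_field
begin

lemma one_mem_component_zero: "\<one> \<in> \<G> 0"
  using component_zero_field by (simp add: subfield_def subdomain_def subcring_def subringE(3) subfieldE(1))

lemma component_zero_inverse:
  assumes "a \<in> \<G> 0" "a \<noteq> \<zero>"
  obtains b where "b \<in> \<G> 0" "b \<otimes> a = \<one>"
  using subfield_m_inv[OF component_zero_field, of a] assms by blast

lemma component_pow: "a \<in> \<G> d \<Longrightarrow> a [^] (n::nat) \<in> \<G> (n * d)"
proof (induction n)
  case 0
  then show ?case using one_mem_component_zero by simp
next
  case (Suc n)
  then show ?case using component_mult[of "a [^] n" "n * d" a d] by (simp add: add.commute)
qed

lemma irrelevant_ideal_iff:
  "x \<in> irrelevant_ideal R \<G> \<longleftrightarrow> x \<in> carrier R \<and> hcomp x 0 = \<zero>"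
proof
  assume "x \<in> irrelevant_ideal R \<G>"
  then obtain S f where *: "x = (\<Oplus>i\<in>S. f i)" "S \<subseteq> {1..}" "\<And>i. i \<in> S \<Longrightarrow> f i \<in> \<G> i"
    unfolding irrelevant_ideal_def by blast
  have c: "f i \<in> carrier R" if "i \<in> S" for i using *(3)[OF that] component_carrier by blast
  have "hcomp x 0 = (\<Oplus>i\<in>S. hcomp (f i) 0)" unfolding *(1) using c by (rule hcomp_finsum)
  also have "\<dots> = \<zero>" using *(2,3) by (intro add.finprod_one_eqI) (fastforce simp: hcomp_hom)
  finally show "x \<in> carrier R \<and> hcomp x 0 = \<zero>" using * c by (auto intro!: finsum_closed)
next
  assume x: "x \<in> carrier R \<and> hcomp x 0 = \<zero>"
  let ?S = "{i. hcomp x i \<noteq> \<zero>}"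
  have "?S \<subseteq> {1..}"
  proof
    fix i assume "i \<in> ?S"
    then show "i \<in> {1..}" using x by (cases i) auto
  qed
  then show "x \<in> irrelevant_ideal R \<G>"
    using hcomp_spec[of x] x unfolding irrelevant_ideal_def by blast
qed

lemma component_mem_irrelevant: "a \<in> \<G> d \<Longrightarrow> d > 0 \<Longrightarrow> a \<in> irrelevant_ideal R \<G>"
  by (simp add: irrelevant_ideal_iff component_carrier hcomp_hom)

lemma hideal_irrelevant: "hideal (irrelevant_ideal R \<G>)"
proof -
  have "hcomp (r \<otimes> a) 0 = \<zero>" if a: "a \<in> carrier R" "hcomp a 0 = \<zero>" and r: "r \<in> carrier R" for a r
  proof -
    have "hcomp (r \<otimes> a) (0 + 0) \<in> {\<zero>} \<longleftrightarrow> hcomp r 0 \<otimes> hcomp a 0 \<in> {\<zero>}"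
      by (rule hcomp_mult_mem_iff[OF zeroideal r a(1)]) auto
    then show ?thesis using a r by simp
  qed
  then have "ideal (irrelevant_ideal R \<G>) R"
    by (intro idealI') (auto simp: irrelevant_ideal_iff hcomp_add)
  moreover have "hcomp x i \<in> irrelevant_ideal R \<G>" if "x \<in> irrelevant_ideal R \<G>" for x i
    using that hcomp_hom[OF hcomp_mem, of x i 0] by (auto simp: irrelevant_ideal_iff)
  ultimately show ?thesis by (simp add: hideal_def)
qed

text \<open>A nonzero component of degree zero is a unit, because \<open>\<G> 0\<close> is a field,
  and it would lie in \<open>J\<close> together with its element.\<close>

lemma hideal_subset_irrelevant:
  assumes J: "hideal J" "J \<noteq> carrier R"
  shows "J \<subseteq> irrelevant_ideal R \<G>"
proof
  fix x assume x: "x \<in> J"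
  have J': "ideal J R" using J hideal_ideal by blast
  have xc: "x \<in> carrier R" using x J' ideal_mem_carrier by blast
  have "hcomp x 0 = \<zero>"
  proof (rule ccontr)
    assume "hcomp x 0 \<noteq> \<zero>"
    then obtain b where b: "b \<in> \<G> 0" "b \<otimes> hcomp x 0 = \<one>"
      using component_zero_inverse hcomp_mem[OF xc] by blast
    have "b \<otimes> hcomp x 0 \<in> J"
      using b(1) hideal_hcomp[OF J(1) x] component_carrier by (intro ideal_lmult_mem[OF J']) auto
    then show False using b J ideal.one_imp_carrier[OF J'] by simp
  qed
  then show "x \<in> irrelevant_ideal R \<G>" using xc by (simp add: irrelevant_ideal_iff)
qed

lemma hideal_proper_not_homogeneous_subset:
  assumes J: "hideal J" "\<not> irrelevant_ideal R \<G> \<subseteq> J"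
  obtains z d where "z \<in> \<G> d" "d > 0" "z \<notin> J"
proof -
  obtain x where x: "x \<in> irrelevant_ideal R \<G>" "x \<notin> J" using J by blast
  have xc: "x \<in> carrier R" using x irrelevant_ideal_iff by blast
  then obtain i where i: "hcomp x i \<notin> J" using mem_of_hcomp_mem[OF hideal_ideal[OF J(1)] xc] x by blast
  moreover have "i \<noteq> 0"
  proof
    assume "i = 0"
    then show False using i x ideal_zero_mem[OF hideal_ideal[OF J(1)]]
      by (simp add: irrelevant_ideal_iff)
  qed
  ultimately show ?thesis using that[of "hcomp x i" i] hcomp_mem[OF xc] by blast
qed

text \<open>Primary decomposition is not needed: it suffices that a homogeneous ideal contains a finite
  product of homogeneous primes above it.\<close>

definition lprod :: "'a list \<Rightarrow> 'a" where
  "lprod bs = foldr (\<otimes>) bs \<one>"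

lemma lprod_simps [simp]: "lprod [] = \<one>" "lprod (b # bs) = b \<otimes> lprod bs"
  by (simp_all add: lprod_def)

lemma lprod_closed [simp]: "set bs \<subseteq> carrier R \<Longrightarrow> lprod bs \<in> carrier R"
  by (induction bs) auto

lemma lprod_append: "set as \<subseteq> carrier R \<Longrightarrow> set bs \<subseteq> carrier R \<Longrightarrow> lprod (as @ bs) = lprod as \<otimes> lprod bs"
  by (induction as) (auto simp: m_assoc)

text \<open>A product of primes inside \<open>J\<close>, tested on one element from each factor.
  Multiplicity is repetition in the list; the empty list puts \<open>\<one>\<close> into
  \<open>J\<close> and so belongs to the unit ideal.\<close>

definition prime_factors_list :: "'a set \<Rightarrow> 'a set list \<Rightarrow> bool" where
  "prime_factors_list J Ps \<longleftrightarrow> (\<forall>P\<in>set Ps. hideal P \<and> primeideal P R \<and> J \<subseteq> P) \<and>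
    (\<forall>bs. list_all2 (\<in>) bs Ps \<longrightarrow> lprod bs \<in> J)"

text \<open>Noetherian induction. A maximal counterexample \<open>M\<close> is proper and not prime,
  so it contains a product of homogeneous \<open>a\<close> and \<open>b\<close> outside
  \<open>M\<close>. The lists for M + (a) and M + (b) can be concatenated, since the product of
  these two ideals lies in \<open>M\<close>.\<close>

lemma ex_prime_factors_list:
  assumes "hideal J"
  shows "\<exists>Ps. prime_factors_list J Ps"
proof (rule ccontr)
  let ?good = "\<lambda>J. \<exists>Ps. prime_factors_list J Ps"
  define Bad where "Bad = {J. hideal J \<and> \<not> ?good J}"
  assume "\<not> ?good J"
  then have "Bad \<noteq> {}" using assms Bad_def by blast
  moreover have "ideal J R" if "J \<in> Bad" for J using that hideal_ideal Bad_def by blast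
  ultimately have "\<exists>M\<in>Bad. \<forall>J\<in>Bad. M \<subseteq> J \<longrightarrow> J = M" by (rule ideal_maximal_element)
  then obtain M where MX: "M \<in> Bad" and max: "\<forall>J\<in>Bad. M \<subseteq> J \<longrightarrow> J = M" by (elim bexE)
  then have M: "hideal M" "\<not> ?good M" by (simp_all add: Bad_def)
  have M': "ideal M R" using M hideal_ideal by blast
  have Mc: "M \<subseteq> carrier R" using M' ideal_mem_carrier by blast
  have "M \<noteq> carrier R"
  proof
    assume "M = carrier R"
    then have "?good M" by (intro exI[of _ "[]"]) (auto simp: prime_factors_list_def)
    then show False using M by blast
  qed
  moreover have "\<not> primeideal M R"
  proof
    assume P: "primeideal M R"
    have "lprod bs \<in> M" if "list_all2 (\<in>) bs [M]" for bs
      using that Mc by (auto simp: list_all2_Cons2)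
    then have "?good M" using P M by (intro exI[of _ "[M]"]) (auto simp: prime_factors_list_def)
    then show False using M by blast
  qed
  ultimately have "\<exists>a b i j. a \<in> \<G> i \<and> b \<in> \<G> j \<and> a \<otimes> b \<in> M \<and> a \<notin> M \<and> b \<notin> M"
    using hideal_primeI[OF M(1)] by metis
  then obtain a b i j where ab: "a \<in> \<G> i" "b \<in> \<G> j" "a \<otimes> b \<in> M" "a \<notin> M" "b \<notin> M"
    by blast
  have c: "a \<in> carrier R" "b \<in> carrier R" using ab component_carrier by blast+
  have good: "?good (Idl (insert z M))" if z: "z \<in> \<G> k" "z \<notin> M" for z k
  proof (rule ccontr)
    assume *: "\<not> ?good (Idl (insert z M))"
    have "insert z M \<subseteq> Idl (insert z M)" using z Mc component_carrier by (intro genideal_self) auto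
    then show False using max hideal_add_principal[OF M(1) z(1)] * z by (auto simp: Bad_def)
  qed
  obtain Ps where Ps: "\<forall>P\<in>set Ps. hideal P \<and> primeideal P R \<and> Idl (insert a M) \<subseteq> P"
    "\<And>bs. list_all2 (\<in>) bs Ps \<Longrightarrow> lprod bs \<in> Idl (insert a M)"
    using good[OF ab(1,4)] unfolding prime_factors_list_def by auto
  obtain Qs where Qs: "\<forall>P\<in>set Qs. hideal P \<and> primeideal P R \<and> Idl (insert b M) \<subseteq> P"
    "\<And>bs. list_all2 (\<in>) bs Qs \<Longrightarrow> lprod bs \<in> Idl (insert b M)"
    using good[OF ab(2,5)] unfolding prime_factors_list_def by auto
  have sub: "M \<subseteq> Idl (insert a M)" "M \<subseteq> Idl (insert b M)"
    using genideal_self[of "insert a M"] genideal_self[of "insert b M"] c Mc by auto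
  have "lprod bs \<in> M" if bs: "list_all2 (\<in>) bs (Ps @ Qs)" for bs
  proof -
    obtain as cs where cs: "bs = as @ cs" "list_all2 (\<in>) as Ps" "list_all2 (\<in>) cs Qs"
      using bs by (auto simp: list_all2_append2)
    have carr: "set xs \<subseteq> carrier R" if "list_all2 (\<in>) xs Xs" "\<forall>P\<in>set Xs. hideal P" for xs Xs
      using that
    proof (induction xs Xs rule: list_all2_induct)
      case (Cons x xs y ys)
      then show ?case using ideal_mem_carrier[OF hideal_ideal] by auto
    qed auto
    have cc: "set as \<subseteq> carrier R" "set cs \<subseteq> carrier R"
      using carr[OF cs(2)] carr[OF cs(3)] Ps(1) Qs(1) by blast+
    obtain r m where r: "r \<in> carrier R" "m \<in> M" "lprod as = r \<otimes> a \<oplus> m"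
      using Idl_insert_memE[OF M' c(1) Ps(2)[OF cs(2)]] by blast
    obtain s l where s: "s \<in> carrier R" "l \<in> M" "lprod cs = s \<otimes> b \<oplus> l"
      using Idl_insert_memE[OF M' c(2) Qs(2)[OF cs(3)]] by blast
    have mc: "m \<in> carrier R" "l \<in> carrier R" using r s Mc by auto
    have "lprod as \<otimes> lprod cs = (r \<otimes> s) \<otimes> (a \<otimes> b) \<oplus> ((r \<otimes> a) \<otimes> l \<oplus> (s \<otimes> b \<oplus> l) \<otimes> m)"
      unfolding r(3) s(3) using r(1) s(1) c mc by (simp add: l_distr r_distr m_ac a_ac)
    also have "\<dots> \<in> M"
      using r(1,2) s(1,2) c mc ab(3) by (simp add: ideal_add_mem[OF M'] ideal_lmult_mem[OF M'])
    finally show ?thesis using cs(1) cc by (simp add: lprod_append)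
  qed
  moreover have "\<forall>P\<in>set Ps. M \<subseteq> P" "\<forall>P\<in>set Qs. M \<subseteq> P"
    using Ps(1) Qs(1) subset_trans[OF sub(1)] subset_trans[OF sub(2)] by blast+
  ultimately have "prime_factors_list M (Ps @ Qs)"
    using Ps(1) Qs(1) unfolding prime_factors_list_def by auto
  then show False using M by blast
qed

end

section \<open>Primes above I and the dimension of R/I\<close>

context cring
begin

lemma quot_image_mem_iff:
  assumes I: "ideal I R" and P: "ideal P R" "I \<subseteq> P" and a: "a \<in> carrier R"
  shows "I +> a \<in> (+>) I ` P \<longleftrightarrow> a \<in> P"
proof
  assume "I +> a \<in> (+>) I ` P"
  then obtain c where c: "c \<in> P" "I +> a = I +> c" by blast
  have cc: "c \<in> carrier R" using c P ideal_mem_carrier by blast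
  have "a \<ominus> c \<in> I" using quotient_eq_iff_same_a_r_cos[OF I a cc] c by simp
  then show "a \<in> P" using ideal_minus_iff[OF P(1) a cc] P(2) c(1) by blast
qed blast

lemma prime_quot_image:
  assumes I: "ideal I R" and P: "primeideal P R" "I \<subseteq> P"
  shows "primeideal ((+>) I ` P) (R Quot I)"
proof (rule primeidealI)
  interpret P: primeideal P R by fact
  interpret I: ideal I R by fact
  show "ideal ((+>) I ` P) (R Quot I)" by (rule ring_ideal_imp_quot_ideal[OF I P.is_ideal])
  show "cring (R Quot I)" by (rule I.quotient_is_cring[OF cring_axioms])
  have C: "carrier (R Quot I) = (+>) I ` carrier R"
    by (auto simp: FactRing_def A_RCOSETS_def' a_r_coset_def')
  obtain a where a: "a \<in> carrier R" "a \<notin> P" using P.I_notcarr P.Icarr by blast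
  then have "I +> a \<notin> (+>) I ` P" using quot_image_mem_iff[OF I P.is_ideal P(2)] by blast
  then show "carrier (R Quot I) \<noteq> (+>) I ` P" using a C by blast
  fix A B assume "A \<in> carrier (R Quot I)" "B \<in> carrier (R Quot I)"
    and AB: "A \<otimes>\<^bsub>R Quot I\<^esub> B \<in> (+>) I ` P"
  then obtain a b where ab: "a \<in> carrier R" "b \<in> carrier R" "A = I +> a" "B = I +> b"
    unfolding C by blast
  then have "I +> (a \<otimes> b) \<in> (+>) I ` P"
    using AB by (simp add: FactRing_def I.rcoset_mult_add)
  then have "a \<otimes> b \<in> P" using quot_image_mem_iff[OF I P.is_ideal P(2)] ab by simp
  then show "A \<in> (+>) I ` P \<or> B \<in> (+>) I ` P" using P.I_prime ab by blast
qed

text \<open>This is how dimension one acts on primes: three primes in a chain above \<open>I\<close>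
  have images that form a chain of length 2 in the quotient.\<close>

lemma quot_dim_one_no_chain:
  assumes dim: "krull_dim (R Quot I) = 1" and I: "ideal I R"
    and P: "primeideal P R" "primeideal Q R" "primeideal M R" "I \<subseteq> P" "P \<subset> Q" "Q \<subset> M"
  shows False
proof -
  define C where "C = (\<lambda>i::nat. (+>) I ` (if i = 0 then P else if i = 1 then Q else M))"
  have id: "ideal P R" "ideal Q R" "ideal M R" using P by (simp_all add: primeideal.axioms)
  have st: "(+>) I ` X1 \<subset> (+>) I ` Y1"
    if X: "ideal X1 R" "ideal Y1 R" "I \<subseteq> X1" "X1 \<subset> Y1" for X1 Y1
  proof -
    obtain a where a: "a \<in> Y1" "a \<notin> X1" using X by blast
    then have "I +> a \<notin> (+>) I ` X1"
      using quot_image_mem_iff[OF I X(1,3)] ideal_mem_carrier[OF X(2)] by blast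
    then show ?thesis using a X(4) by blast
  qed
  have "I \<subseteq> Q" "I \<subseteq> M" using P by auto
  then have "primeideal (C i) (R Quot I)" for i
    unfolding C_def using P prime_quot_image[OF I] by auto
  moreover have "C i \<subset> C (Suc i)" if "i < 2" for i
    using that st[OF id(1,2) P(4,5)] st[OF id(2,3) \<open>I \<subseteq> Q\<close> P(6)]
    by (cases i) (auto simp: C_def)
  ultimately have "enat 2 \<le> krull_dim (R Quot I)"
    unfolding krull_dim_def by (intro SUP_upper) auto
  then show False using dim by (simp add: one_enat_def)
qed

text \<open>The zero ring has no primes, so its \<open>krull_dim\<close> is a supremum over the
  empty set, which is 0 in \<open>enat\<close> and differs from 1.\<close>

lemma quot_dim_one_proper:
  assumes dim: "krull_dim (R Quot I) = 1" and I: "ideal I R"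
  shows "I \<noteq> carrier R"
proof
  assume *: "I = carrier R"
  interpret I: ideal I R by fact
  have C: "carrier (R Quot I) = {\<zero>\<^bsub>R Quot I\<^esub>}"
    using I.a_rcos_const by (auto simp: FactRing_def A_RCOSETS_def' * a_rcos_zero[OF oneideal]) 
  have "\<not> primeideal P (R Quot I)" for P
  proof
    assume "primeideal P (R Quot I)"
    then interpret P: primeideal P "R Quot I" .
    have "\<zero>\<^bsub>R Quot I\<^esub> \<in> P" 
      by (rule ring.ideal_zero_mem[OF I.quotient_is_ring P.is_ideal])
    then show False using P.I_notcarr P.a_subset C by auto
  qed
  then have "krull_dim (R Quot I) = 0"
  proof -
    assume no: "\<And>P. \<not> primeideal P (R Quot I)"
    have "{n :: nat. \<exists>P. (\<forall>i\<le>n. primeideal (P i) (R Quot I)) \<and> (\<forall>i<n. P i \<subset> P (Suc i))} = {}"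
      using no by blast
    then show ?thesis unfolding krull_dim_def by (simp only: image_empty) (simp add: bot_enat_def)
  qed
  then show False using dim by simp
qed

end

section \<open>Homogeneous prime avoidance and a parameter modulo I\<close>

context noetherian_graded_ring_over_field
begin

text \<open>From each \<open>Q\<close> take an element outside \<open>P\<close> and replace it by a
  component that is still outside \<open>P\<close>; the product of these stays outside
  \<open>P\<close> by primality.\<close>

lemma homogeneous_in_all_not_in_prime:
  assumes "finite Y" "\<And>Q. Q \<in> Y \<Longrightarrow> hideal Q \<and> \<not> Q \<subseteq> P" "primeideal P R"
  shows "\<exists>z k. z \<in> \<G> k \<and> z \<notin> P \<and> (\<forall>Q\<in>Y. z \<in> Q)"
  using assms(1,2)
proof (induction Y rule: finite_induct)
  case empty
  have "\<one> \<notin> P" using assms(3) ideal.one_imp_carrier primeideal.axioms(1) primeideal.I_notcarr by metis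
  then show ?case using one_mem_component_zero by blast
next
  case (insert Q Y)
  interpret P: primeideal P R by fact
  obtain z k where z: "z \<in> \<G> k" "z \<notin> P" "\<forall>Q\<in>Y. z \<in> Q" using insert by auto
  obtain q where q: "q \<in> Q" "q \<notin> P" using insert by blast
  have Q: "hideal Q" using insert by blast
  have qc: "q \<in> carrier R" using q Q ideal_mem_carrier hideal_ideal by blast
  obtain i where i: "hcomp q i \<notin> P" using mem_of_hcomp_mem[OF P.is_ideal qc] q by blast
  have zc: "z \<in> carrier R" using z component_carrier by blast
  have "z \<otimes> hcomp q i \<in> \<G> (k + i)" using z qc by (intro component_mult hcomp_mem)
  moreover have "z \<otimes> hcomp q i \<notin> P" using P.I_prime[OF zc hcomp_closed[OF qc]] z i by blast
  moreover have "z \<otimes> hcomp q i \<in> Q"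
    by (rule ideal_lmult_mem[OF hideal_ideal[OF Q] hideal_hcomp[OF Q q(1)] zc])
  moreover have "z \<otimes> hcomp q i \<in> Q'" if "Q' \<in> Y" for Q'
    using that z insert.prems qc by (intro ideal_rmult_mem) (auto intro: hideal_ideal)
  ultimately show ?case by blast
qed

text \<open>The field may be finite, so general linear combinations are not at hand. If one prime is
  contained in another, the smaller one is dropped. Otherwise an element avoiding all primes but
  \<open>P\<close> is corrected by an element of all the others outside \<open>P\<close>, after both
  are raised to powers of equal degree.\<close>

lemma homogeneous_prime_avoidance:
  assumes "finite Y" "\<And>P. P \<in> Y \<Longrightarrow> hideal P \<and> primeideal P R \<and> \<not> irrelevant_ideal R \<G> \<subseteq> P"
  shows "\<exists>x d. d > 0 \<and> x \<in> \<G> d \<and> (\<forall>P\<in>Y. x \<notin> P)"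
  using assms
proof (induction "card Y" arbitrary: Y rule: less_induct)
  case less
  show ?case
  proof (cases "\<exists>P\<in>Y. \<exists>P'\<in>Y. P \<noteq> P' \<and> P \<subseteq> P'")
    case True
    then obtain P P' where P: "P \<in> Y" "P' \<in> Y" "P \<noteq> P'" "P \<subseteq> P'" by blast
    have "card (Y - {P}) < card Y" using P less.prems(1) by (intro psubset_card_mono) auto
    then obtain x d where x: "d > 0" "x \<in> \<G> d" "\<forall>Q\<in>Y-{P}. x \<notin> Q"
      using less.hyps[of "Y - {P}"] less.prems by auto
    then have "x \<notin> P" using P by blast
    then show ?thesis using x by blast
  next
    case anti: False
    show ?thesis
    proof (cases "Y = {}")
      case True
      \<comment> \<open>With no prime to avoid, the zero element counted in degree 1 will
        do.\<close>
      then show ?thesis using component_zero[of 1] by (metis empty_iff zero_less_one)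
    next
      case False
      then obtain P where P: "P \<in> Y" by blast
      have Pp: "hideal P" "primeideal P R" "\<not> irrelevant_ideal R \<G> \<subseteq> P" using less.prems P by blast+
      interpret P: primeideal P R by fact
      have "card (Y - {P}) < card Y" using P less.prems(1) by (intro psubset_card_mono) auto
      then obtain x d where x: "d > 0" "x \<in> \<G> d" "\<forall>Q\<in>Y-{P}. x \<notin> Q"
        using less.hyps[of "Y - {P}"] less.prems by auto
      show ?thesis
      proof (cases "x \<in> P")
        case False
        then show ?thesis using x by blast
      next
        case xP: True
        \<comment> \<open>The factor \<open>z0\<close> makes the degree of \<open>z\<close>
          positive, as \<open>z1\<close> below may have degree zero.\<close>
        obtain z0 e0 where z0: "z0 \<in> \<G> e0" "e0 > 0" "z0 \<notin> P"
          using hideal_proper_not_homogeneous_subset[OF Pp(1,3)] .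
        have "\<exists>z k. z \<in> \<G> k \<and> z \<notin> P \<and> (\<forall>Q\<in>Y-{P}. z \<in> Q)"
          using less.prems anti P Pp by (intro homogeneous_in_all_not_in_prime) auto
        then obtain z1 k where z1: "z1 \<in> \<G> k" "z1 \<notin> P" "\<forall>Q\<in>Y-{P}. z1 \<in> Q" by blast
        define z where "z = z0 \<otimes> z1"
        define e where "e = e0 + k"
        have c: "z0 \<in> carrier R" "z1 \<in> carrier R" "x \<in> carrier R" "z \<in> carrier R"
          using z0 z1 x component_carrier by (auto simp: z_def)
        have z: "z \<in> \<G> e" "e > 0" "z \<notin> P"
          using z0 z1 component_mult P.I_prime[OF c(1,2)] by (auto simp: z_def e_def)
        have zQ: "z \<in> Q" if "Q \<in> Y - {P}" for Q
          using that z1 less.prems(2)[of Q] ideal_lmult_mem[of Q z1 z0] c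
            by (auto simp: z_def hideal_ideal)
        \<comment> \<open>Both powers have degree \<open>e * d\<close>. In \<open>P\<close> only the
          first summand lies, in each other prime of \<open>Y\<close> only the second, so the sum
          lies in none of them.\<close>
        define y where "y = x [^] e \<oplus> z [^] d"
        have "y \<in> \<G> (e * d)"
          unfolding y_def using component_pow[OF x(2), of e] component_pow[OF z(1), of d]
          by (intro component_add) (simp_all add: mult.commute)
        moreover have "y \<notin> P"
        proof
          assume "y \<in> P"
          moreover have "x [^] e \<in> P" using xP z by (intro ideal_pow_mem[OF P.is_ideal])
          ultimately have "z [^] d \<in> P"
            unfolding y_def using ideal_add_cancel[OF P.is_ideal] c by simp
          then show False using P.pow_mem[OF c(4)] z by blast
        qed
        moreover have "y \<notin> Q" if Q: "Q \<in> Y - {P}" for Q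
        proof
          assume yQ: "y \<in> Q"
          have Qp: "primeideal Q R" using Q less.prems by blast
          then have Qi: "ideal Q R" by (rule primeideal.axioms)
          have "z [^] d \<in> Q" using zQ[OF Q] x by (intro ideal_pow_mem[OF Qi])
          moreover have "y = z [^] d \<oplus> x [^] e" unfolding y_def using c by (simp add: a_comm)
          ultimately have "x [^] e \<in> Q"
            using ideal_add_cancel[OF Qi, of "z [^] d" "x [^] e"] c yQ by simp
          then show False using primeideal.pow_mem[OF Qp c(3)] x(3) Q by blast
        qed
        moreover have "e * d > 0" using x z by simp
        ultimately show ?thesis by blast
      qed
    qed
  qed
qed

lemma prime_factors_listD:
  assumes "prime_factors_list J Ps" "P \<in> set Ps"
  shows "hideal P" "primeideal P R" "J \<subseteq> P"
  using assms by (auto simp: prime_factors_list_def)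

text \<open>Otherwise each listed prime has an element outside \<open>Q\<close>, and the product of
  these lies in \<open>J\<close>, hence in \<open>Q\<close>, against primality. In particular every
  minimal prime over \<open>J\<close> is listed, so these primes are homogeneous and finite in
  number.\<close>

lemma prime_contains_factor:
  assumes Ps: "prime_factors_list J Ps" and Q: "primeideal Q R" "J \<subseteq> Q"
  obtains P where "P \<in> set Ps" "P \<subseteq> Q"
proof -
  interpret Q: primeideal Q R by fact
  have "\<exists>P\<in>set Ps. P \<subseteq> Q"
  proof (rule ccontr)
    assume no: "\<not> (\<exists>P\<in>set Ps. P \<subseteq> Q)"
    have "\<exists>bs. list_all2 (\<in>) bs Ps \<and> set bs \<subseteq> carrier R \<and> lprod bs \<notin> Q"
      if "\<forall>P\<in>set Ps. hideal P \<and> \<not> P \<subseteq> Q" for Ps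
      using that
    proof (induction Ps)
      case Nil
      have "\<one> \<notin> Q" using Q.one_imp_carrier Q.I_notcarr by blast
      then show ?case by simp
    next
      case (Cons P Ps)
      obtain bs where bs: "list_all2 (\<in>) bs Ps" "set bs \<subseteq> carrier R" "lprod bs \<notin> Q"
        using Cons by auto
      obtain b where b: "b \<in> P" "b \<notin> Q" using Cons.prems by auto
      have "b \<in> carrier R" using b Cons.prems ideal_mem_carrier hideal_ideal by auto
      then show ?case using bs b Q.I_prime[of b "lprod bs"] by (intro exI[of _ "b # bs"]) auto
    qed
    then show False using Ps no Q(2) unfolding prime_factors_list_def by blast
  qed
  then show ?thesis using that by blast
qed

text \<open>A homogeneous element of degree at least (k+1)D is a combination of generators with
  coefficients of degree at least kD. Passing to the colon ideal of a generator turns the hypothesis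
  on k+1 factors into one on k factors.\<close>

lemma products_mem_imp_high_degree_mem:
  assumes z: "finite Z" "Z \<subseteq> irrelevant_ideal R \<G>" "irrelevant_ideal R \<G> = Idl Z"
    "\<And>z. z \<in> Z \<Longrightarrow> z \<in> \<G> (d z)" "\<And>z. z \<in> Z \<Longrightarrow> d z \<le> D" "D > 0"
  shows "\<lbrakk>ideal J R; \<And>bs. length bs = k \<Longrightarrow> set bs \<subseteq> irrelevant_ideal R \<G> \<Longrightarrow> lprod bs \<in> J;
    y \<in> \<G> n; n \<ge> k * D\<rbrakk> \<Longrightarrow> y \<in> J"
proof (induction k arbitrary: J y n)
  case 0
  have "\<one> \<in> J" using 0(2)[of "[]"] by simp
  then show ?case using 0 ideal.one_imp_carrier component_carrier by blast
next
  case (Suc k)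
  have mc: "\<And>a. a \<in> irrelevant_ideal R \<G> \<Longrightarrow> a \<in> carrier R" by (simp add: irrelevant_ideal_iff)
  have "n > 0" using Suc.prems z(6) by (metis gr_zeroI le_zero_eq mult_is_0 nat.simps(3) neq0_conv)
  then have "y \<in> irrelevant_ideal R \<G>" using Suc.prems component_mem_irrelevant by blast
  then have "y \<in> Idl (id ` Z)" using z(3) by simp
  then obtain r where r: "\<And>i. i \<in> Z \<Longrightarrow> d i \<le> n \<Longrightarrow> r i \<in> \<G> (n - d i)" "y = (\<Oplus>i\<in>Z. r i \<otimes> id i)"
    using component_mem_Idl_imageE[of Z id d y n] z(1,4) Suc.prems(3) by auto
  have "r i \<otimes> id i \<in> J" if i: "i \<in> Z" for i
  proof -
    have ic: "i \<in> carrier R" "i \<in> irrelevant_ideal R \<G>" using i z mc by auto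
    let ?J = "{r \<in> carrier R. r \<otimes> i \<in> J}"
    have le: "d i \<le> n" "k * D \<le> n - d i" using z(5)[OF i] Suc.prems(4) by simp_all
    have "r i \<in> ?J"
    proof (rule Suc.IH[OF colon_ideal[OF Suc.prems(1) ic(1)] _ r(1)[OF i le(1)] le(2)])
      fix bs assume bs: "length bs = k" "set bs \<subseteq> irrelevant_ideal R \<G>"
      have "set bs \<subseteq> carrier R" using bs mc by blast
      moreover from this have "lprod (i # bs) = lprod bs \<otimes> i" using ic by (simp add: m_comm)
      ultimately show "lprod bs \<in> ?J" using Suc.prems(2)[of "i # bs"] bs ic by simp
    qed
    then show ?thesis by simp
  qed
  then show ?case unfolding r(2) by (rule ideal_finsum_mem[OF Suc.prems(1)])
qed

text \<open>Every listed prime is the irrelevant ideal, so \<open>J\<close> contains a power of it,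
  and this power contains all components of large degree.\<close>

lemma primes_irrelevant_imp_high_degree_mem:
  assumes J: "hideal J" and Q: "\<And>Q. hideal Q \<Longrightarrow> primeideal Q R \<Longrightarrow> J \<subseteq> Q \<Longrightarrow> Q = irrelevant_ideal R \<G>"
  obtains N where "\<And>n y. n \<ge> N \<Longrightarrow> y \<in> \<G> n \<Longrightarrow> y \<in> J"
proof -
  let ?m = "irrelevant_ideal R \<G>"
  obtain Ps where Ps: "prime_factors_list J Ps" using ex_prime_factors_list[OF J] by blast
  have Pm: "\<forall>P\<in>set Ps. P = ?m" using prime_factors_listD[OF Ps] Q by blast
  have "lprod bs \<in> J" if "length bs = length Ps" "set bs \<subseteq> ?m" for bs
  proof -
    have "list_all2 (\<in>) bs Ps" using that Pm unfolding list_all2_conv_all_nth by (metis nth_mem subsetD)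
    then show ?thesis using Ps by (auto simp: prime_factors_list_def)
  qed
  note prod = this
  let ?H = "?m \<inter> (\<Union>i. \<G> i)"
  have Hc: "?H \<subseteq> carrier R" using component_carrier by blast
  obtain Z where Z: "finite Z" "Z \<subseteq> ?H" "Idl ?H = Idl Z" using Idl_finite_subset[OF Hc] .
  have mZ: "?m = Idl Z" using hideal_eq_Idl[OF hideal_irrelevant] Z(3) by simp
  have "\<forall>z\<in>Z. \<exists>i. z \<in> \<G> i" using Z by blast
  then obtain d where d: "\<And>z. z \<in> Z \<Longrightarrow> z \<in> \<G> (d z)" by metis
  define D where "D = Suc (Max (insert 0 (d ` Z)))"
  have "d z \<le> D" if "z \<in> Z" for z using that Z(1) by (auto simp: D_def intro!: le_SucI Max_ge)
  then have "y \<in> J" if "n \<ge> length Ps * D" "y \<in> \<G> n" for n y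
    using products_mem_imp_high_degree_mem[OF Z(1) _ mZ d _ _ hideal_ideal[OF J] prod that(2,1)] Z(2)
    by (auto simp: D_def)
  then show ?thesis using that by blast
qed

text \<open>Finite dimension of \<open>\<G> n\<close> over the field: the ideal generated by
  \<open>\<G> n\<close> has finitely many generators inside \<open>\<G> n\<close>, and in degree
  \<open>n\<close> their coefficients have degree zero.\<close>

lemma component_finitely_generated:
  "\<exists>B\<subseteq>\<G> n. finite B \<and>
    (\<forall>y\<in>\<G> n. \<exists>r. (\<forall>b\<in>B. r b \<in> \<G> 0) \<and> y = (\<Oplus>b\<in>B. r b \<otimes> b))"
proof -
  have c: "\<G> n \<subseteq> carrier R" using component_carrier by blast
  obtain B where B: "finite B" "B \<subseteq> \<G> n" "Idl (\<G> n) = Idl B" using Idl_finite_subset[OF c] .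
  have "\<exists>r. (\<forall>b\<in>B. r b \<in> \<G> 0) \<and> y = (\<Oplus>b\<in>B. r b \<otimes> b)" if y: "y \<in> \<G> n" for y
  proof -
    have "y \<in> Idl (id ` B)" using y genideal_self[OF c] B by auto
    then obtain r where "\<And>i. i \<in> B \<Longrightarrow> n \<le> n \<Longrightarrow> r i \<in> \<G> (n - n)" "y = (\<Oplus>i\<in>B. r i \<otimes> id i)"
      using component_mem_Idl_imageE[of B id "\<lambda>_. n" y n] B(1,2) y by auto
    then show ?thesis by auto
  qed
  then show ?thesis using B by blast
qed

lemma primeideal_irrelevant: "primeideal (irrelevant_ideal R \<G>) R"
proof (rule hideal_primeI[OF hideal_irrelevant])
  have "subfield (\<G> 0) R" by (rule component_zero_field)
  then have one: "\<one> \<noteq> \<zero>" by (rule subfieldE(6))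
  then have "\<one> \<notin> irrelevant_ideal R \<G>"
    using hcomp_hom[OF one_mem_component_zero, of 0] by (simp add: irrelevant_ideal_iff)
  then show "irrelevant_ideal R \<G> \<noteq> carrier R" by auto
  fix a b i j assume ab: "a \<in> \<G> i" "b \<in> \<G> j" "a \<otimes> b \<in> irrelevant_ideal R \<G>"
  show "a \<in> irrelevant_ideal R \<G> \<or> b \<in> irrelevant_ideal R \<G>"
  proof (cases "i = 0 \<and> j = 0")
    case True
    then have z: "a \<otimes> b = \<zero>"
      using ab component_mult[OF ab(1,2)] hcomp_hom[of "a \<otimes> b" 0 0] by (simp add: irrelevant_ideal_iff)
    have c: "a \<in> carrier R" "b \<in> carrier R" using ab component_carrier by blast+
    have "b = \<zero>" if na: "a \<noteq> \<zero>"
    proof -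
      obtain a' where a': "a' \<in> \<G> 0" "a' \<otimes> a = \<one>" using component_zero_inverse ab True na by blast
      have a'c: "a' \<in> carrier R" using a' component_carrier by blast
      have "b = (a' \<otimes> a) \<otimes> b" using a' c by simp
      also have "\<dots> = a' \<otimes> (a \<otimes> b)" using a'c c m_assoc by blast
      finally show ?thesis using z a'c by simp
    qed
    then show ?thesis using ideal_zero_mem[OF hideal_ideal[OF hideal_irrelevant]] by blast
  qed (use ab component_mem_irrelevant in blast)
qed

text \<open>Choose \<open>x\<close> outside all listed primes of \<open>I\<close> other than the
  irrelevant ideal. A homogeneous prime containing \<open>x\<close> and \<open>I\<close>, if not the
  irrelevant ideal, would lie strictly between a listed prime and the irrelevant ideal, which
  dimension one forbids.\<close>

lemma ex_homogeneous_parameter: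
  assumes I: "hideal I" and dim: "krull_dim (R Quot I) = 1"
  shows "\<exists>x d N. d > 0 \<and> x \<in> \<G> d \<and> (\<forall>n\<ge>N. \<G> n \<subseteq> Idl (insert x I))"
proof -
  let ?m = "irrelevant_ideal R \<G>"
  have I': "ideal I R" using I by (rule hideal_ideal)
  obtain Ps where Ps: "prime_factors_list I Ps" using ex_prime_factors_list[OF I] by blast
  note PsD = prime_factors_listD[OF Ps]
  have sub: "Q \<subseteq> ?m" if "hideal Q" "primeideal Q R" for Q
    using hideal_subset_irrelevant[OF that(1)] primeideal.I_notcarr[OF that(2)] by blast
  define Y where "Y = {P \<in> set Ps. P \<noteq> ?m}"
  have "\<not> ?m \<subseteq> P" if "P \<in> Y" for P using that sub PsD(1,2) by (auto simp: Y_def)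
  then obtain x d where x: "d > 0" "x \<in> \<G> d" "\<forall>P\<in>Y. x \<notin> P"
    using homogeneous_prime_avoidance[of Y] PsD(1,2) by (auto simp: Y_def)
  have xc: "insert x I \<subseteq> carrier R" using x component_carrier I' ideal_mem_carrier by blast
  have "Q = ?m" if Q: "hideal Q" "primeideal Q R" "Idl (insert x I) \<subseteq> Q" for Q
  proof (rule ccontr)
    assume ne: "Q \<noteq> ?m"
    have Q': "x \<in> Q" "I \<subseteq> Q" using Q(3) genideal_self[OF xc] by auto
    obtain P where P: "P \<in> set Ps" "P \<subseteq> Q" using prime_contains_factor[OF Ps Q(2) Q'(2)] .
    have "P \<noteq> ?m" using P(2) sub[OF Q(1,2)] ne by blast
    then have "x \<notin> P" using x P Y_def by blast
    then have "P \<subset> Q" "Q \<subset> ?m" using P Q' sub[OF Q(1,2)] ne by blast+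
    then show False
      using quot_dim_one_no_chain[OF dim I' PsD(2)[OF P(1)] Q(2) primeideal_irrelevant PsD(3)[OF P(1)]]
      by blast
  qed
  then obtain N where "\<And>n y. n \<ge> N \<Longrightarrow> y \<in> \<G> n \<Longrightarrow> y \<in> Idl (insert x I)"
    using primes_irrelevant_imp_high_degree_mem[OF hideal_add_principal[OF I x(2)]] by blast
  then show ?thesis using x by blast
qed

end

section \<open>Vanishing of Koszul homology in high degree\<close>

text \<open>Dickson's lemma, with coordinates read off by \<open>f\<close> so that it applies to any
  index type. Let \<open>F\<close> represent \<open>S\<close> in the first \<open>n\<close>
  coordinates and \<open>M\<close> bound its last coordinate. Elements with last coordinate above
  \<open>M\<close> dominate a member of \<open>F\<close>; the others fall into finitely many slices,
  each treated by induction.\<close>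

lemma dickson:
  fixes f :: "'a \<Rightarrow> nat \<Rightarrow> nat"
  shows "\<exists>F\<subseteq>S. finite F \<and> (\<forall>s\<in>S. \<exists>t\<in>F. \<forall>i<n. f t i \<le> f s i)"
proof (induction n arbitrary: S)
  case 0
  then show ?case
  proof (cases "S = {}")
    case False
    then obtain s where "s \<in> S" by blast
    then show ?thesis by (intro exI[of _ "{s}"]) auto
  qed auto
next
  case (Suc n)
  obtain F where F: "F \<subseteq> S" "finite F" "\<forall>s\<in>S. \<exists>t\<in>F. \<forall>i<n. f t i \<le> f s i"
    using Suc by blast
  define M where "M = Max (insert 0 ((\<lambda>t. f t n) ` F))"
  have M: "f t n \<le> M" if "t \<in> F" for t using that F(2) by (auto simp: M_def)
  have "\<forall>k. \<exists>H\<subseteq>{s \<in> S. f s n = k}. finite H \<and>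
      (\<forall>s\<in>{s \<in> S. f s n = k}. \<exists>t\<in>H. \<forall>i<n. f t i \<le> f s i)"
    using Suc by blast
  then have "\<exists>H. \<forall>k. H k \<subseteq> {s \<in> S. f s n = k} \<and> finite (H k) \<and>
      (\<forall>s\<in>{s \<in> S. f s n = k}. \<exists>t\<in>H k. \<forall>i<n. f t i \<le> f s i)"
    by (rule choice)
  then obtain H where "\<forall>k. H k \<subseteq> {s \<in> S. f s n = k} \<and> finite (H k) \<and>
      (\<forall>s\<in>{s \<in> S. f s n = k}. \<exists>t\<in>H k. \<forall>i<n. f t i \<le> f s i)" ..
  then have H: "\<And>k. H k \<subseteq> {s \<in> S. f s n = k}" "\<And>k. finite (H k)"
    "\<And>k s. s \<in> S \<Longrightarrow> f s n = k \<Longrightarrow> \<exists>t\<in>H k. \<forall>i<n. f t i \<le> f s i"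
    by auto
  have "\<exists>t\<in>F \<union> (\<Union>k\<le>M. H k). \<forall>i<Suc n. f t i \<le> f s i" if s: "s \<in> S" for s
  proof (cases "f s n \<le> M")
    case True
    obtain t where t: "t \<in> H (f s n)" "\<forall>i<n. f t i \<le> f s i" using H(3)[OF s refl] by blast
    then have "f t n = f s n" using H(1) by blast
    then show ?thesis using t True by (intro bexI[of _ t]) (auto simp: less_Suc_eq)
  next
    case False
    obtain t where t: "t \<in> F" "\<forall>i<n. f t i \<le> f s i" using F(3) s by blast
    then show ?thesis using M[OF t(1)] False by (intro bexI[of _ t]) (auto simp: less_Suc_eq)
  qed
  moreover have "F \<union> (\<Union>k\<le>M. H k) \<subseteq> S" using F(1) H(1) by blast
  moreover have "finite (F \<union> (\<Union>k\<le>M. H k))" using F(2) H(2) by auto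
  ultimately show ?case by blast
qed

text \<open>\<open>R\<close> as a module over a weighted polynomial ring: the variables \<open>X\<^sub>0, \<dots>, X\<^sub>n\<close> act through
  \<open>g\<close>, and \<open>e\<close> lists module generators. An index \<open>(\<alpha>, j)\<close> stands for the monomial \<open>X\<^sup>\<alpha> e\<^sub>j\<close> of
  the free module.\<close>

type_synonym mono_index = "(nat \<Rightarrow>\<^sub>0 nat) \<times> nat"

locale monomial_presentation = noetherian_graded_ring_over_field R \<G> for R (structure) and \<G> +
  fixes n :: nat and g :: "nat \<Rightarrow> 'a" and d :: "nat \<Rightarrow> nat"
    and m :: nat and e :: "nat \<Rightarrow> 'a" and de :: "nat \<Rightarrow> nat"
  assumes g_mem: "i \<le> n \<Longrightarrow> g i \<in> \<G> (d i)" and d_pos: "i \<le> n \<Longrightarrow> d i > 0"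
    and e_mem: "j < m \<Longrightarrow> e j \<in> \<G> (de j)"
begin

definition wt :: "(nat \<Rightarrow>\<^sub>0 nat) \<Rightarrow> nat" where
  "wt \<alpha> = (\<Sum>i\<le>n. Poly_Mapping.lookup \<alpha> i * d i)"

definition gp :: "(nat \<Rightarrow>\<^sub>0 nat) \<Rightarrow> 'a" where
  "gp \<alpha> = (\<Otimes>i\<in>{..n}. g i [^] Poly_Mapping.lookup \<alpha> i)"

definition mon :: "mono_index \<Rightarrow> 'a" where
  "mon \<epsilon> = gp (fst \<epsilon>) \<otimes> e (snd \<epsilon>)"

definition mdeg :: "mono_index \<Rightarrow> nat" where
  "mdeg \<epsilon> = wt (fst \<epsilon>) + de (snd \<epsilon>)"

text \<open>The condition on \<open>keys\<close> excludes variables beyond \<open>n\<close>, which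
  \<open>wt\<close> and \<open>gp\<close> do not see; with it each degree has finitely many
  indices.\<close>

definition indices :: "nat \<Rightarrow> mono_index set" where
  "indices k = {\<epsilon>. Poly_Mapping.keys (fst \<epsilon>) \<subseteq> {..n} \<and> snd \<epsilon> < m \<and> mdeg \<epsilon> = k}"

definition mshift :: "(nat \<Rightarrow>\<^sub>0 nat) \<Rightarrow> mono_index \<Rightarrow> mono_index" where
  "mshift \<gamma> \<epsilon> = (\<gamma> + fst \<epsilon>, snd \<epsilon>)"

lemma g_closed [simp]: "i \<le> n \<Longrightarrow> g i \<in> carrier R"
  using g_mem component_carrier by blast

lemma e_closed [simp]: "j < m \<Longrightarrow> e j \<in> carrier R"
  using e_mem component_carrier by blast

lemma gp_closed [simp]: "gp \<alpha> \<in> carrier R"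
  unfolding gp_def by (intro finprod_closed) auto

lemma gp_add: "gp (\<alpha> + \<beta>) = gp \<alpha> \<otimes> gp \<beta>"
proof -
  have "gp (\<alpha> + \<beta>) = (\<Otimes>i\<in>{..n}. g i [^] Poly_Mapping.lookup \<alpha> i \<otimes> g i [^] Poly_Mapping.lookup \<beta> i)"
    unfolding gp_def by (intro finprod_cong') (auto simp: lookup_add nat_pow_mult)
  also have "\<dots> = gp \<alpha> \<otimes> gp \<beta>" unfolding gp_def by (intro finprod_multf) auto
  finally show ?thesis .
qed

lemma gp_single:
  assumes "i \<le> n"
  shows "gp (Poly_Mapping.single i k) = g i [^] k"
proof -
  have "gp (Poly_Mapping.single i k) = (\<Otimes>j\<in>{..n}. if i = j then g j [^] k else \<one>)"
    unfolding gp_def by (intro finprod_cong') (auto simp: lookup_single)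
  also have "\<dots> = g i [^] k" using assms by (intro finprod_singleton) auto
  finally show ?thesis .
qed

lemma wt_add: "wt (\<alpha> + \<beta>) = wt \<alpha> + wt \<beta>"
  by (simp add: wt_def lookup_add distrib_right sum.distrib)

lemma wt_single: "i \<le> n \<Longrightarrow> wt (Poly_Mapping.single i k) = k * d i"
  by (simp add: wt_def lookup_single when_def if_distrib[of "\<lambda>x. x * _"] cong: if_cong)

lemma mon_closed [simp]: "snd \<epsilon> < m \<Longrightarrow> mon \<epsilon> \<in> carrier R"
  by (simp add: mon_def)

lemma mon_index_closed [simp]: "\<epsilon> \<in> indices k \<Longrightarrow> mon \<epsilon> \<in> carrier R"
  by (simp add: indices_def)

lemma mon_mshift: "snd \<epsilon> < m \<Longrightarrow> mon (mshift \<gamma> \<epsilon>) = gp \<gamma> \<otimes> mon \<epsilon>"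
  by (simp add: mon_def mshift_def gp_add m_assoc)

lemma mdeg_mshift: "mdeg (mshift \<gamma> \<epsilon>) = wt \<gamma> + mdeg \<epsilon>"
  by (simp add: mdeg_def mshift_def wt_add)

lemma mshift_mem:
  assumes "Poly_Mapping.keys \<gamma> \<subseteq> {..n}" "\<epsilon> \<in> indices k"
  shows "mshift \<gamma> \<epsilon> \<in> indices (wt \<gamma> + k)"
proof -
  have "Poly_Mapping.keys (\<gamma> + fst \<epsilon>) \<subseteq> Poly_Mapping.keys \<gamma> \<union> Poly_Mapping.keys (fst \<epsilon>)"
    by (rule keys_add)
  then show ?thesis using assms mdeg_mshift[of \<gamma> \<epsilon>] by (auto simp: indices_def mshift_def)
qed

text \<open>The order on \<open>mono_index\<close> is lexicographic and compatible with
  multiplication by monomials, so it serves as the monomial order. Inductions along it run inside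
  one degree, where there are finitely many indices.\<close>

lemma mshift_less: "\<epsilon> < \<delta> \<Longrightarrow> mshift \<gamma> \<epsilon> < mshift \<gamma> \<delta>"
  by (cases \<epsilon>; cases \<delta>) (auto simp: mshift_def)

lemma finite_indices: "finite (indices k)"
proof -
  let ?A = "{\<alpha>. Poly_Mapping.keys \<alpha> \<subseteq> {..n} \<and> wt \<alpha> \<le> k}"
  have "Poly_Mapping.lookup \<alpha> i \<le> k" if a: "\<alpha> \<in> ?A" and i: "i \<le> n" for \<alpha> i
  proof -
    have "Poly_Mapping.lookup \<alpha> i * 1 \<le> Poly_Mapping.lookup \<alpha> i * d i" using d_pos[OF i]
      by (intro mult_left_mono) auto
    also have "\<dots> \<le> wt \<alpha>" unfolding wt_def using i by (intro member_le_sum) auto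
    finally show ?thesis using a by simp
  qed
  then have "Poly_Mapping.lookup ` ?A \<subseteq> {f. \<forall>i. (i \<in> {..n} \<longrightarrow> f i \<in> {..k}) \<and> (i \<notin> {..n} \<longrightarrow> f i = 0)}"
    by (auto simp: in_keys_iff subset_iff)
  moreover have "finite {f. \<forall>i. (i \<in> {..n} \<longrightarrow> f i \<in> {..k}) \<and> (i \<notin> {..n} \<longrightarrow> f i = (0::nat))}"
    by (intro finite_set_of_finite_funs) auto
  ultimately have "finite (Poly_Mapping.lookup ` ?A)" by (rule finite_subset)
  moreover have "inj_on Poly_Mapping.lookup ?A" by (auto intro!: inj_onI poly_mapping_eqI)
  ultimately have "finite ?A" by (rule finite_imageD)
  then have "finite (?A \<times> {..<m})" by auto
  moreover have "indices k \<subseteq> ?A \<times> {..<m}" by (auto simp: indices_def mdeg_def)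
  ultimately show ?thesis by (rule rev_finite_subset)
qed

text \<open>\<open>comb h k A a b\<close> says that \<open>a\<close> and \<open>b\<close> are the images of one and the same formal
  \<open>\<G> 0\<close>-linear combination of \<open>A\<close> under the linear maps given by \<open>h\<close> and \<open>k\<close>.\<close>

inductive comb :: "(mono_index \<Rightarrow> 'a) \<Rightarrow> (mono_index \<Rightarrow> 'a) \<Rightarrow> mono_index set \<Rightarrow> 'a \<Rightarrow> 'a \<Rightarrow> bool"
  for h k A where
  comb_zero: "comb h k A \<zero> \<zero>"
| comb_step: "comb h k A a b \<Longrightarrow> c \<in> \<G> 0 \<Longrightarrow> \<epsilon> \<in> A \<Longrightarrow> comb h k A (a \<oplus> c \<otimes> h \<epsilon>) (b \<oplus> c \<otimes> k \<epsilon>)"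

lemma comb_closed:
  assumes "comb h k A a b" "h \<in> A \<rightarrow> carrier R" "k \<in> A \<rightarrow> carrier R"
  shows "a \<in> carrier R \<and> b \<in> carrier R"
  using assms(1)
  by induction (use assms(2,3) component_carrier in \<open>auto intro!: a_closed m_closed\<close>)

lemma comb_diag: "comb h k A a b \<Longrightarrow> comb h h A a a"
  by (induction rule: comb.induct) (auto intro: comb.intros)

lemma comb_add:
  assumes h: "h \<in> A \<rightarrow> carrier R" "k \<in> A \<rightarrow> carrier R" and 1: "comb h k A a b" and 2: "comb h k A a' b'"
  shows "comb h k A (a \<oplus> a') (b \<oplus> b')"
  using 2
proof induction
  case comb_zero
  then show ?case using 1 comb_closed[OF 1 h] by simp
next
  case (comb_step a' b' c \<epsilon>)
  have c: "a \<in> carrier R" "b \<in> carrier R" "a' \<in> carrier R" "b' \<in> carrier R" "c \<in> carrier R"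
    "h \<epsilon> \<in> carrier R" "k \<epsilon> \<in> carrier R"
    using comb_closed[OF 1 h] comb_closed[OF comb_step(1) h] comb_step h component_carrier by auto
  show ?case using comb.comb_step[OF comb_step(4,2,3)] c by (simp add: a_assoc)
qed

lemma comb_smult:
  assumes h: "h \<in> A \<rightarrow> carrier R" "k \<in> A \<rightarrow> carrier R" and 1: "comb h k A a b" and r: "r \<in> \<G> 0"
  shows "comb h k A (r \<otimes> a) (r \<otimes> b)"
  using 1
proof induction
  case comb_zero
  then show ?case using comb.comb_zero r component_carrier by simp
next
  case (comb_step a b c \<epsilon>)
  have c: "a \<in> carrier R" "b \<in> carrier R" "r \<in> carrier R" "c \<in> carrier R"
    "h \<epsilon> \<in> carrier R" "k \<epsilon> \<in> carrier R"
    using comb_closed[OF comb_step(1) h] comb_step h component_carrier r by auto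
  have "r \<otimes> c \<in> \<G> 0" using component_mult[OF r comb_step(2)] by simp
  from comb.comb_step[OF comb_step(4) this comb_step(3)] show ?case
    using c by (simp add: r_distr m_assoc)
qed

lemma comb_single:
  assumes "\<epsilon> \<in> A" "c \<in> \<G> 0" "h \<epsilon> \<in> carrier R" "k \<epsilon> \<in> carrier R"
  shows "comb h k A (c \<otimes> h \<epsilon>) (c \<otimes> k \<epsilon>)"
  using comb.comb_step[OF comb.comb_zero assms(2,1), of h k] assms component_carrier by simp

lemma comb_finsum:
  assumes h: "h \<in> A \<rightarrow> carrier R" "k \<in> A \<rightarrow> carrier R"
    and S: "finite S" "\<And>i. i \<in> S \<Longrightarrow> comb h k A (a i) (b i)"
  shows "comb h k A (\<Oplus>i\<in>S. a i) (\<Oplus>i\<in>S. b i)"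
  using S
proof (induction S rule: finite_induct)
  case empty
  then show ?case using comb.comb_zero by simp
next
  case (insert i S)
  have "a j \<in> carrier R \<and> b j \<in> carrier R" if "j \<in> insert i S" for j
    using comb_closed[OF insert(4)[OF that] h] .
  then show ?case using insert comb_add[OF h] by (simp add: finsum_insert Pi_iff)
qed

text \<open>A combination may use \<open>\<epsilon>\<close> in several steps. Collecting them yields
  one coefficient, which can then be tested for being zero when \<open>\<epsilon>\<close> is the
  largest index.\<close>

lemma comb_insertE:
  assumes h: "h \<in> insert \<epsilon> A \<rightarrow> carrier R" "k \<in> insert \<epsilon> A \<rightarrow> carrier R"
    and 1: "comb h k (insert \<epsilon> A) a b"
  shows "\<exists>a' b' c. comb h k A a' b' \<and> c \<in> \<G> 0 \<and> a = a' \<oplus> c \<otimes> h \<epsilon> \<and> b = b' \<oplus> c \<otimes> k \<epsilon>"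
  using 1
proof induction
  case comb_zero
  then show ?case using comb.comb_zero[of h k A] h by (intro exI[of _ \<zero>]) auto
next
  case (comb_step a b c \<delta>)
  then obtain a' b' c' where *: "comb h k A a' b'" "c' \<in> \<G> 0" "a = a' \<oplus> c' \<otimes> h \<epsilon>" "b = b' \<oplus> c' \<otimes> k \<epsilon>"
    by blast
  have h': "h \<in> A \<rightarrow> carrier R" "k \<in> A \<rightarrow> carrier R" using h by auto
  have c: "a' \<in> carrier R" "b' \<in> carrier R" "c' \<in> carrier R" "c \<in> carrier R"
    "h \<epsilon> \<in> carrier R" "k \<epsilon> \<in> carrier R" "h \<delta> \<in> carrier R" "k \<delta> \<in> carrier R"
    using comb_closed[OF *(1) h'] comb_step h component_carrier * by auto
  show ?case
  proof (cases "\<delta> = \<epsilon>")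
    case True
    then show ?thesis using * c component_add[OF *(2) comb_step(2)]
      by (intro exI[of _ a'] exI[of _ b'] exI[of _ "c' \<oplus> c"]) (simp add: l_distr a_assoc)
  next
    case False
    then have "\<delta> \<in> A" using comb_step by blast
    from comb.comb_step[OF *(1) comb_step(2) this] * c show ?thesis
      by (intro exI[of _ "a' \<oplus> c \<otimes> h \<delta>"] exI[of _ "b' \<oplus> c \<otimes> k \<delta>"] exI[of _ c']) (simp add: a_ac)
  qed
qed

text \<open>Termwise multiplication of a formal combination by the monomial of
  \<open>\<gamma>\<close>. If \<open>\<psi>\<close> sends each shifted index to \<open>y\<close>
  times the old monomial modulo \<open>J\<close>, then by linearity the shifted combination goes to
  \<open>y \<otimes> a\<close>, a value that depends only on \<open>a\<close> and not on its
  representation. Division by a power of \<open>X\<^sub>0\<close> is evaluated in this way.\<close>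

lemma comb_mshift:
  assumes J: "ideal J R" and y: "y \<in> carrier R"
    and A: "A \<subseteq> indices k" and A': "A' \<subseteq> indices k'"
    and \<psi>: "\<psi> \<in> A' \<rightarrow> carrier R"
    and sh: "\<And>\<nu>. \<nu> \<in> A \<Longrightarrow> mshift \<gamma> \<nu> \<in> A' \<and> \<psi> (mshift \<gamma> \<nu>) \<ominus> y \<otimes> mon \<nu> \<in> J"
    and c: "comb mon l A a a'"
  shows "\<exists>b. comb mon \<psi> A' (gp \<gamma> \<otimes> a) b \<and> b \<ominus> y \<otimes> a \<in> J"
  using c
proof induction
  case comb_zero
  have "\<zero> \<ominus> y \<otimes> \<zero> \<in> J" using y ideal_zero_mem[OF J] by (simp add: minus_eq)
  then show ?case using comb.comb_zero[of mon \<psi> A'] by auto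
next
  case (comb_step a a' c \<epsilon>)
  then obtain b where b: "comb mon \<psi> A' (gp \<gamma> \<otimes> a) b" "b \<ominus> y \<otimes> a \<in> J" by blast
  have monA: "mon \<in> A \<rightarrow> carrier R" "mon \<in> A' \<rightarrow> carrier R" using A A' by auto
  have \<epsilon>: "\<epsilon> \<in> indices k" "mshift \<gamma> \<epsilon> \<in> A'" using comb_step A sh by auto
  have c: "a \<in> carrier R" "c \<in> carrier R" "mon \<epsilon> \<in> carrier R" "b \<in> carrier R" "\<psi> (mshift \<gamma> \<epsilon>) \<in> carrier R"
    using comb_closed[OF comb_diag[OF comb_step(1)] monA(1) monA(1)] comb_closed[OF b(1) monA(2) \<psi>]
      comb_step component_carrier \<epsilon> \<psi> by auto
  have eq: "mon (mshift \<gamma> \<epsilon>) = gp \<gamma> \<otimes> mon \<epsilon>" using \<epsilon> by (intro mon_mshift) (simp add: indices_def)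
  have "comb mon \<psi> A' (gp \<gamma> \<otimes> a \<oplus> c \<otimes> mon (mshift \<gamma> \<epsilon>)) (b \<oplus> c \<otimes> \<psi> (mshift \<gamma> \<epsilon>))"
    using b(1) comb_step(2) \<epsilon>(2) by (rule comb.comb_step)
  also have "gp \<gamma> \<otimes> a \<oplus> c \<otimes> mon (mshift \<gamma> \<epsilon>) = gp \<gamma> \<otimes> (a \<oplus> c \<otimes> mon \<epsilon>)"
    unfolding eq using c m_lcomm[of c "gp \<gamma>" "mon \<epsilon>"] by (simp add: r_distr)
  finally have 1: "comb mon \<psi> A' (gp \<gamma> \<otimes> (a \<oplus> c \<otimes> mon \<epsilon>)) (b \<oplus> c \<otimes> \<psi> (mshift \<gamma> \<epsilon>))" .
  have "(b \<ominus> y \<otimes> a) \<oplus> c \<otimes> (\<psi> (mshift \<gamma> \<epsilon>) \<ominus> y \<otimes> mon \<epsilon>) \<in> J"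
    using b(2) sh comb_step(3) c by (intro ideal_add_mem[OF J] ideal_lmult_mem[OF J]) auto
  also have "(b \<ominus> y \<otimes> a) \<oplus> c \<otimes> (\<psi> (mshift \<gamma> \<epsilon>) \<ominus> y \<otimes> mon \<epsilon>) =
      (b \<oplus> c \<otimes> \<psi> (mshift \<gamma> \<epsilon>)) \<ominus> y \<otimes> (a \<oplus> c \<otimes> mon \<epsilon>)"
    using c y m_lcomm[of c y "mon \<epsilon>"] by (simp add: minus_eq r_distr r_minus minus_add a_ac)
  finally show ?case using 1 by blast
qed

text \<open>The leading indices of the relations among the \<^term>\<open>mon \<epsilon>\<close>, as in Groebner basis theory.\<close>

definition leading :: "mono_index set" where
  "leading = {\<epsilon>. \<epsilon> \<in> indices (mdeg \<epsilon>) \<and>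
     comb mon mon {\<nu> \<in> indices (mdeg \<epsilon>). \<nu> < \<epsilon>} (mon \<epsilon>) (mon \<epsilon>)}"

text \<open>By Dickson's lemma finitely many leading indices divide all the others, and
  \<open>B\<close> is the largest of their degrees.\<close>

lemma leading_decompose:
  "\<exists>B. \<forall>\<epsilon>\<in>leading. \<exists>\<gamma> \<mu>. Poly_Mapping.keys \<gamma> \<subseteq> {..n} \<and> \<epsilon> = mshift \<gamma> \<mu> \<and> \<mu> \<in> leading \<and> mdeg \<mu> \<le> B"
proof -
  \<comment> \<open>Besides the exponents, both \<open>snd \<epsilon>\<close> and
    \<open>m - snd \<epsilon>\<close> are coordinates, so a coordinatewise comparison forces equal
    module generators.\<close>
  define f where "f = (\<lambda>\<epsilon>::mono_index. \<lambda>i. if i \<le> n then Poly_Mapping.lookup (fst \<epsilon>) i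
    else if i = n + 1 then snd \<epsilon> else m - snd \<epsilon>)"
  obtain F where F: "F \<subseteq> leading" "finite F" "\<forall>s\<in>leading. \<exists>t\<in>F. \<forall>i<n + 3. f t i \<le> f s i"
    using dickson[of leading "n + 3" f] by blast
  define B where "B = Max (insert 0 (mdeg ` F))"
  have "\<exists>\<gamma> \<mu>. Poly_Mapping.keys \<gamma> \<subseteq> {..n} \<and> \<epsilon> = mshift \<gamma> \<mu> \<and> \<mu> \<in> leading \<and> mdeg \<mu> \<le> B"
    if \<epsilon>: "\<epsilon> \<in> leading" for \<epsilon>
  proof -
    obtain \<mu> where \<mu>: "\<mu> \<in> F" "\<And>i. i < n + 3 \<Longrightarrow> f \<mu> i \<le> f \<epsilon> i" using F(3) \<epsilon> by blast
    have idx: "\<epsilon> \<in> indices (mdeg \<epsilon>)" "\<mu> \<in> indices (mdeg \<mu>)"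
      using \<epsilon> \<mu>(1) F(1) by (auto simp: leading_def)
    have le: "Poly_Mapping.lookup (fst \<mu>) i \<le> Poly_Mapping.lookup (fst \<epsilon>) i" for i
    proof (cases "i \<le> n")
      case True
      then show ?thesis using \<mu>(2)[of i] by (simp add: f_def)
    next
      case False
      then have "i \<notin> Poly_Mapping.keys (fst \<mu>)" using idx(2) by (auto simp: indices_def)
      then show ?thesis by (simp add: in_keys_iff)
    qed
    have "snd \<mu> \<le> snd \<epsilon>" "m - snd \<mu> \<le> m - snd \<epsilon>"
      using \<mu>(2)[of "n + 1"] \<mu>(2)[of "n + 2"] by (simp_all add: f_def)
    moreover have "snd \<mu> < m" "snd \<epsilon> < m" using idx by (simp_all add: indices_def)
    ultimately have "snd \<mu> = snd \<epsilon>" by linarith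
    moreover have "fst \<epsilon> = (fst \<epsilon> - fst \<mu>) + fst \<mu>"
      using le by (intro poly_mapping_eqI) (simp add: lookup_add lookup_minus)
    ultimately have "\<epsilon> = mshift (fst \<epsilon> - fst \<mu>) \<mu>" by (simp add: mshift_def prod_eq_iff)
    moreover have "Poly_Mapping.keys (fst \<epsilon> - fst \<mu>) \<subseteq> {..n}"
    proof
      fix i assume "i \<in> Poly_Mapping.keys (fst \<epsilon> - fst \<mu>)"
      then have "i \<in> Poly_Mapping.keys (fst \<epsilon>)" by (auto simp: in_keys_iff lookup_minus)
      then show "i \<in> {..n}" using idx by (auto simp: indices_def)
    qed
    moreover have "mdeg \<mu> \<le> B" using \<mu>(1) F(2) by (auto simp: B_def)
    ultimately show ?thesis using \<mu>(1) F(1) by blast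
  qed
  then show ?thesis by blast
qed

text \<open>The division of an index by \<open>X\<^sub>0\<^sup>s\<close> modulo \<open>X\<^sub>1\<^sup>q, \<dots>, X\<^sub>n\<^sup>q\<close>. Exponents of \<open>X\<^sub>0\<close> below \<open>s\<close> are
  truncated to \<open>0\<close>; such indices never matter.\<close>

definition divmon :: "nat \<Rightarrow> nat \<Rightarrow> mono_index \<Rightarrow> 'a" where
  "divmon s q \<epsilon> = (if \<exists>i\<in>{1..n}. q \<le> Poly_Mapping.lookup (fst \<epsilon>) i then \<zero>
     else mon (fst \<epsilon> - Poly_Mapping.single 0 s, snd \<epsilon>))"

definition powers_ideal :: "nat \<Rightarrow> 'a set" where
  "powers_ideal q = Idl ((\<lambda>i. g i [^] q) ` {1..n})"

lemma powers_ideal_ideal: "ideal (powers_ideal q) R"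
  unfolding powers_ideal_def by (intro genideal_ideal) auto

lemma divmon_closed: "snd \<epsilon> < m \<Longrightarrow> divmon s q \<epsilon> \<in> carrier R"
  by (simp add: divmon_def)

lemma gp_mem_powers_ideal:
  assumes i: "i \<in> {1..n}" "q \<le> Poly_Mapping.lookup \<alpha> i"
  shows "gp \<alpha> \<in> powers_ideal q"
proof -
  have "\<alpha> = (\<alpha> - Poly_Mapping.single i q) + Poly_Mapping.single i q"
    using i by (intro poly_mapping_eqI) (auto simp: lookup_add lookup_minus lookup_single when_def)
  then have "gp \<alpha> = gp (\<alpha> - Poly_Mapping.single i q) \<otimes> gp (Poly_Mapping.single i q)"
    using gp_add by metis
  moreover have "gp (Poly_Mapping.single i q) \<in> powers_ideal q"
  proof -
    have "(\<lambda>i. g i [^] q) ` {1..n} \<subseteq> powers_ideal q"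
      unfolding powers_ideal_def by (intro genideal_self) auto
    then show ?thesis using i gp_single[of i q] by auto
  qed
  ultimately show ?thesis using ideal_lmult_mem[OF powers_ideal_ideal] by simp
qed

text \<open>Here \<open>y\<close> is a formal quotient of the monomial of \<open>\<gamma>\<close>.
  If \<open>divmon\<close> becomes zero only after multiplication by \<open>\<nu>\<close>, then
  \<open>y \<otimes> mon \<nu>\<close> is itself a multiple of some \<open>g i [^] q\<close>,
  because removing a power of \<open>X\<^sub>0\<close> leaves the other exponents intact.\<close>

lemma divmon_mshift:
  assumes \<nu>: "snd \<nu> < m"
    and y: "(\<exists>i\<in>{1..n}. q \<le> Poly_Mapping.lookup \<gamma> i) \<and> y = \<zero> \<or>
      s \<le> Poly_Mapping.lookup \<gamma> 0 \<and> y = gp (\<gamma> - Poly_Mapping.single 0 s)"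
  shows "divmon s q (mshift \<gamma> \<nu>) \<ominus> y \<otimes> mon \<nu> \<in> powers_ideal q"
proof (cases "\<exists>i\<in>{1..n}. q \<le> Poly_Mapping.lookup (\<gamma> + fst \<nu>) i")
  case True
  then obtain i where i: "i \<in> {1..n}" "q \<le> Poly_Mapping.lookup (\<gamma> + fst \<nu>) i" by blast
  have dz: "divmon s q (mshift \<gamma> \<nu>) = \<zero>"
    unfolding divmon_def mshift_def fst_conv using True by simp
  have "y \<otimes> mon \<nu> \<in> powers_ideal q"
  proof (cases "y = \<zero>")
    case True
    then show ?thesis using \<nu> ideal_zero_mem[OF powers_ideal_ideal] by simp
  next
    case False
    then have y': "y = gp (\<gamma> - Poly_Mapping.single 0 s)" using y by blast
    have "y \<otimes> mon \<nu> = gp (\<gamma> - Poly_Mapping.single 0 s + fst \<nu>) \<otimes> e (snd \<nu>)"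
      using \<nu> by (simp add: y' mon_def gp_add m_assoc)
    moreover have "gp (\<gamma> - Poly_Mapping.single 0 s + fst \<nu>) \<in> powers_ideal q"
      using i by (intro gp_mem_powers_ideal[of i]) (auto simp: lookup_add lookup_minus lookup_single when_def)
    ultimately show ?thesis using \<nu> ideal_rmult_mem[OF powers_ideal_ideal] by simp
  qed
  then show ?thesis
    using dz ideal_minus_mem[OF powers_ideal_ideal ideal_zero_mem[OF powers_ideal_ideal]] by simp
next
  case False
  then have "\<not> (\<exists>i\<in>{1..n}. q \<le> Poly_Mapping.lookup \<gamma> i)" by (auto simp: lookup_add trans_le_add1)
  then have y': "s \<le> Poly_Mapping.lookup \<gamma> 0" "y = gp (\<gamma> - Poly_Mapping.single 0 s)" using y by blast+
  have eq: "\<gamma> + fst \<nu> - Poly_Mapping.single 0 s = (\<gamma> - Poly_Mapping.single 0 s) + fst \<nu>"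
    using y' by (intro poly_mapping_eqI) (auto simp: lookup_add lookup_minus lookup_single when_def)
  have "divmon s q (mshift \<gamma> \<nu>) = y \<otimes> mon \<nu>"
    using \<nu> unfolding divmon_def mshift_def fst_conv snd_conv using False
    by (simp add: mon_def eq gp_add y' m_assoc)
  moreover have "y \<otimes> mon \<nu> \<in> carrier R" using \<nu> y' by simp
  ultimately show ?thesis using ideal_zero_mem[OF powers_ideal_ideal] by (simp add: minus_eq r_neg)
qed

text \<open>If all exponents were smaller, the weight would stay below the bound; strictness comes
  from \<open>X\<^sub>0\<close> and \<open>d 0 > 0\<close>.\<close>

lemma high_degree_exponent:
  assumes "s * d 0 + q * (\<Sum>i\<in>{1..n}. d i) \<le> wt \<gamma>"
  shows "s \<le> Poly_Mapping.lookup \<gamma> 0 \<or> (\<exists>i\<in>{1..n}. q \<le> Poly_Mapping.lookup \<gamma> i)"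
proof (rule ccontr)
  assume "\<not> ?thesis"
  then have *: "Poly_Mapping.lookup \<gamma> 0 < s" "\<And>i. i \<in> {1..n} \<Longrightarrow> Poly_Mapping.lookup \<gamma> i \<le> q" by force+
  have "wt \<gamma> = Poly_Mapping.lookup \<gamma> 0 * d 0 + (\<Sum>i\<in>{1..n}. Poly_Mapping.lookup \<gamma> i * d i)"
    unfolding wt_def using sum.atLeast_Suc_atMost[of 0 n "\<lambda>i. Poly_Mapping.lookup \<gamma> i * d i"]
    by (simp add: atMost_atLeast0)
  moreover have "Poly_Mapping.lookup \<gamma> 0 * d 0 < s * d 0" using * d_pos[of 0] by simp
  moreover have "(\<Sum>i\<in>{1..n}. Poly_Mapping.lookup \<gamma> i * d i) \<le> (\<Sum>i\<in>{1..n}. q * d i)"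
    using * by (intro sum_mono mult_right_mono) auto
  ultimately show False using assms unfolding sum_distrib_left by linarith
qed

text \<open>This is the vanishing, in degrees at least \<open>s d\<^sub>0 + q (d\<^sub>1 + \<dots> + d\<^sub>n) + B\<close>, of the first Koszul
  homology of \<open>x\<^sup>s, f\<^sub>1\<^sup>q, \<dots>, f\<^sub>n\<^sup>q\<close> on \<open>R\<close>. A relation is reduced by its leading index, which is a
  multiple \<open>X\<^sup>\<gamma>\<close> of a minimal one; in high degree \<open>X\<^sup>\<gamma>\<close> is divisible by \<open>X\<^sub>0\<^sup>s\<close> or some \<open>X\<^sub>i\<^sup>q\<close>.\<close>

lemma relation_divmon_mem:
  assumes B: "\<forall>\<epsilon>\<in>leading. \<exists>\<gamma> \<mu>. Poly_Mapping.keys \<gamma> \<subseteq> {..n} \<and> \<epsilon> = mshift \<gamma> \<mu> \<and> \<mu> \<in> leading \<and> mdeg \<mu> \<le> B"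
    and D: "s * d 0 + q * (\<Sum>i\<in>{1..n}. d i) + B \<le> D"
    and A: "finite A" "A \<subseteq> indices D" "\<forall>\<epsilon>\<in>A. \<forall>\<nu>\<in>indices D. \<nu> < \<epsilon> \<longrightarrow> \<nu> \<in> A"
    and b: "comb mon (divmon s q) A \<zero> b"
  shows "b \<in> powers_ideal q"
  using A b
proof (induction A arbitrary: b rule: finite_linorder_max_induct)
  case empty
  have "comb h k {} a b \<Longrightarrow> b = \<zero>" for h k a b
    by (induction rule: comb.induct) auto
  then show ?case using empty ideal_zero_mem[OF powers_ideal_ideal] by blast
next
  case (insert \<epsilon> A)
  let ?J = "powers_ideal q" and ?\<psi> = "divmon s q"
  have J: "ideal ?J R" by (rule powers_ideal_ideal)
  have \<epsilon>: "\<epsilon> \<in> indices D" "mdeg \<epsilon> = D" and AD: "A \<subseteq> indices D" using insert.prems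
    by (auto simp: indices_def)
  \<comment> \<open>Downward closure makes \<open>A\<close> exactly the set of smaller indices that
    occurs in the definition of \<open>leading\<close>.\<close>
  have low: "{\<nu> \<in> indices D. \<nu> < \<epsilon>} = A" using insert by auto
  have down: "\<forall>\<epsilon>\<in>A. \<forall>\<nu>\<in>indices D. \<nu> < \<epsilon> \<longrightarrow> \<nu> \<in> A"
    using insert.prems(2) insert.hyps(2) by (metis insertE insertI2 order.strict_trans less_irrefl)
  have mp: "mon \<in> insert \<epsilon> A \<rightarrow> carrier R" "?\<psi> \<in> insert \<epsilon> A \<rightarrow> carrier R"
    using AD \<epsilon> by (auto simp: indices_def subset_iff intro: divmon_closed)
  have mpA: "mon \<in> A \<rightarrow> carrier R" "?\<psi> \<in> A \<rightarrow> carrier R" using mp by auto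
  obtain a' b' c where *: "comb mon ?\<psi> A a' b'" "c \<in> \<G> 0" "\<zero> = a' \<oplus> c \<otimes> mon \<epsilon>" "b = b' \<oplus> c \<otimes> ?\<psi> \<epsilon>"
    using comb_insertE[OF mp insert.prems(3)] by blast
  have cl: "a' \<in> carrier R" "b' \<in> carrier R" "c \<in> carrier R" "mon \<epsilon> \<in> carrier R" "?\<psi> \<epsilon> \<in> carrier R"
    using comb_closed[OF *(1) mpA] * component_carrier mp by auto
  show ?case
  proof (cases "c = \<zero>")
    case True
    then have "a' = \<zero>" "b = b'" using * cl by auto
    then show ?thesis using insert.IH[OF AD down] * by simp
  next
    case False
    then obtain c' where c': "c' \<in> \<G> 0" "c' \<otimes> c = \<one>" using component_zero_inverse * by blast
    have c'c: "c' \<in> carrier R" using c' component_carrier by blast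
    \<comment> \<open>Solving the relation for \<open>mon \<epsilon>\<close> writes it through
      smaller indices, so \<open>\<epsilon>\<close> is leading.\<close>
    have "\<ominus> c' \<otimes> a' = mon \<epsilon>"
    proof -
      have "c \<otimes> mon \<epsilon> = \<ominus> a'" using *(3) cl by (metis m_closed minus_equality minus_minus a_comm)
      then have "mon \<epsilon> = c' \<otimes> (\<ominus> a')" using c'(2) cl c'c by (metis m_assoc l_one)
      then show ?thesis using cl c'c by (simp add: l_minus r_minus)
    qed
    moreover have "comb mon mon A (\<ominus> c' \<otimes> a') (\<ominus> c' \<otimes> a')"
      by (rule comb_smult[OF mpA(1) mpA(1) comb_diag[OF *(1)] component_neg[OF c'(1)]])
    ultimately have "\<epsilon> \<in> leading" using \<epsilon> low by (simp add: leading_def)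
    then obtain \<gamma> \<mu> where \<gamma>: "Poly_Mapping.keys \<gamma> \<subseteq> {..n}" "\<epsilon> = mshift \<gamma> \<mu>" "\<mu> \<in> leading" "mdeg \<mu> \<le> B"
      using B by blast
    have deg: "wt \<gamma> + mdeg \<mu> = D" using \<gamma>(2) \<epsilon>(2) mdeg_mshift by simp
    then have "s * d 0 + q * (\<Sum>i\<in>{1..n}. d i) \<le> wt \<gamma>" using D \<gamma>(4) by linarith
    then have "s \<le> Poly_Mapping.lookup \<gamma> 0 \<or> (\<exists>i\<in>{1..n}. q \<le> Poly_Mapping.lookup \<gamma> i)"
      by (rule high_degree_exponent)
    then obtain y where y: "(\<exists>i\<in>{1..n}. q \<le> Poly_Mapping.lookup \<gamma> i) \<and> y = \<zero> \<or>
        s \<le> Poly_Mapping.lookup \<gamma> 0 \<and> y = gp (\<gamma> - Poly_Mapping.single 0 s)" by blast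
    have yc: "y \<in> carrier R" using y by auto
    let ?L = "{\<nu> \<in> indices (mdeg \<mu>). \<nu> < \<mu>}"
    have \<mu>: "\<mu> \<in> indices (mdeg \<mu>)" "comb mon mon ?L (mon \<mu>) (mon \<mu>)" using \<gamma>(3)
      by (auto simp: leading_def)
    have sh: "mshift \<gamma> \<nu> \<in> A \<and> ?\<psi> (mshift \<gamma> \<nu>) \<ominus> y \<otimes> mon \<nu> \<in> ?J" if "\<nu> \<in> ?L" for \<nu>
    proof
      have "mshift \<gamma> \<nu> \<in> indices D" using mshift_mem[OF \<gamma>(1), of \<nu> "mdeg \<mu>"] that deg by simp
      moreover have "mshift \<gamma> \<nu> < \<epsilon>" using mshift_less[of \<nu> \<mu> \<gamma>] that \<gamma>(2) by simp
      ultimately show "mshift \<gamma> \<nu> \<in> A" using low by blast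
      show "?\<psi> (mshift \<gamma> \<nu>) \<ominus> y \<otimes> mon \<nu> \<in> ?J"
        using that y by (intro divmon_mshift) (auto simp: indices_def)
    qed
    have LS: "?L \<subseteq> indices (mdeg \<mu>)" by blast
    obtain b2 where b2: "comb mon ?\<psi> A (gp \<gamma> \<otimes> mon \<mu>) b2" "b2 \<ominus> y \<otimes> mon \<mu> \<in> ?J"
      using comb_mshift[OF J yc LS AD mpA(2) sh \<mu>(2)] by blast
    have \<mu>m: "snd \<mu> < m" using \<mu>(1) by (simp add: indices_def)
    have cl2: "b2 \<in> carrier R" "mon \<mu> \<in> carrier R" using comb_closed[OF b2(1) mpA] \<mu>m by auto
    have "gp \<gamma> \<otimes> mon \<mu> = mon \<epsilon>" using mon_mshift[OF \<mu>m] \<gamma>(2) by simp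
    \<comment> \<open>The term at \<open>\<epsilon>\<close> is replaced by the shifted
      representation of \<open>mon \<mu>\<close> in smaller indices. The result is a relation on
      \<open>A\<close>, and the value \<open>b\<close> has changed by
      \<open>c \<otimes> (divmon s q \<epsilon> \<ominus> b2)\<close>, which lies in the ideal
      because both entries are congruent to \<open>y \<otimes> mon \<mu>\<close>.\<close>
    then have "comb mon ?\<psi> A (a' \<oplus> c \<otimes> mon \<epsilon>) (b' \<oplus> c \<otimes> b2)"
      using comb_add[OF mpA *(1) comb_smult[OF mpA b2(1) *(2)]] by simp
    then have 1: "b' \<oplus> c \<otimes> b2 \<in> ?J" using insert.IH[OF AD down] *(3) by simp
    have "?\<psi> \<epsilon> \<ominus> y \<otimes> mon \<mu> \<in> ?J" unfolding \<gamma>(2) using \<mu>m y by (rule divmon_mshift)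
    then have "(?\<psi> \<epsilon> \<ominus> y \<otimes> mon \<mu>) \<ominus> (b2 \<ominus> y \<otimes> mon \<mu>) \<in> ?J" using b2(2) by (rule ideal_minus_mem[OF J])
    moreover have "(?\<psi> \<epsilon> \<ominus> y \<otimes> mon \<mu>) \<ominus> (b2 \<ominus> y \<otimes> mon \<mu>) = ?\<psi> \<epsilon> \<ominus> b2"
      using cl cl2 yc by (simp add: minus_eq minus_add a_ac r_neg r_neg1 r_neg2)
    ultimately have "c \<otimes> (?\<psi> \<epsilon> \<ominus> b2) \<in> ?J" using ideal_lmult_mem[OF J] cl by simp
    with 1 have "(b' \<oplus> c \<otimes> b2) \<oplus> c \<otimes> (?\<psi> \<epsilon> \<ominus> b2) \<in> ?J" by (rule ideal_add_mem[OF J])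
    also have "(b' \<oplus> c \<otimes> b2) \<oplus> c \<otimes> (?\<psi> \<epsilon> \<ominus> b2) = b"
      unfolding *(4) using cl cl2 by (simp add: minus_eq r_distr r_minus a_ac r_neg r_neg1 r_neg2)
    finally show ?thesis .
  qed
qed

text \<open>Graded Nakayama. In degrees below \<open>N\<close> the list \<open>e\<close> spans over
  the field; from \<open>N\<close> on every element is a combination of the \<open>g i\<close>,
  whose coefficients have smaller degree because \<open>d i > 0\<close>.\<close>

lemma comb_span:
  assumes N: "\<And>k y. k < N \<Longrightarrow> y \<in> \<G> k \<Longrightarrow> \<exists>B r. finite B \<and>
      (\<forall>b\<in>B. r b \<in> \<G> 0 \<and> (\<exists>j<m. e j = b \<and> de j = k)) \<and> y = (\<Oplus>b\<in>B. r b \<otimes> b)"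
    and gen: "\<And>k y. k \<ge> N \<Longrightarrow> y \<in> \<G> k \<Longrightarrow> y \<in> Idl (g ` {..n})"
  shows "y \<in> \<G> k \<Longrightarrow> comb mon mon (indices k) y y"
proof (induction k arbitrary: y rule: less_induct)
  case (less k)
  have mp: "mon \<in> indices l \<rightarrow> carrier R" for l by auto
  show ?case
  proof (cases "k < N")
    case True
    then obtain B r where B: "finite B" "\<And>b. b \<in> B \<Longrightarrow> r b \<in> \<G> 0"
      "\<And>b. b \<in> B \<Longrightarrow> \<exists>j<m. e j = b \<and> de j = k" "y = (\<Oplus>b\<in>B. r b \<otimes> b)"
      using N[OF True less.prems] by blast
    have g0: "gp 0 = \<one>" unfolding gp_def by (intro finprod_one_eqI) auto
    have "comb mon mon (indices k) (r b \<otimes> b) (r b \<otimes> b)" if b: "b \<in> B" for b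
    proof -
      obtain j where j: "j < m" "e j = b" "de j = k" using B(3)[OF b] by blast
      have "mon (0, j) = b" using j g0 e_closed[OF j(1)] by (simp add: mon_def)
      moreover have "(0, j) \<in> indices k" using j by (simp add: indices_def mdeg_def wt_def)
      ultimately show ?thesis
        using comb_single[of "(0, j)" "indices k" "r b" mon mon] B(2)[OF b] e_closed[OF j(1)] j by simp
    qed
    then show ?thesis unfolding B(4) by (intro comb_finsum[OF mp mp B(1)]) auto
  next
    case False
    then have "y \<in> Idl (g ` {..n})" using gen[OF _ less.prems] by simp
    then obtain r where r: "\<And>i. i \<in> {..n} \<Longrightarrow> d i \<le> k \<Longrightarrow> r i \<in> \<G> (k - d i)"
      "\<And>i. i \<in> {..n} \<Longrightarrow> \<not> d i \<le> k \<Longrightarrow> r i = \<zero>" "y = (\<Oplus>i\<in>{..n}. r i \<otimes> g i)"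
      using component_mem_Idl_imageE[of "{..n}" g d y k] g_mem less.prems by auto
    have "comb mon mon (indices k) (r i \<otimes> g i) (r i \<otimes> g i)" if i: "i \<in> {..n}" for i
    proof (cases "d i \<le> k")
      case True
      have ri: "r i \<in> \<G> (k - d i)" by (rule r(1)[OF i True])
      then have rc: "r i \<in> carrier R" by (rule component_carrier)
      have lt: "k - d i < k" using True d_pos[of i] i by simp
      let ?\<gamma> = "Poly_Mapping.single i (1::nat)"
      have kk: "Poly_Mapping.keys ?\<gamma> \<subseteq> {..n}" using i by simp
      have w: "wt ?\<gamma> + (k - d i) = k" using wt_single[of i 1] i True by simp
      \<comment> \<open>For the ideal \<open>carrier R\<close> the congruence in
        \<open>comb_mshift\<close> is vacuous, and what remains is the shifted
        representation.\<close>
      have "\<exists>b. comb mon mon (indices k) (gp ?\<gamma> \<otimes> r i) b \<and> b \<ominus> \<zero> \<otimes> r i \<in> carrier R"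
      proof (rule comb_mshift[OF oneideal _ subset_refl subset_refl mp _ less.IH[OF lt ri]])
        fix \<nu> assume \<nu>: "\<nu> \<in> indices (k - d i)"
        have 1: "mshift ?\<gamma> \<nu> \<in> indices k" using mshift_mem[OF kk \<nu>] w by simp
        then show "mshift ?\<gamma> \<nu> \<in> indices k \<and> mon (mshift ?\<gamma> \<nu>) \<ominus> \<zero> \<otimes> mon \<nu> \<in> carrier R"
          using \<nu> by simp
      qed simp
      then have "comb mon mon (indices k) (gp ?\<gamma> \<otimes> r i) (gp ?\<gamma> \<otimes> r i)" using comb_diag by blast
      moreover have "gp ?\<gamma> \<otimes> r i = r i \<otimes> g i" using gp_single[of i 1] i rc m_comm by simp
      ultimately show ?thesis by simp
    next
      case False
      then show ?thesis using r(2)[OF i] i comb.comb_zero by simp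
    qed
    then show ?thesis unfolding r(3) by (intro comb_finsum[OF mp mp]) auto
  qed
qed

text \<open>The element \<open>g 0 [^] s \<otimes> u\<close> is lifted to formal combinations in two
  ways, from \<open>u\<close> and from the coefficients of the \<open>g i [^] q\<close>. Their
  difference is a relation, which \<open>divmon\<close> sends to \<open>u\<close> modulo the ideal,
  so \<open>relation_divmon_mem\<close> applies. The summand \<open>s * d 0\<close> occurs in the
  degree and in the bound alike, hence cancels.\<close>

lemma koszul_vanishing:
  assumes span: "\<And>k y. y \<in> \<G> k \<Longrightarrow> comb mon mon (indices k) y y"
  shows "\<exists>B. \<forall>s q k u. u \<in> \<G> k \<longrightarrow> g 0 [^] (s::nat) \<otimes> u \<in> powers_ideal q \<longrightarrow>
    q * (\<Sum>i\<in>{1..n}. d i) + B \<le> k \<longrightarrow> u \<in> powers_ideal q"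
proof -
  obtain B where B: "\<forall>\<epsilon>\<in>leading. \<exists>\<gamma> \<mu>. Poly_Mapping.keys \<gamma> \<subseteq> {..n} \<and>
      \<epsilon> = mshift \<gamma> \<mu> \<and> \<mu> \<in> leading \<and> mdeg \<mu> \<le> B"
    using leading_decompose by blast
  have "u \<in> powers_ideal q"
    if u: "u \<in> \<G> k" and xu: "g 0 [^] s \<otimes> u \<in> powers_ideal q" and k: "q * (\<Sum>i\<in>{1..n}. d i) + B \<le> k"
    for s q k :: nat and u
  proof -
    let ?J = "powers_ideal q" and ?\<psi> = "divmon s q"
    have J: "ideal ?J R" by (rule powers_ideal_ideal)
    define D where "D = s * d 0 + k"
    have uc: "u \<in> carrier R" using u component_carrier by blast
    have g0c: "g 0 [^] s \<in> carrier R" by simp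
    have mp: "mon \<in> indices D \<rightarrow> carrier R" "?\<psi> \<in> indices D \<rightarrow> carrier R"
      by (auto simp: indices_def intro: divmon_closed)
    have shiftD: "\<exists>b. comb mon ?\<psi> (indices D) (gp \<gamma> \<otimes> a) b \<and> b \<ominus> y \<otimes> a \<in> ?J"
      if a: "a \<in> \<G> l" and kk: "Poly_Mapping.keys \<gamma> \<subseteq> {..n}" and l: "wt \<gamma> + l = D"
        and y: "(\<exists>i\<in>{1..n}. q \<le> Poly_Mapping.lookup \<gamma> i) \<and> y = \<zero>
            \<or> s \<le> Poly_Mapping.lookup \<gamma> 0 \<and> y = gp (\<gamma> - Poly_Mapping.single 0 s)"
      for a l \<gamma> y
    proof (rule comb_mshift[OF J _ subset_refl subset_refl mp(2) _ span[OF a]])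
      show "y \<in> carrier R" using y by auto
      fix \<nu> assume \<nu>: "\<nu> \<in> indices l"
      show "mshift \<gamma> \<nu> \<in> indices D \<and> ?\<psi> (mshift \<gamma> \<nu>) \<ominus> y \<otimes> mon \<nu> \<in> ?J"
        using mshift_mem[OF kk \<nu>] l divmon_mshift[OF _ y, of \<nu>] \<nu> by (simp add: indices_def)
    qed
    let ?\<gamma> = "Poly_Mapping.single 0 s :: nat \<Rightarrow>\<^sub>0 nat"
    \<comment> \<open>Here \<open>\<gamma>\<close> is divided by itself, so \<open>y\<close> is
      \<open>gp 0\<close>, which is \<open>\<one>\<close>, and the division returns \<open>u\<close>
      modulo the ideal.\<close>
    have "\<exists>b. comb mon ?\<psi> (indices D) (gp ?\<gamma> \<otimes> u) b \<and> b \<ominus> gp (?\<gamma> - ?\<gamma>) \<otimes> u \<in> ?J"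
      using u by (rule shiftD) (auto simp: D_def wt_single)
    moreover have "gp (?\<gamma> - ?\<gamma>) = \<one>"
      unfolding gp_def by (intro finprod_one_eqI) auto
    ultimately obtain b0 where b0: "comb mon ?\<psi> (indices D) (g 0 [^] s \<otimes> u) b0" "b0 \<ominus> u \<in> ?J"
      using uc gp_single[of 0 s] by auto
    have xuD: "g 0 [^] s \<otimes> u \<in> \<G> D"
      unfolding D_def using u component_pow[OF g_mem[of 0]] by (intro component_mult) auto
    have gq: "g i [^] q \<in> \<G> (q * d i)" if "i \<in> {1..n}" for i
      using component_pow[OF g_mem[of i]] that by simp
    obtain r where r: "\<And>i. i \<in> {1..n} \<Longrightarrow> q * d i \<le> D \<Longrightarrow> r i \<in> \<G> (D - q * d i)"
      "\<And>i. i \<in> {1..n} \<Longrightarrow> \<not> q * d i \<le> D \<Longrightarrow> r i = \<zero>"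
      "g 0 [^] s \<otimes> u = (\<Oplus>i\<in>{1..n}. r i \<otimes> g i [^] q)"
      using component_mem_Idl_imageE[of "{1..n}" "\<lambda>i. g i [^] q" "\<lambda>i. q * d i" "g 0 [^] s \<otimes> u" D]
        gq xuD xu[unfolded powers_ideal_def] by auto
    have "\<exists>b. comb mon ?\<psi> (indices D) (r i \<otimes> g i [^] q) b \<and> b \<in> ?J" if i: "i \<in> {1..n}" for i
    proof (cases "q * d i \<le> D")
      case True
      let ?\<gamma> = "Poly_Mapping.single i q"
      have ri: "r i \<in> \<G> (D - q * d i)" by (rule r(1)[OF i True])
      then have rc: "r i \<in> carrier R" by (rule component_carrier)
      have "\<exists>b. comb mon ?\<psi> (indices D) (gp ?\<gamma> \<otimes> r i) b \<and> b \<ominus> \<zero> \<otimes> r i \<in> ?J"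
      proof (rule shiftD[OF ri])
        have "\<exists>j\<in>{1..n}. q \<le> Poly_Mapping.lookup ?\<gamma> j" using i by (intro bexI[of _ i]) auto
        then show "(\<exists>j\<in>{1..n}. q \<le> Poly_Mapping.lookup ?\<gamma> j) \<and> \<zero> = \<zero> \<or>
            s \<le> Poly_Mapping.lookup ?\<gamma> 0 \<and> \<zero> = gp (?\<gamma> - Poly_Mapping.single 0 s)" by blast
      qed (use i True in \<open>auto simp: wt_single\<close>)
      then obtain b where b: "comb mon ?\<psi> (indices D) (gp ?\<gamma> \<otimes> r i) b" "b \<ominus> \<zero> \<otimes> r i \<in> ?J" by blast
      have "b \<in> carrier R" using comb_closed[OF b(1) mp] by blast
      then have "b \<in> ?J" using b(2) rc by (simp add: minus_eq)
      moreover have "gp ?\<gamma> \<otimes> r i = r i \<otimes> g i [^] q" using gp_single[of i q] i rc m_comm by simp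
      ultimately show ?thesis using b(1) by auto
    next
      case False
      then show ?thesis using r(2)[OF i] i comb.comb_zero ideal_zero_mem[OF J]
        by (intro exI[of _ \<zero>]) simp
    qed
    then obtain b where b: "\<And>i. i \<in> {1..n} \<Longrightarrow> comb mon ?\<psi> (indices D) (r i \<otimes> g i [^] q) (b i)"
      "\<And>i. i \<in> {1..n} \<Longrightarrow> b i \<in> ?J" by metis
    define \<beta> where "\<beta> = (\<Oplus>i\<in>{1..n}. b i)"
    have \<beta>: "comb mon ?\<psi> (indices D) (g 0 [^] s \<otimes> u) \<beta>"
      unfolding r(3) \<beta>_def by (rule comb_finsum[OF mp _ b(1)]) auto
    have \<beta>J: "\<beta> \<in> ?J" unfolding \<beta>_def using b(2) by (rule ideal_finsum_mem[OF J])
    have cl: "b0 \<in> carrier R" "\<beta> \<in> carrier R"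
      using comb_closed[OF b0(1) mp] comb_closed[OF \<beta> mp] by auto
    have "comb mon ?\<psi> (indices D) (\<ominus> \<one> \<otimes> (g 0 [^] s \<otimes> u)) (\<ominus> \<one> \<otimes> \<beta>)"
      by (rule comb_smult[OF mp \<beta> component_neg[OF one_mem_component_zero]])
    from comb_add[OF mp b0(1) this]
    have "comb mon ?\<psi> (indices D) \<zero> (b0 \<ominus> \<beta>)"
      using uc cl by (simp add: l_minus r_neg minus_eq)
    then have "b0 \<ominus> \<beta> \<in> ?J"
      using k by (intro relation_divmon_mem[OF B _ finite_indices subset_refl]) (auto simp: D_def)
    then have "b0 \<in> ?J" using ideal_minus_iff[OF J cl] \<beta>J by blast
    then show ?thesis using ideal_minus_iff[OF J cl(1) uc b0(2)] by blast
  qed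
  then show ?thesis by blast
qed

end

section \<open>Saturation of the Frobenius powers in high degree\<close>

context noetherian_graded_ring_over_field
begin

text \<open>Properness puts the generators into the irrelevant ideal, so one of degree zero must be
  zero and can be counted in degree 1. Positive degrees are what the variables of the polynomial
  ring need; index 0 stays free for the parameter.\<close>

lemma hideal_homogeneous_generators:
  assumes I: "hideal I" "I \<noteq> carrier R"
  shows "\<exists>n f d. (\<forall>i\<in>{1..n::nat}. f i \<in> \<G> (d i) \<and> d i > 0) \<and> I = Idl (f ` {1..n})"
proof -
  let ?H = "I \<inter> (\<Union>i. \<G> i)"
  have Hc: "?H \<subseteq> carrier R" using component_carrier by blast
  obtain A where A: "finite A" "A \<subseteq> ?H" "Idl ?H = Idl A" using Idl_finite_subset[OF Hc] .
  have "\<exists>i>0. a \<in> \<G> i" if a: "a \<in> A" for a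
  proof -
    obtain i where i: "a \<in> \<G> i" using a A by blast
    have "a \<in> irrelevant_ideal R \<G>" using a A hideal_subset_irrelevant[OF I] by blast
    then have "i = 0 \<Longrightarrow> a = \<zero>" using hcomp_hom[OF i, of 0] by (simp add: irrelevant_ideal_iff)
    then show ?thesis using i component_zero[of 1] by (cases "i = 0") auto
  qed
  then obtain da where da: "\<And>a. a \<in> A \<Longrightarrow> da a > 0 \<and> a \<in> \<G> (da a)" by metis
  obtain as where as: "set as = A" using finite_list[OF A(1)] by blast
  define f where "f = (\<lambda>i. as ! (i - 1))"
  have im: "f ` {1..length as} = A"
  proof -
    have "f ` {1..length as} = (\<lambda>i. as ! i) ` {0..<length as}"
      by (force simp: f_def image_iff intro: bexI[of _ "Suc _"])
    then show ?thesis using as by (simp add: nth_image[of "length as", simplified])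
  qed
  show ?thesis
  proof (intro exI[of _ "length as"] exI[of _ f] exI[of _ "\<lambda>i. da (f i)"] conjI ballI)
    show "f i \<in> \<G> (da (f i))" "da (f i) > 0" if "i \<in> {1..length as}" for i
      using da[of "f i"] im that by blast+
    show "I = Idl (f ` {1..length as})" using im A(3) hideal_eq_Idl[OF I(1)] by simp
  qed
qed

text \<open>Spanning elements are listed as pairs with their degree, because an element alone does
  not determine it: zero lies in every component.\<close>

lemma graded_module_generators:
  "\<exists>(m::nat) e de. (\<forall>j<m. e j \<in> \<G> (de j)) \<and> (\<forall>k<N. \<forall>y\<in>\<G> k. \<exists>B r. finite B \<and>
      (\<forall>b\<in>B. r b \<in> \<G> 0 \<and> (\<exists>j<m. e j = b \<and> de j = k)) \<and> y = (\<Oplus>b\<in>B. r b \<otimes> b))"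
proof -
  have "\<forall>k. \<exists>B\<subseteq>\<G> k. finite B \<and>
      (\<forall>y\<in>\<G> k. \<exists>r. (\<forall>b\<in>B. r b \<in> \<G> 0) \<and> y = (\<Oplus>b\<in>B. r b \<otimes> b))"
    by (intro allI component_finitely_generated)
  from choice[OF this]
  obtain B where "\<forall>k. B k \<subseteq> \<G> k \<and> finite (B k) \<and>
      (\<forall>y\<in>\<G> k. \<exists>r. (\<forall>b\<in>B k. r b \<in> \<G> 0) \<and> y = (\<Oplus>b\<in>B k. r b \<otimes> b))"
    by (elim exE)
  then have B: "\<And>k. finite (B k)" "\<And>k. B k \<subseteq> \<G> k"
    "\<And>k y. y \<in> \<G> k \<Longrightarrow> \<exists>r. (\<forall>b\<in>B k. r b \<in> \<G> 0) \<and> y = (\<Oplus>b\<in>B k. r b \<otimes> b)"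
    by blast+
  obtain es where es: "set es = Sigma {..<N} B"
    using finite_list[of "Sigma {..<N} B"] B(1) by blast
  show ?thesis
  proof (intro exI[of _ "length es"] exI[of _ "\<lambda>j. snd (es ! j)"] exI[of _ "\<lambda>j. fst (es ! j)"]
      conjI allI impI ballI)
    show "snd (es ! j) \<in> \<G> (fst (es ! j))" if "j < length es" for j
    proof -
      have "es ! j \<in> Sigma {..<N} B" using nth_mem[OF that] es by simp
      then have "snd (es ! j) \<in> B (fst (es ! j))" by (metis SigmaE fst_conv snd_conv)
      then show ?thesis using B(2) by blast
    qed
    fix k y assume k: "k < N" and y: "y \<in> \<G> k"
    obtain r where r: "\<forall>b\<in>B k. r b \<in> \<G> 0" "y = (\<Oplus>b\<in>B k. r b \<otimes> b)" using B(3)[OF y] by blast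
    have "\<exists>j<length es. snd (es ! j) = b \<and> fst (es ! j) = k" if "b \<in> B k" for b
    proof -
      have "(k, b) \<in> set es" using that k es by auto
      then show ?thesis by (auto simp: in_set_conv_nth)
    qed
    then show "\<exists>B r. finite B \<and> (\<forall>b\<in>B. r b \<in> \<G> 0 \<and>
        (\<exists>j<length es. snd (es ! j) = b \<and> fst (es ! j) = k)) \<and> y = (\<Oplus>b\<in>B. r b \<otimes> b)"
      using r B(1) by (intro exI[of _ "B k"] exI[of _ r] conjI ballI) simp_all
  qed
qed

lemma frobenius_power_saturated_in_high_degree:
  assumes I: "hideal I" and dim: "krull_dim (R Quot I) = 1"
    and p: "Factorial_Ring.prime (p::nat)" "[p] \<cdot> \<one> = \<zero>"
  shows "\<exists>x d N. d > 0 \<and> x \<in> \<G> d \<and> (\<forall>e s k. \<forall>u\<in>\<G> k.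
      x [^] (s::nat) \<otimes> u \<in> frobenius_power R I (p ^ e) \<longrightarrow> N * p ^ e \<le> k \<longrightarrow>
      u \<in> frobenius_power R I (p ^ e))"
proof -
  have I': "ideal I R" using I by (rule hideal_ideal)
  have Ip: "I \<noteq> carrier R" by (rule quot_dim_one_proper[OF dim I'])
  obtain x d N where x: "d > 0" "x \<in> \<G> d" and N: "\<forall>n\<ge>N. \<G> n \<subseteq> Idl (insert x I)"
    using ex_homogeneous_parameter[OF I dim] by (elim exE conjE)
  obtain n :: nat and f df where f: "\<forall>i\<in>{1..n}. f i \<in> \<G> (df i) \<and> df i > 0" "I = Idl (f ` {1..n})"
    using hideal_homogeneous_generators[OF I Ip] by (elim exE conjE)
  obtain m :: nat and e de where e: "\<forall>j<m. e j \<in> \<G> (de j)"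
    and span: "\<forall>k<N. \<forall>y\<in>\<G> k. \<exists>B r. finite B \<and>
      (\<forall>b\<in>B. r b \<in> \<G> 0 \<and> (\<exists>j<m. e j = b \<and> de j = k)) \<and> y = (\<Oplus>b\<in>B. r b \<otimes> b)"
    using graded_module_generators[of N] by (elim exE conjE)
  define g where "g = (\<lambda>i. if i = 0 then x else f i)"
  define dg where "dg = (\<lambda>i. if i = 0 then d else df i)"
  interpret monomial_presentation R \<G> n g dg m e de
  proof unfold_locales
    show "i \<le> n \<Longrightarrow> g i \<in> \<G> (dg i)" "i \<le> n \<Longrightarrow> 0 < dg i" for i
      using f(1) x by (auto simp: g_def dg_def)
  qed (use e in blast)
  have fc: "f ` {1..n} \<subseteq> carrier R" using f(1) component_carrier by auto
  have gim: "g ` {..n} = insert x (f ` {1..n})"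
  proof -
    have "{..n} = insert 0 {1..n}" by auto
    moreover have "g ` {1..n} = f ` {1..n}" by (intro image_cong) (auto simp: g_def)
    ultimately have "g ` {..n} = insert (g 0) (f ` {1..n})" by (simp only: image_insert)
    then show ?thesis by (simp add: g_def)
  qed
  have gc: "g ` {..n} \<subseteq> carrier R" using g_closed by blast
  have "Idl (insert x I) \<subseteq> Idl (g ` {..n})"
  proof (rule genideal_minimal[OF genideal_ideal[OF gc]])
    have "insert x (f ` {1..n}) \<subseteq> Idl (g ` {..n})" using genideal_self[OF gc] gim by simp
    moreover from this have "I \<subseteq> Idl (g ` {..n})"
      unfolding f(2) by (intro genideal_minimal[OF genideal_ideal[OF gc]]) auto
    ultimately show "insert x I \<subseteq> Idl (g ` {..n})" by blast
  qed
  then have gen: "\<And>k y. k \<ge> N \<Longrightarrow> y \<in> \<G> k \<Longrightarrow> y \<in> Idl (g ` {..n})" using N by blast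
  have "\<exists>B. \<forall>s q k u. u \<in> \<G> k \<longrightarrow> g 0 [^] (s::nat) \<otimes> u \<in> powers_ideal q \<longrightarrow>
    q * (\<Sum>i\<in>{1..n}. dg i) + B \<le> k \<longrightarrow> u \<in> powers_ideal q"
    by (rule koszul_vanishing[OF comb_span[OF span[rule_format] gen]])
  then obtain B where B: "\<And>s q k u. u \<in> \<G> k \<Longrightarrow> g 0 [^] (s::nat) \<otimes> u \<in> powers_ideal q \<Longrightarrow>
    q * (\<Sum>i\<in>{1..n}. dg i) + B \<le> k \<Longrightarrow> u \<in> powers_ideal q" by blast
  have fp: "frobenius_power R I (p ^ e) = powers_ideal (p ^ e)" for e
  proof -
    have "frobenius_power R I (p ^ e) = Idl ((\<lambda>x. x [^] (p ^ e)) ` f ` {1..n})"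
      unfolding f(2) by (rule frobenius_power_Idl[OF p fc])
    also have "(\<lambda>x. x [^] (p ^ e)) ` f ` {1..n} = (\<lambda>i. g i [^] (p ^ e)) ` {1..n}"
      unfolding image_image by (intro image_cong) (auto simp: g_def)
    finally show ?thesis by (simp add: powers_ideal_def)
  qed
  show ?thesis
  proof (rule exI[of _ x], rule exI[of _ d], rule exI[of _ "(\<Sum>i\<in>{1..n}. dg i) + B"],
      intro conjI allI ballI impI x)
    fix e s u k assume u: "u \<in> \<G> k" "x [^] (s::nat) \<otimes> u \<in> frobenius_power R I (p ^ e)"
      "((\<Sum>i\<in>{1..n}. dg i) + B) * p ^ e \<le> k"
    \<comment> \<open>The additive constant of the Koszul bound is absorbed into a multiple of
      \<open>p ^ e\<close>, which gives a bound linear in the Frobenius exponent.\<close>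
    have "B * 1 \<le> B * p ^ e" using p(1) prime_gt_0_nat[of p] by (intro mult_left_mono) simp_all
    moreover have "((\<Sum>i\<in>{1..n}. dg i) + B) * p ^ e = p ^ e * (\<Sum>i\<in>{1..n}. dg i) + B * p ^ e"
      by (simp add: algebra_simps)
    ultimately have "p ^ e * (\<Sum>i\<in>{1..n}. dg i) + B \<le> k" using u(3) by linarith
    then show "u \<in> frobenius_power R I (p ^ e)"
      using B[OF u(1)] u(2) by (simp add: fp g_def)
  qed
qed

end

section \<open>The conditions (LC) and (LC*)\<close>

context cring
begin

lemma one_off_minimal_primes: "\<one> \<in> off_minimal_primes R"
  unfolding off_minimal_primes_def minimal_primes_def
  using ideal.one_imp_carrier primeideal.axioms(1) primeideal.I_notcarr by fastforce

lemma mult_off_minimal_primes: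
  assumes "a \<in> off_minimal_primes R" "b \<in> off_minimal_primes R"
  shows "a \<otimes> b \<in> off_minimal_primes R"
  using assms primeideal.I_prime unfolding off_minimal_primes_def minimal_primes_def by fastforce

lemma off_minimal_primes_closed: "a \<in> off_minimal_primes R \<Longrightarrow> a \<in> carrier R"
  by (simp add: off_minimal_primes_def)

lemma tight_closure_ideal:
  assumes p: "Factorial_Ring.prime (p::nat)" "[p] \<cdot> \<one> = \<zero>" and J: "ideal J R"
  shows "ideal (tight_closure R p J) R"
proof (rule idealI')
  note F = frobenius_power_ideal[OF J]
  have pp: "p ^ e > 0" for e using p(1) prime_gt_0_nat by simp
  show "tight_closure R p J \<subseteq> carrier R" by (auto simp: tight_closure_def)
  show "\<zero> \<in> tight_closure R p J"
    unfolding tight_closure_def using ideal_zero_mem[OF F] pp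
    by (auto intro!: bexI[OF _ one_off_minimal_primes] simp: nat_pow_zero)
  fix a assume "a \<in> tight_closure R p J"
  then obtain c e0 where a: "a \<in> carrier R" "c \<in> off_minimal_primes R"
    "\<And>e. e \<ge> e0 \<Longrightarrow> c \<otimes> a [^] (p ^ e) \<in> frobenius_power R J (p ^ e)"
    unfolding tight_closure_def by blast
  have cc: "c \<in> carrier R" using a off_minimal_primes_closed by blast
  show "a \<oplus> b \<in> tight_closure R p J" if b: "b \<in> tight_closure R p J" for b
  proof -
    obtain c' e0' where b: "b \<in> carrier R" "c' \<in> off_minimal_primes R"
      "\<And>e. e \<ge> e0' \<Longrightarrow> c' \<otimes> b [^] (p ^ e) \<in> frobenius_power R J (p ^ e)"
      using b unfolding tight_closure_def by blast
    have cc': "c' \<in> carrier R" using b off_minimal_primes_closed by blast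
    have "c \<otimes> c' \<otimes> (a \<oplus> b) [^] (p ^ e) \<in> frobenius_power R J (p ^ e)" if e: "e \<ge> max e0 e0'" for e
    proof -
      have "c' \<otimes> (c \<otimes> a [^] (p ^ e)) \<oplus> c \<otimes> (c' \<otimes> b [^] (p ^ e)) \<in> frobenius_power R J (p ^ e)"
        using a(3)[of e] b(3)[of e] e cc cc' by (simp add: ideal_add_mem[OF F] ideal_lmult_mem[OF F])
      also have "c' \<otimes> (c \<otimes> a [^] (p ^ e)) \<oplus> c \<otimes> (c' \<otimes> b [^] (p ^ e)) = c \<otimes> c' \<otimes> (a \<oplus> b) [^] (p ^ e)"
        using a(1) b(1) cc cc' m_lcomm[of c' c] frobenius_add[OF p a(1) b(1)]
        by (simp add: r_distr m_assoc)
      finally show ?thesis .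
    qed
    then show ?thesis
      unfolding tight_closure_def using a(1) b(1) mult_off_minimal_primes[OF a(2) b(2)] by blast
  qed
  show "r \<otimes> a \<in> tight_closure R p J" if r: "r \<in> carrier R" for r
  proof -
    have "c \<otimes> (r \<otimes> a) [^] (p ^ e) \<in> frobenius_power R J (p ^ e)" if e: "e \<ge> e0" for e
    proof -
      have "r [^] (p ^ e) \<otimes> (c \<otimes> a [^] (p ^ e)) \<in> frobenius_power R J (p ^ e)"
        using a(3)[OF e] r by (simp add: ideal_lmult_mem[OF F])
      then show ?thesis using r a(1) cc m_lcomm[of c] by (simp add: nat_pow_distrib)
    qed
    then show ?thesis unfolding tight_closure_def using a(1,2) r by blast
  qed
qed

lemma pow_mem_ideals_set_pow:
  assumes "ideal M R" "a \<in> M"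
  shows "a [^] (n::nat) \<in> M [^]\<^bsub>ideals_set R\<^esub> n"
proof (induction n)
  case 0
  then show ?case by (simp add: ideals_set_def nat_pow_def)
next
  case (Suc n)
  then have "a [^] n \<otimes> a \<in> ideal_prod R (M [^]\<^bsub>ideals_set R\<^esub> n) M"
    using assms by (intro ideal_prod.prod)
  then show ?case by (simp add: ideals_set_def nat_pow_def)
qed

text \<open>Of the power of \<open>M\<close> that kills the class, only the power of one element
  \<open>a\<close> is kept; \<open>a\<close> will be the parameter, whose effect on Frobenius powers
  is already controlled.\<close>

lemma H0_quot_moduleE:
  assumes J: "ideal J R" and M: "ideal M R" and A: "A \<in> H0 R M (quot_module R J)" and a: "a \<in> M"
  obtains u n where "u \<in> carrier R" "A = J +> u" "a [^] (n::nat) \<otimes> u \<in> J"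
proof -
  have ac: "a \<in> carrier R" using a M ideal_mem_carrier by blast
  have "carrier (R Quot J) = (+>) J ` carrier R"
    by (auto simp: FactRing_def A_RCOSETS_def' a_r_coset_def')
  then obtain u where u: "u \<in> carrier R" "A = J +> u"
    using A by (auto simp: H0_def quot_module_simps)
  obtain n where n: "\<forall>r \<in> M [^]\<^bsub>ideals_set R\<^esub> (n::nat). r \<odot>\<^bsub>quot_module R J\<^esub> A = J"
    using A by (auto simp: H0_def quot_module_simps)
  then have "a [^] n \<odot>\<^bsub>quot_module R J\<^esub> (J +> u) = J"
    using pow_mem_ideals_set_pow[OF M a] u by blast
  then have "J +> (a [^] n \<otimes> u) = J" using u ac by (simp add: quot_module_smult[OF J])
  then have "a [^] n \<otimes> u \<in> J" using u ac by (intro ideal.rcos_const_imp_mem[OF J]) auto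
  then show ?thesis using that u by blast
qed

end

context noetherian_graded_ring_over_field
begin

text \<open>The multiples of \<open>\<one>\<close> lie in the field \<open>\<G> 0\<close>, where a
  product vanishes only if a factor does; hence \<open>p\<close> divides a product only if it
  divides a factor.\<close>

lemma has_char_prime:
  assumes ch: "has_char (R\<lparr>carrier := \<G> 0\<rparr>) p" and p0: "p > 0"
  shows "Factorial_Ring.prime p" and "[p] \<cdot> \<one> = \<zero>"
proof -
  have eq: "[n] \<cdot>\<^bsub>R\<lparr>carrier := \<G> 0\<rparr>\<^esub> \<one> = [n] \<cdot> \<one>" for n :: nat
    by (simp add: add_pow_def nat_pow_def)
  have z: "[n] \<cdot> \<one> = \<zero> \<longleftrightarrow> p dvd n" for n :: nat
    using ch eq by (simp add: has_char_def)
  have "[(1::nat)] \<cdot> \<one> = \<one>" by simp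
  moreover have "\<one> \<noteq> \<zero>" by (rule subfieldE(6)[OF component_zero_field])
  ultimately have p1: "\<not> p dvd 1" using z[of 1] by metis
  have mem: "[n] \<cdot> \<one> \<in> \<G> 0" for n :: nat
    by (induction n) (auto intro: component_add one_mem_component_zero)
  have "prime_elem p"
  proof (rule prime_elemI)
    fix a b assume "p dvd a * b"
    then have "[(a * b)] \<cdot> \<one> = \<zero>" using z by blast
    moreover have "[a] \<cdot> \<one> \<otimes> [b] \<cdot> \<one> = [(a * b)] \<cdot> \<one>"
      by (simp add: add_pow_ldistr add.nat_pow_pow mult.commute)
    ultimately have "[a] \<cdot> \<one> = \<zero> \<or> [b] \<cdot> \<one> = \<zero>"
      using subfieldE(5)[OF component_zero_field mem mem] by simp
    then show "p dvd a \<or> p dvd b" using z by blast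
  qed (use p0 p1 in auto)
  then show "Factorial_Ring.prime p" by (simp add: prime_def)
  show "[p] \<cdot> \<one> = \<zero>" using z by simp
qed

lemma hideal_frobenius_power:
  assumes p: "Factorial_Ring.prime (p::nat)" "[p] \<cdot> \<one> = \<zero>" and I: "hideal I"
  shows "hideal (frobenius_power R I (p ^ e))"
proof -
  let ?H = "I \<inter> (\<Union>i. \<G> i)"
  have "?H \<subseteq> carrier R" using component_carrier by blast
  then have "frobenius_power R (Idl ?H) (p ^ e) = Idl ((\<lambda>x. x [^] (p ^ e)) ` ?H)"
    by (rule frobenius_power_Idl[OF p])
  moreover have "(\<lambda>x. x [^] (p ^ e)) ` ?H \<subseteq> (\<Union>i. \<G> i)" using component_pow by blast
  ultimately show ?thesis using hideal_eq_Idl[OF I] hideal_Idl by metis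
qed

lemma ideal_degree_ge_mem: "r \<in> \<G> k \<Longrightarrow> M \<le> k \<Longrightarrow> r \<in> ideal_degree_ge R \<G> M"
  unfolding ideal_degree_ge_def using component_carrier
  by (intro set_mp[OF genideal_self]) auto

lemma ideal_degree_ge_ideal: "ideal (ideal_degree_ge R \<G> M) R"
  unfolding ideal_degree_ge_def using component_carrier by (intro genideal_ideal) auto

lemma ideal_degree_ge_mult_mem:
  assumes J: "ideal J R" and u: "u \<in> carrier R"
    and h: "\<And>k r. M \<le> k \<Longrightarrow> r \<in> \<G> k \<Longrightarrow> r \<otimes> u \<in> J" and r: "r \<in> ideal_degree_ge R \<G> M"
  shows "r \<otimes> u \<in> J"
proof -
  have "(\<Union>i\<in>{M..}. \<G> i) \<subseteq> {r \<in> carrier R. r \<otimes> u \<in> J}" using h component_carrier by auto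
  then have "ideal_degree_ge R \<G> M \<subseteq> {r \<in> carrier R. r \<otimes> u \<in> J}"
    unfolding ideal_degree_ge_def by (rule genideal_minimal[OF colon_ideal[OF J u]])
  then show ?thesis using r by blast
qed

text \<open>Multiplication by a homogeneous \<open>r\<close> of degree at least
  \<open>N * p ^ e\<close> moves every component of \<open>u\<close> into the range where the
  Frobenius power is saturated with respect to \<open>x\<close>.\<close>

lemma high_degree_kills_saturation:
  assumes I: "hideal I" and dim: "krull_dim (R Quot I) = 1"
    and p: "Factorial_Ring.prime (p::nat)" "[p] \<cdot> \<one> = \<zero>"
  shows "\<exists>x N d. d > 0 \<and> x \<in> \<G> d \<and> (\<forall>e s. \<forall>u\<in>carrier R. x [^] (s::nat) \<otimes> u \<in> frobenius_power R I (p ^ e) \<longrightarrow>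
    (\<forall>r\<in>ideal_degree_ge R \<G> (N * p ^ e). r \<otimes> u \<in> frobenius_power R I (p ^ e)))"
proof -
  obtain x d N where x: "d > 0" "x \<in> \<G> d" and sat: "\<forall>e s k. \<forall>u\<in>\<G> k.
      x [^] (s::nat) \<otimes> u \<in> frobenius_power R I (p ^ e) \<longrightarrow> N * p ^ e \<le> k \<longrightarrow>
      u \<in> frobenius_power R I (p ^ e)"
    using frobenius_power_saturated_in_high_degree[OF I dim p] by (elim exE conjE)
  have xc: "x \<in> carrier R" using x component_carrier by blast
  have main: "r \<otimes> u \<in> frobenius_power R I (p ^ e)"
    if u: "u \<in> carrier R" "x [^] (s::nat) \<otimes> u \<in> frobenius_power R I (p ^ e)"
      and r: "r \<in> ideal_degree_ge R \<G> (N * p ^ e)" for e s u r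
  proof -
    let ?J = "frobenius_power R I (p ^ e)"
    have Jh: "hideal ?J" by (rule hideal_frobenius_power[OF p I])
    have J: "ideal ?J R" using Jh by (rule hideal_ideal)
    have "r \<otimes> u \<in> ?J" if k: "N * p ^ e \<le> k" and r: "r \<in> \<G> k" for k r
    proof -
      have rc: "r \<in> carrier R" using r component_carrier by blast
      have "r \<otimes> hcomp u j \<in> ?J" for j
      proof -
        have "hcomp (x [^] s \<otimes> u) (s * d + j) \<in> ?J" using hideal_hcomp[OF Jh u(2)] .
        then have "x [^] s \<otimes> hcomp u j \<in> ?J"
          using hcomp_mult_hom[OF component_pow[OF x(2)] u(1)] by simp
        then have "r \<otimes> (x [^] s \<otimes> hcomp u j) \<in> ?J" using rc by (rule ideal_lmult_mem[OF J])
        then have "x [^] s \<otimes> (r \<otimes> hcomp u j) \<in> ?J" using m_lcomm[of r "x [^] s"] rc xc u by simp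
        moreover have "r \<otimes> hcomp u j \<in> \<G> (k + j)" by (rule component_mult[OF r hcomp_mem[OF u(1)]])
        moreover have "N * p ^ e \<le> k + j" using k by simp
        ultimately show ?thesis using sat by blast
      qed
      then have "hcomp (r \<otimes> u) i \<in> ?J" for i
        using hcomp_mult_hom[OF r u(1)] ideal_zero_mem[OF J] by simp
      then show ?thesis by (rule mem_of_hcomp_mem[OF J m_closed[OF rc u(1)]])
    qed
    then show ?thesis using r by (rule ideal_degree_ge_mult_mem[OF J u(1)])
  qed
  show ?thesis
    by (rule exI[of _ x], rule exI[of _ N], rule exI[of _ d]) (intro conjI allI ballI impI x, rule main)
qed

lemma LC_dim_one:
  assumes I: "hideal I" and dim: "krull_dim (R Quot I) = 1"
    and p: "Factorial_Ring.prime (p::nat)" "[p] \<cdot> \<one> = \<zero>"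
  shows "LC R \<G> p I"
proof -
  have I': "ideal I R" using I by (rule hideal_ideal)
  obtain x N d where x: "d > 0" "x \<in> \<G> d" and kill: "\<forall>e s. \<forall>u\<in>carrier R.
    x [^] (s::nat) \<otimes> u \<in> frobenius_power R I (p ^ e) \<longrightarrow>
    (\<forall>r\<in>ideal_degree_ge R \<G> (N * p ^ e). r \<otimes> u \<in> frobenius_power R I (p ^ e))"
    using high_degree_kills_saturation[OF I dim p] by (elim exE conjE)
  have "r \<odot>\<^bsub>quot_module R (frobenius_power R I (p ^ e))\<^esub> A = frobenius_power R I (p ^ e)"
    if r: "r \<in> ideal_degree_ge R \<G> (N * p ^ e)"
      and A: "A \<in> H0 R (irrelevant_ideal R \<G>) (quot_module R (frobenius_power R I (p ^ e)))" for e r A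
  proof -
    let ?J = "frobenius_power R I (p ^ e)"
    have J: "ideal ?J R" by (rule frobenius_power_ideal[OF I'])
    obtain u s where u: "u \<in> carrier R" "A = ?J +> u" "x [^] (s::nat) \<otimes> u \<in> ?J"
      using H0_quot_moduleE[OF J hideal_ideal[OF hideal_irrelevant] A component_mem_irrelevant[OF x(2,1)]] .
    have "r \<in> carrier R" by (rule ideal_mem_carrier[OF ideal_degree_ge_ideal r])
    moreover have "r \<otimes> u \<in> ?J" by (rule kill[rule_format, OF u(1,3) r])
    ultimately show ?thesis
      unfolding u(2) using r u(1) by (simp add: quot_module_smult[OF J] a_rcos_zero[OF J])
  qed
  then show ?thesis
    unfolding LC_def Let_def quot_module_simps by (intro exI[of _ N] allI ballI)
qed

lemma LC_star_dim_one:
  assumes I: "hideal I" and dim: "krull_dim (R Quot I) = 1"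
    and p: "Factorial_Ring.prime (p::nat)" "[p] \<cdot> \<one> = \<zero>"
  shows "LC_star R \<G> p I"
proof -
  have I': "ideal I R" using I by (rule hideal_ideal)
  obtain x N d where x: "d > 0" "x \<in> \<G> d" and kill: "\<forall>e s. \<forall>u\<in>carrier R.
    x [^] (s::nat) \<otimes> u \<in> frobenius_power R I (p ^ e) \<longrightarrow>
    (\<forall>r\<in>ideal_degree_ge R \<G> (N * p ^ e). r \<otimes> u \<in> frobenius_power R I (p ^ e))"
    using high_degree_kills_saturation[OF I dim p] by (elim exE conjE)
  have xc: "x \<in> carrier R" using x component_carrier by blast
  have "r \<odot>\<^bsub>quot_module R (tight_closure R p (frobenius_power R I (p ^ e)))\<^esub> A =
      tight_closure R p (frobenius_power R I (p ^ e))"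
    if r: "r \<in> ideal_degree_ge R \<G> (N * p ^ e)"
      and A: "A \<in> H0 R (irrelevant_ideal R \<G>) (quot_module R (tight_closure R p (frobenius_power R I (p ^ e))))"
    for e r A
  proof -
    let ?J = "frobenius_power R I (p ^ e)"
    let ?T = "tight_closure R p ?J"
    have J: "ideal ?J R" by (rule frobenius_power_ideal[OF I'])
    have T: "ideal ?T R" by (rule tight_closure_ideal[OF p J])
    obtain u s where u: "u \<in> carrier R" "A = ?T +> u" "x [^] (s::nat) \<otimes> u \<in> ?T"
      using H0_quot_moduleE[OF T hideal_ideal[OF hideal_irrelevant] A component_mem_irrelevant[OF x(2,1)]] .
    obtain c e0 where c: "c \<in> off_minimal_primes R"
      "\<And>e'. e' \<ge> e0 \<Longrightarrow> c \<otimes> (x [^] s \<otimes> u) [^] (p ^ e') \<in> frobenius_power R ?J (p ^ e')"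
      using u(3) unfolding tight_closure_def by blast
    have cc: "c \<in> carrier R" using c off_minimal_primes_closed by blast
    have "r \<otimes> u \<in> ?T" if k: "N * p ^ e \<le> k" and r: "r \<in> \<G> k" for k r
    proof -
      have rc: "r \<in> carrier R" using r component_carrier by blast
      have "c \<otimes> (r \<otimes> u) [^] (p ^ e') \<in> frobenius_power R ?J (p ^ e')" if e': "e' \<ge> e0" for e'
      proof -
        let ?q = "p ^ e'"
        have eq: "frobenius_power R ?J ?q = frobenius_power R I (p ^ (e + e'))"
          by (rule frobenius_power_frobenius_power[OF p I'])
        have "c \<otimes> (x [^] s \<otimes> u) [^] ?q = x [^] (s * ?q) \<otimes> (c \<otimes> u [^] ?q)"
          using cc xc u(1) m_lcomm[of c "x [^] (s * ?q)"] by (simp add: nat_pow_distrib nat_pow_pow)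
        then have "x [^] (s * ?q) \<otimes> (c \<otimes> u [^] ?q) \<in> frobenius_power R I (p ^ (e + e'))"
          using c(2)[OF e'] eq by simp
        moreover have "r [^] ?q \<in> ideal_degree_ge R \<G> (N * p ^ (e + e'))"
          using component_pow[OF r, of ?q] k
            by (intro ideal_degree_ge_mem) (auto simp: power_add mult.commute)
        ultimately have "r [^] ?q \<otimes> (c \<otimes> u [^] ?q) \<in> frobenius_power R I (p ^ (e + e'))"
          using kill[rule_format, of "c \<otimes> u [^] ?q"] cc u(1) by simp
        then show ?thesis
          unfolding eq using cc rc u(1) m_lcomm[of c "r [^] ?q"] by (simp add: nat_pow_distrib)
      qed
      then show ?thesis unfolding tight_closure_def using c(1) rc u(1) by blast
    qed
    then have "r \<otimes> u \<in> ?T" using r by (rule ideal_degree_ge_mult_mem[OF T u(1)])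
    moreover have "r \<in> carrier R" by (rule ideal_mem_carrier[OF ideal_degree_ge_ideal r])
    ultimately show ?thesis
      unfolding u(2) using r u(1) by (simp add: quot_module_smult[OF T] a_rcos_zero[OF T])
  qed
  then show ?thesis
    unfolding LC_star_def Let_def quot_module_simps by (intro exI[of _ N] allI ballI)
qed

end

section \<open>Localization\<close>

locale cring_localization = cring R for R (structure) +
  fixes W :: "'a set"
  assumes W: "submonoid W R"
begin

abbreviation "L \<equiv> localization R W"

abbreviation "fr \<equiv> fraction R W"

lemma W_closed [simp]: "s \<in> W \<Longrightarrow> s \<in> carrier R"
  using W submonoid.subset by blast

lemma W_one [simp]: "\<one> \<in> W"
  using W submonoid.one_closed by blast

lemma W_mult [simp]: "s \<in> W \<Longrightarrow> t \<in> W \<Longrightarrow> s \<otimes> t \<in> W"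
  using W submonoid.m_closed by metis

lemma W_pow [simp]: "s \<in> W \<Longrightarrow> s [^] (n::nat) \<in> W"
  by (induction n) auto

lemmas fr_eq_iff = fraction_eq_iff[OF cring_axioms W]
  and fr_mult = localization_mult[OF cring_axioms W]
  and fr_add = localization_add[OF cring_axioms W]

lemma fr_eqI:
  assumes "a \<in> carrier R" "s \<in> W" "b \<in> carrier R" "t \<in> W" "t \<otimes> a = s \<otimes> b"
  shows "fr a s = fr b t"
  using fr_eq_iff[OF assms(1-4)] assms(5)
    by (intro iffD2[OF fr_eq_iff[OF assms(1-4)]] bexI[of _ \<one>]) auto

lemma localization_carrier: "carrier L = {fr a s | a s. a \<in> carrier R \<and> s \<in> W}"
  by (auto simp: localization_def quotient_def fraction_def)

lemma fr_closed [simp]: "a \<in> carrier R \<Longrightarrow> s \<in> W \<Longrightarrow> fr a s \<in> carrier L"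
  using localization_carrier by blast

lemma localization_carrierE:
  assumes "x \<in> carrier L"
  obtains a s where "a \<in> carrier R" "s \<in> W" "x = fr a s"
  using assms localization_carrier by blast

lemma localization_one: "\<one>\<^bsub>L\<^esub> = fr \<one> \<one>"
  by (simp add: localization_def)

lemma localization_zero: "\<zero>\<^bsub>L\<^esub> = fr \<zero> \<one>"
  by (simp add: localization_def)

lemma cring_localization: "cring L"
proof (rule cringI)
  show "abelian_group L"
  proof (rule abelian_groupI)
    fix x y assume "x \<in> carrier L" "y \<in> carrier L"
    then obtain a s b t where *: "a \<in> carrier R" "s \<in> W" "x = fr a s" "b \<in> carrier R" "t \<in> W" "y = fr b t"
      by (elim localization_carrierE)
    show "x \<oplus>\<^bsub>L\<^esub> y \<in> carrier L" using * by (simp add: fr_add)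
    show "x \<oplus>\<^bsub>L\<^esub> y = y \<oplus>\<^bsub>L\<^esub> x" using * by (simp add: fr_add a_comm m_comm)
    fix z assume "z \<in> carrier L"
    then obtain c r where **: "c \<in> carrier R" "r \<in> W" "z = fr c r" by (elim localization_carrierE)
    show "x \<oplus>\<^bsub>L\<^esub> y \<oplus>\<^bsub>L\<^esub> z = x \<oplus>\<^bsub>L\<^esub> (y \<oplus>\<^bsub>L\<^esub> z)"
      using * ** by (simp add: fr_add r_distr m_ac a_ac)
  next
    show "\<zero>\<^bsub>L\<^esub> \<in> carrier L" by (simp add: localization_zero)
    fix x assume "x \<in> carrier L"
    then obtain a s where *: "a \<in> carrier R" "s \<in> W" "x = fr a s" by (elim localization_carrierE)
    show "\<zero>\<^bsub>L\<^esub> \<oplus>\<^bsub>L\<^esub> x = x" using * by (simp add: localization_zero fr_add)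
    have "fr (\<ominus> a) s \<oplus>\<^bsub>L\<^esub> x = fr \<zero> (s \<otimes> s)" using * by (simp add: fr_add r_minus l_neg)
    also have "\<dots> = \<zero>\<^bsub>L\<^esub>" unfolding localization_zero using * by (intro fr_eqI) auto
    finally show "\<exists>y\<in>carrier L. y \<oplus>\<^bsub>L\<^esub> x = \<zero>\<^bsub>L\<^esub>" using * by (intro bexI[of _ "fr (\<ominus> a) s"]) auto
  qed
  show "Group.comm_monoid L"
  proof (rule comm_monoidI)
    fix x y assume "x \<in> carrier L" "y \<in> carrier L"
    then obtain a s b t where *: "a \<in> carrier R" "s \<in> W" "x = fr a s" "b \<in> carrier R" "t \<in> W" "y = fr b t"
      by (elim localization_carrierE)
    show "x \<otimes>\<^bsub>L\<^esub> y \<in> carrier L" using * by (simp add: fr_mult)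
    show "x \<otimes>\<^bsub>L\<^esub> y = y \<otimes>\<^bsub>L\<^esub> x" using * by (simp add: fr_mult m_comm)
    fix z assume "z \<in> carrier L"
    then obtain c r where **: "c \<in> carrier R" "r \<in> W" "z = fr c r" by (elim localization_carrierE)
    show "x \<otimes>\<^bsub>L\<^esub> y \<otimes>\<^bsub>L\<^esub> z = x \<otimes>\<^bsub>L\<^esub> (y \<otimes>\<^bsub>L\<^esub> z)"
      using * ** by (simp add: fr_mult m_assoc)
  next
    show "\<one>\<^bsub>L\<^esub> \<in> carrier L" by (simp add: localization_one)
    fix x assume "x \<in> carrier L"
    then show "\<one>\<^bsub>L\<^esub> \<otimes>\<^bsub>L\<^esub> x = x"
      by (elim localization_carrierE) (simp add: localization_one fr_mult)
  qed
  fix x y z assume "x \<in> carrier L" "y \<in> carrier L" "z \<in> carrier L"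
  then obtain a s b t c r where *: "a \<in> carrier R" "s \<in> W" "x = fr a s" "b \<in> carrier R" "t \<in> W" "y = fr b t"
    "c \<in> carrier R" "r \<in> W" "z = fr c r"
    by (elim localization_carrierE)
  have "fr ((t \<otimes> a \<oplus> s \<otimes> b) \<otimes> c) (s \<otimes> t \<otimes> r) =
      fr (t \<otimes> r \<otimes> (a \<otimes> c) \<oplus> s \<otimes> r \<otimes> (b \<otimes> c)) (s \<otimes> r \<otimes> (t \<otimes> r))"
    using *(1,2,4,5,7,8) by (intro fr_eqI) (simp_all add: r_distr l_distr m_ac)
  then show "(x \<oplus>\<^bsub>L\<^esub> y) \<otimes>\<^bsub>L\<^esub> z = x \<otimes>\<^bsub>L\<^esub> z \<oplus>\<^bsub>L\<^esub> y \<otimes>\<^bsub>L\<^esub> z"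
    using * by (simp add: fr_add fr_mult)
qed

sublocale L: cring L
  by (rule cring_localization)

lemma fr_pow: "a \<in> carrier R \<Longrightarrow> s \<in> W \<Longrightarrow> fr a s [^]\<^bsub>L\<^esub> (n::nat) = fr (a [^] n) (s [^] n)"
  by (induction n) (simp_all add: localization_one fr_mult)

lemma fr_split: "a \<in> carrier R \<Longrightarrow> s \<in> W \<Longrightarrow> fr a s = fr \<one> s \<otimes>\<^bsub>L\<^esub> fr a \<one>"
  by (simp add: fr_mult)

lemma fr_cancel:
  assumes "a \<in> carrier R" "s \<in> W"
  shows "fr a \<one> = fr s \<one> \<otimes>\<^bsub>L\<^esub> fr a s"
proof -
  have "fr s \<one> \<otimes>\<^bsub>L\<^esub> fr a s = fr (s \<otimes> a) s" using assms by (simp add: fr_mult)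
  also have "\<dots> = fr a \<one>" using assms by (intro fr_eqI) auto
  finally show ?thesis by simp
qed

lemma fr_mem_localize_ideal: "a \<in> J \<Longrightarrow> s \<in> W \<Longrightarrow> fr a s \<in> localize_ideal R W J"
  unfolding localize_ideal_def by blast

lemma localize_ideal_mem_iff:
  assumes J: "ideal J R" and a: "a \<in> carrier R" "s \<in> W"
  shows "fr a s \<in> localize_ideal R W J \<longleftrightarrow> (\<exists>w\<in>W. w \<otimes> a \<in> J)"
proof
  assume "fr a s \<in> localize_ideal R W J"
  then obtain b t where b: "b \<in> J" "t \<in> W" "fr a s = fr b t" unfolding localize_ideal_def by blast
  have bc: "b \<in> carrier R" using b J ideal_mem_carrier by blast
  obtain u where u: "u \<in> W" "u \<otimes> (t \<otimes> a) = u \<otimes> (s \<otimes> b)"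
    using b(3) fr_eq_iff[OF a bc b(2)] by blast
  have "u \<otimes> (s \<otimes> b) \<in> J" using u a b by (simp add: ideal_lmult_mem[OF J])
  then have "(u \<otimes> t) \<otimes> a \<in> J" using u a b by (simp add: m_assoc)
  then show "\<exists>w\<in>W. w \<otimes> a \<in> J" using u b by (intro bexI[of _ "u \<otimes> t"]) auto
next
  assume "\<exists>w\<in>W. w \<otimes> a \<in> J"
  then obtain w where w: "w \<in> W" "w \<otimes> a \<in> J" by blast
  have "fr a s = fr (w \<otimes> a) (w \<otimes> s)" using w a by (intro fr_eqI) (auto simp: m_ac)
  then show "fr a s \<in> localize_ideal R W J" using w a by (simp add: fr_mem_localize_ideal)
qed

lemma localize_ideal_ideal:
  assumes J: "ideal J R"
  shows "ideal (localize_ideal R W J) L"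
proof (rule L.idealI')
  have Jc: "\<And>a. a \<in> J \<Longrightarrow> a \<in> carrier R" using J ideal_mem_carrier by blast
  show "localize_ideal R W J \<subseteq> carrier L" unfolding localize_ideal_def using Jc by auto
  show "\<zero>\<^bsub>L\<^esub> \<in> localize_ideal R W J"
    using ideal_zero_mem[OF J] by (simp add: localization_zero fr_mem_localize_ideal)
  fix x assume "x \<in> localize_ideal R W J"
  then obtain a s where a: "a \<in> J" "s \<in> W" "x = fr a s" unfolding localize_ideal_def by blast
  show "x \<oplus>\<^bsub>L\<^esub> y \<in> localize_ideal R W J" if y: "y \<in> localize_ideal R W J" for y
  proof -
    obtain b t where b: "b \<in> J" "t \<in> W" "y = fr b t" using y unfolding localize_ideal_def by blast
    have "t \<otimes> a \<oplus> s \<otimes> b \<in> J"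
      using a b by (simp add: ideal_add_mem[OF J] ideal_lmult_mem[OF J])
    then show ?thesis using a b Jc by (simp add: fr_add fr_mem_localize_ideal)
  qed
  show "y \<otimes>\<^bsub>L\<^esub> x \<in> localize_ideal R W J" if y: "y \<in> carrier L" for y
  proof -
    obtain b t where b: "b \<in> carrier R" "t \<in> W" "y = fr b t" using y by (elim localization_carrierE)
    have "b \<otimes> a \<in> J" using a b by (simp add: ideal_lmult_mem[OF J])
    then show ?thesis using a b Jc by (simp add: fr_mult fr_mem_localize_ideal)
  qed
qed

section \<open>Primes, Frobenius powers and tight closure under localization\<close>

definition contraction :: "('a \<times> 'a) set set \<Rightarrow> 'a set" where
  "contraction Q = {a \<in> carrier R. fr a \<one> \<in> Q}"

lemma contraction_ideal:
  assumes Q: "ideal Q L"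
  shows "ideal (contraction Q) R"
proof (rule idealI')
  show "\<zero> \<in> contraction Q"
    using L.ideal_zero_mem[OF Q] by (simp add: contraction_def localization_zero)
  show "a \<oplus> b \<in> contraction Q" if ab: "a \<in> contraction Q" "b \<in> contraction Q" for a b
  proof -
    have "fr a \<one> \<oplus>\<^bsub>L\<^esub> fr b \<one> \<in> Q" using ab L.ideal_add_mem[OF Q] by (simp add: contraction_def)
    then show ?thesis using ab by (simp add: contraction_def fr_add)
  qed
  show "r \<otimes> a \<in> contraction Q" if ab: "a \<in> contraction Q" "r \<in> carrier R" for a r
  proof -
    have "fr r \<one> \<otimes>\<^bsub>L\<^esub> fr a \<one> \<in> Q" using ab L.ideal_lmult_mem[OF Q] by (simp add: contraction_def)
    then show ?thesis using ab by (simp add: contraction_def fr_mult)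
  qed
qed (auto simp: contraction_def)

lemma fr_mem_iff_contraction:
  assumes Q: "ideal Q L" and a: "a \<in> carrier R" "s \<in> W"
  shows "fr a s \<in> Q \<longleftrightarrow> a \<in> contraction Q"
proof
  assume "fr a s \<in> Q"
  then have "fr s \<one> \<otimes>\<^bsub>L\<^esub> fr a s \<in> Q" using a by (simp add: L.ideal_lmult_mem[OF Q])
  then show "a \<in> contraction Q" using a fr_cancel[OF a] by (simp add: contraction_def)
next
  assume "a \<in> contraction Q"
  then have "fr \<one> s \<otimes>\<^bsub>L\<^esub> fr a \<one> \<in> Q" using a by (simp add: contraction_def L.ideal_lmult_mem[OF Q])
  then show "fr a s \<in> Q" using fr_split[OF a] by simp
qed

lemma contraction_prime:
  assumes Q: "primeideal Q L"
  shows "primeideal (contraction Q) R" "contraction Q \<inter> W = {}"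
proof -
  interpret Q: primeideal Q L by fact
  have one: "\<one>\<^bsub>L\<^esub> \<notin> Q" using Q.one_imp_carrier Q.I_notcarr by blast
  show disj: "contraction Q \<inter> W = {}"
  proof (rule ccontr)
    assume "contraction Q \<inter> W \<noteq> {}"
    then obtain w where w: "w \<in> contraction Q" "w \<in> W" by blast
    have "fr w w \<in> Q" using fr_mem_iff_contraction[OF Q.is_ideal] w by simp
    moreover have "fr w w = \<one>\<^bsub>L\<^esub>" unfolding localization_one using w by (intro fr_eqI) auto
    ultimately show False using one by simp
  qed
  show "primeideal (contraction Q) R"
  proof (rule primeidealI[OF contraction_ideal[OF Q.is_ideal] cring_axioms])
    show "carrier R \<noteq> contraction Q" using disj W_one one_closed by blast
    fix a b assume ab: "a \<in> carrier R" "b \<in> carrier R" "a \<otimes> b \<in> contraction Q"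
    then have "fr a \<one> \<otimes>\<^bsub>L\<^esub> fr b \<one> \<in> Q" by (simp add: contraction_def fr_mult)
    then have "fr a \<one> \<in> Q \<or> fr b \<one> \<in> Q" using ab by (intro Q.I_prime) auto
    then show "a \<in> contraction Q \<or> b \<in> contraction Q" using ab by (simp add: contraction_def)
  qed
qed

lemma localize_prime:
  assumes P: "primeideal P R" "P \<inter> W = {}"
  shows "primeideal (localize_ideal R W P) L" "contraction (localize_ideal R W P) = P"
proof -
  interpret P: primeideal P R by fact
  have mem: "fr a s \<in> localize_ideal R W P \<longleftrightarrow> a \<in> P" if as: "a \<in> carrier R" "s \<in> W" for a s
  proof
    assume "fr a s \<in> localize_ideal R W P"
    then obtain w where "w \<in> W" "w \<otimes> a \<in> P" using localize_ideal_mem_iff[OF P.is_ideal as] by blast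
    then show "a \<in> P" using P.I_prime[of w a] as P(2) by auto
  qed (use as fr_mem_localize_ideal in blast)
  show "contraction (localize_ideal R W P) = P"
    unfolding contraction_def using mem P.Icarr by auto
  show "primeideal (localize_ideal R W P) L"
  proof (rule primeidealI[OF localize_ideal_ideal[OF P.is_ideal] cring_localization])
    have "fr \<one> \<one> \<notin> localize_ideal R W P" using mem P(2) W_one by blast
    then show "carrier L \<noteq> localize_ideal R W P" using fr_closed[OF one_closed W_one] by metis
    fix x y assume xy: "x \<in> carrier L" "y \<in> carrier L" "x \<otimes>\<^bsub>L\<^esub> y \<in> localize_ideal R W P"
    obtain a s b t where *: "a \<in> carrier R" "s \<in> W" "x = fr a s" "b \<in> carrier R" "t \<in> W" "y = fr b t"
      using xy(1,2) by (elim localization_carrierE)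
    then have "a \<otimes> b \<in> P" using xy(3) mem[of "a \<otimes> b" "s \<otimes> t"] by (simp add: fr_mult)
    then show "x \<in> localize_ideal R W P \<or> y \<in> localize_ideal R W P"
      using P.I_prime * mem by blast
  qed
qed

text \<open>A prime inside \<open>contraction Q\<close> misses \<open>W\<close> as well, so it
  localizes to a prime inside \<open>Q\<close>; minimality of \<open>Q\<close> gives equality, and
  contracting recovers the prime.\<close>

lemma contraction_minimal_prime:
  assumes Q: "Q \<in> minimal_primes L"
  shows "contraction Q \<in> minimal_primes R" "contraction Q \<inter> W = {}"
proof -
  have Qp: "primeideal Q L" and min: "\<And>Q'. primeideal Q' L \<Longrightarrow> Q' \<subseteq> Q \<Longrightarrow> Q' = Q"
    using Q by (auto simp: minimal_primes_def)
  note cp = contraction_prime[OF Qp]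
  have Qi: "ideal Q L" using Qp by (rule primeideal.axioms)
  show "contraction Q \<inter> W = {}" by fact
  have "P = contraction Q" if P: "primeideal P R" "P \<subseteq> contraction Q" for P
  proof -
    have PW: "P \<inter> W = {}" using P(2) cp(2) by blast
    have "localize_ideal R W P \<subseteq> Q"
    proof
      fix x assume "x \<in> localize_ideal R W P"
      then obtain a s where a: "a \<in> P" "s \<in> W" "x = fr a s" unfolding localize_ideal_def by blast
      moreover have "a \<in> carrier R" using a P(2) by (auto simp: contraction_def)
      ultimately show "x \<in> Q" using fr_mem_iff_contraction[OF Qi] P(2) by blast
    qed
    then have "localize_ideal R W P = Q" using min localize_prime(1)[OF P(1) PW] by blast
    then show ?thesis using localize_prime(2)[OF P(1) PW] by simp
  qed
  then show "contraction Q \<in> minimal_primes R" using cp(1) by (auto simp: minimal_primes_def)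
qed

lemma localize_minimal_prime:
  assumes P: "P \<in> minimal_primes R" "P \<inter> W = {}"
  shows "localize_ideal R W P \<in> minimal_primes L"
proof -
  have Pp: "primeideal P R" and min: "\<And>P'. primeideal P' R \<Longrightarrow> P' \<subseteq> P \<Longrightarrow> P' = P"
    using P by (auto simp: minimal_primes_def)
  note lp = localize_prime[OF Pp P(2)]
  have "Q = localize_ideal R W P" if Q: "primeideal Q L" "Q \<subseteq> localize_ideal R W P" for Q
  proof -
    have Qi: "ideal Q L" using Q(1) by (rule primeideal.axioms)
    have "contraction Q \<subseteq> contraction (localize_ideal R W P)" using Q(2) by (auto simp: contraction_def)
    then have eq: "contraction Q = P" using min contraction_prime(1)[OF Q(1)] lp(2) by simp
    have "localize_ideal R W P \<subseteq> Q"
    proof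
      fix x assume "x \<in> localize_ideal R W P"
      then obtain a s where a: "a \<in> P" "s \<in> W" "x = fr a s" unfolding localize_ideal_def by blast
      moreover have "a \<in> carrier R" using a eq by (auto simp: contraction_def)
      ultimately show "x \<in> Q" using fr_mem_iff_contraction[OF Qi] eq by blast
    qed
    then show ?thesis using Q(2) by blast
  qed
  then show ?thesis using lp(1) by (auto simp: minimal_primes_def)
qed

lemma fr_off_minimal_primes:
  assumes "c \<in> off_minimal_primes R"
  shows "fr c \<one> \<in> off_minimal_primes L"
proof -
  have c: "c \<in> carrier R" using assms off_minimal_primes_closed by blast
  have "fr c \<one> \<notin> Q" if Q: "Q \<in> minimal_primes L" for Q
    using contraction_minimal_prime(1)[OF Q] assms c
    by (auto simp: off_minimal_primes_def contraction_def)
  then show ?thesis using c by (auto simp: off_minimal_primes_def)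
qed

lemma off_minimal_primes_fr:
  assumes c: "fr c t \<in> off_minimal_primes L" "c \<in> carrier R" "t \<in> W" and P: "P \<in> minimal_primes R" "P \<inter> W = {}"
  shows "c \<notin> P"
proof
  assume "c \<in> P"
  then have "fr c t \<in> localize_ideal R W P" using c(3) by (rule fr_mem_localize_ideal)
  then show False using localize_minimal_prime[OF P] c(1) by (auto simp: off_minimal_primes_def)
qed

lemma frobenius_power_localize:
  assumes I: "ideal I R"
  shows "frobenius_power L (localize_ideal R W I) q = localize_ideal R W (frobenius_power R I q)"
proof
  let ?F = "frobenius_power L (localize_ideal R W I) q"
  have Ic: "\<And>a. a \<in> I \<Longrightarrow> a \<in> carrier R" using I ideal_mem_carrier by blast
  show "?F \<subseteq> localize_ideal R W (frobenius_power R I q)"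
    unfolding frobenius_power_def[of L]
  proof (rule L.genideal_minimal[OF localize_ideal_ideal[OF frobenius_power_ideal[OF I]]], safe)
    fix x assume "x \<in> localize_ideal R W I"
    then obtain a s where a: "a \<in> I" "s \<in> W" "x = fr a s" unfolding localize_ideal_def by blast
    then have "x [^]\<^bsub>L\<^esub> q = fr (a [^] q) (s [^] q)" using Ic by (simp add: fr_pow)
    then show "x [^]\<^bsub>L\<^esub> q \<in> localize_ideal R W (frobenius_power R I q)"
      using frobenius_power_mem[OF I a(1)] a(2) by (simp add: fr_mem_localize_ideal)
  qed
  have F: "ideal ?F L" by (rule L.frobenius_power_ideal[OF localize_ideal_ideal[OF I]])
  have "frobenius_power R I q \<subseteq> contraction ?F"
    unfolding frobenius_power_def[of R]
  proof (rule genideal_minimal[OF contraction_ideal[OF F]], safe)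
    fix a assume a: "a \<in> I"
    then have "fr a \<one> \<in> localize_ideal R W I" by (simp add: fr_mem_localize_ideal)
    then have "fr a \<one> [^]\<^bsub>L\<^esub> q \<in> ?F" by (rule L.frobenius_power_mem[OF localize_ideal_ideal[OF I]])
    then show "a [^] q \<in> contraction ?F" using a Ic by (simp add: fr_pow contraction_def)
  qed
  then show "localize_ideal R W (frobenius_power R I q) \<subseteq> ?F"
    using fr_mem_iff_contraction[OF F] ideal_mem_carrier[OF frobenius_power_ideal[OF I]]
    by (auto simp: localize_ideal_def)
qed

lemma localize_tight_closure_subset:
  assumes I: "ideal I R"
  shows "localize_ideal R W (tight_closure R p I) \<subseteq> tight_closure L p (localize_ideal R W I)"
proof
  fix x assume "x \<in> localize_ideal R W (tight_closure R p I)"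
  then obtain a s where a: "a \<in> tight_closure R p I" "s \<in> W" "x = fr a s"
    unfolding localize_ideal_def by blast
  obtain c e0 where c: "a \<in> carrier R" "c \<in> off_minimal_primes R"
    "\<And>e. e \<ge> e0 \<Longrightarrow> c \<otimes> a [^] (p ^ e) \<in> frobenius_power R I (p ^ e)"
    using a(1) unfolding tight_closure_def by blast
  have cc: "c \<in> carrier R" using c off_minimal_primes_closed by blast
  have "fr c \<one> \<otimes>\<^bsub>L\<^esub> x [^]\<^bsub>L\<^esub> (p ^ e) \<in> frobenius_power L (localize_ideal R W I) (p ^ e)"
    if "e \<ge> e0" for e
  proof -
    have "fr c \<one> \<otimes>\<^bsub>L\<^esub> x [^]\<^bsub>L\<^esub> (p ^ e) = fr (c \<otimes> a [^] (p ^ e)) (s [^] (p ^ e))"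
      using a(2,3) c(1) cc by (simp add: fr_pow fr_mult)
    then show ?thesis
      unfolding frobenius_power_localize[OF I] using c(3)[OF that] a(2)
      by (simp add: fr_mem_localize_ideal)
  qed
  then show "x \<in> tight_closure L p (localize_ideal R W I)"
    unfolding tight_closure_def using fr_off_minimal_primes[OF c(2)] a(2,3) c(1) by auto
qed

end

section \<open>Tight closure and localization\<close>

context noetherian_graded_ring_over_field
begin

text \<open>The multiplier \<open>w\<close> need not be homogeneous. The proof replaces \<open>z\<close> by a multiple \<open>r z\<close> with as few
  components outside \<open>J\<close> as possible; these components then have the same homogeneous annihilators modulo
  \<open>J\<close>.\<close>

lemma homogeneous_associated_prime:
  assumes Jh: "hideal J" and z: "z \<in> carrier R" "z \<notin> J" and w: "w \<in> carrier R" "w \<otimes> z \<in> J"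
  shows "\<exists>h k. h \<in> \<G> k \<and> hideal {r \<in> carrier R. r \<otimes> h \<in> J} \<and> primeideal {r \<in> carrier R. r \<otimes> h \<in> J} R \<and>
    w \<otimes> h \<in> J \<and> (\<forall>b i. b \<in> \<G> i \<longrightarrow> b \<otimes> z \<in> J \<longrightarrow> b \<otimes> h \<in> J)"
proof -
  have J: "ideal J R" using Jh by (rule hideal_ideal)
  define H where "H = (\<Union>i. \<G> i)"
  have Hc: "r \<in> carrier R" if "r \<in> H" for r using that component_carrier by (auto simp: H_def)
  have Hm: "r \<otimes> s \<in> H" if "r \<in> H" "s \<in> H" for r s
    using that component_mult unfolding H_def by blast
  \<comment> \<open>\<open>S r\<close> collects the degrees of the components of \<open>z\<close>
    that \<open>r\<close> does not send into \<open>J\<close>. It shrinks under multiplication, so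
    at minimal nonzero size a homogeneous multiple of \<open>r\<close> either keeps it or empties
    it.\<close>
  define S where "S = (\<lambda>r. {j. r \<otimes> hcomp z j \<notin> J})"
  have Sfin: "finite (S r)" if "r \<in> H" for r
  proof -
    have "S r \<subseteq> {j. hcomp z j \<noteq> \<zero>}" using Hc[OF that] ideal_zero_mem[OF J] by (auto simp: S_def)
    then show ?thesis using hcomp_finite[OF z(1)] finite_subset by blast
  qed
  have Smult: "S (s \<otimes> r) \<subseteq> S r" if "r \<in> H" "s \<in> H" for r s
    using ideal_lmult_mem[OF J] Hc that z(1) by (auto simp: S_def m_assoc)
  have "\<exists>r. r \<in> H \<and> S r \<noteq> {}"
  proof -
    obtain j where "hcomp z j \<notin> J" using mem_of_hcomp_mem[OF J z(1)] z(2) by blast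
    then have "j \<in> S \<one>" using z(1) by (simp add: S_def)
    moreover have "\<one> \<in> H" using one_mem_component_zero by (auto simp: H_def)
    ultimately show ?thesis by blast
  qed
  then obtain r0 where r0: "r0 \<in> H" "S r0 \<noteq> {}"
    and least: "\<And>r. r \<in> H \<Longrightarrow> S r \<noteq> {} \<Longrightarrow> card (S r0) \<le> card (S r)"
    using ex_has_least_nat[of "\<lambda>r. r \<in> H \<and> S r \<noteq> {}" _ "\<lambda>r. card (S r)"] by blast
  have Seq: "S (s \<otimes> r0) = S r0" if "s \<in> H" "S (s \<otimes> r0) \<noteq> {}" for s
    using card_seteq[OF Sfin[OF r0(1)] Smult[OF r0(1) that(1)]] least[OF Hm[OF that(1) r0(1)] that(2)] by simp
  define k where "k = Min (S r0)"
  have k: "k \<in> S r0" "\<And>j. j < k \<Longrightarrow> j \<notin> S r0"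
    using Min_in[OF Sfin[OF r0(1)] r0(2)] Min_le[OF Sfin[OF r0(1)]]
      by (auto simp: k_def not_less[symmetric])
  have zk: "hcomp z k \<in> \<G> k" "hcomp z k \<in> carrier R" using z(1) hcomp_mem by auto
  \<comment> \<open>These are the annihilators modulo \<open>J\<close> of the surviving multiples of
    one component; a maximal one among them is prime.\<close>
  define Q where "Q = (\<lambda>t. {a \<in> carrier R. a \<otimes> (t \<otimes> r0 \<otimes> hcomp z k) \<in> J})"
  define Fam where "Fam = {Q t | t. t \<in> H \<and> S (t \<otimes> r0) \<noteq> {}}"
  have "Q \<one> \<in> Fam"
    unfolding Fam_def using r0 Hc[OF r0(1)] one_mem_component_zero by (auto simp: H_def)
  then have "Fam \<noteq> {}" by blast
  moreover have "ideal K R" if "K \<in> Fam" for K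
    using that Hc r0(1) zk by (auto simp: Fam_def Q_def intro!: colon_ideal[OF J])
  ultimately have "\<exists>M\<in>Fam. \<forall>K\<in>Fam. M \<subseteq> K \<longrightarrow> K = M" by (rule ideal_maximal_element)
  then obtain M where M: "M \<in> Fam" and Mmax: "\<forall>K\<in>Fam. M \<subseteq> K \<longrightarrow> K = M" by (elim bexE)
  from M obtain t where t: "t \<in> H" "S (t \<otimes> r0) \<noteq> {}" "M = Q t" by (auto simp: Fam_def)
  define r where "r = t \<otimes> r0"
  have r: "r \<in> H" "r \<in> carrier R" using Hm[OF t(1) r0(1)] Hc by (auto simp: r_def)
  have Sr: "S r = S r0" unfolding r_def by (rule Seq[OF t(1,2)])
  have tc: "t \<in> carrier R" "r0 \<in> carrier R" using Hc t r0 by auto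
  have dich: "S (s \<otimes> r) = {} \<or> S (s \<otimes> r) = S r" if s: "s \<in> H" for s
  proof -
    have "s \<otimes> r = (s \<otimes> t) \<otimes> r0" using Hc[OF s] tc by (simp add: r_def m_assoc)
    then show ?thesis using Seq[OF Hm[OF s t(1)]] Sr by auto
  qed
  define h where "h = r \<otimes> hcomp z k"
  obtain \<rho> where \<rho>: "r \<in> \<G> \<rho>" using r(1) by (auto simp: H_def)
  have h: "h \<in> \<G> (\<rho> + k)" "h \<in> carrier R"
    unfolding h_def using component_mult[OF \<rho> zk(1)] r zk by auto
  have hJ: "h \<notin> J" using k(1) Sr by (auto simp: S_def h_def)
  let ?Q = "{a \<in> carrier R. a \<otimes> h \<in> J}"
  have QM: "?Q = M" unfolding t(3) Q_def h_def r_def ..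
  have kill_all: "s \<otimes> r \<otimes> hcomp z j \<in> J" if s: "s \<in> H" "s \<otimes> h \<in> J" for s j
  proof -
    have "k \<notin> S (s \<otimes> r)" using s Hc[OF s(1)] r zk by (simp add: S_def h_def m_assoc)
    then have "S (s \<otimes> r) = {}" using dich[OF s(1)] k(1) Sr by blast
    then show ?thesis by (auto simp: S_def)
  qed
  have Qh: "hideal ?Q" by (rule hideal_colon[OF Jh h(1)])
  have Qi: "ideal ?Q R" by (rule hideal_ideal[OF Qh])
  have Qp: "primeideal ?Q R"
  proof (rule hideal_primeI[OF Qh])
    have "\<one> \<notin> ?Q" using hJ h by simp
    then show "?Q \<noteq> carrier R" by blast
    fix a b i j assume ab: "a \<in> \<G> i" "b \<in> \<G> j" "a \<otimes> b \<in> ?Q"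
    have c: "a \<in> carrier R" "b \<in> carrier R" using ab component_carrier by blast+
    show "a \<in> ?Q \<or> b \<in> ?Q"
    proof (cases "b \<in> ?Q")
      case False
      have bH: "b \<in> H" using ab by (auto simp: H_def)
      have btr: "b \<otimes> t \<otimes> r0 = b \<otimes> r" using c tc by (simp add: r_def m_assoc)
      have bh: "b \<otimes> t \<otimes> r0 \<otimes> hcomp z k = b \<otimes> h" unfolding btr h_def using c r zk by (simp add: m_assoc)
      have "k \<in> S (b \<otimes> t \<otimes> r0)" using False c bh by (simp add: S_def)
      then have "Q (b \<otimes> t) \<in> Fam" unfolding Fam_def using Hm[OF bH t(1)] by blast
      moreover have "Q (b \<otimes> t) = {a \<in> carrier R. a \<otimes> (b \<otimes> h) \<in> J}" by (simp add: Q_def bh)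
      moreover have "M \<subseteq> {a \<in> carrier R. a \<otimes> (b \<otimes> h) \<in> J}"
      proof
        fix y assume "y \<in> M"
        then have y: "y \<in> carrier R" "y \<otimes> h \<in> J" using QM by auto
        have "b \<otimes> (y \<otimes> h) \<in> J" using ideal_lmult_mem[OF J y(2) c(2)] .
        then show "y \<in> {a \<in> carrier R. a \<otimes> (b \<otimes> h) \<in> J}" using y(1) c h m_lcomm by simp
      qed
      ultimately have "{a \<in> carrier R. a \<otimes> (b \<otimes> h) \<in> J} = M" using Mmax by auto
      moreover have "a \<in> {a \<in> carrier R. a \<otimes> (b \<otimes> h) \<in> J}" using ab(3) c h by (simp add: m_assoc)
      ultimately show ?thesis using QM by blast
    qed blast
  qed
  have wQ: "w \<in> ?Q"
  proof (rule ccontr)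
    assume "w \<notin> ?Q"
    then have "\<exists>i. hcomp w i \<notin> ?Q" using mem_of_hcomp_mem[OF Qi w(1)] by blast
    \<comment> \<open>The component of \<open>w \<otimes> (r \<otimes> z)\<close> in degree
      \<open>i + (\<rho> + k)\<close> is compared. Components of \<open>w\<close> below
      \<open>i\<close> send all of \<open>r \<otimes> z\<close> into \<open>J\<close>; those above
      \<open>i\<close> meet components of \<open>r \<otimes> z\<close> below
      \<open>\<rho> + k\<close>, which are in \<open>J\<close> since \<open>k\<close> is the least
      element of \<open>S r0\<close>.\<close>
    then obtain i where i: "hcomp w i \<notin> ?Q" "\<And>l. l < i \<Longrightarrow> hcomp w l \<in> ?Q"
      using exists_least_iff[of "\<lambda>i. hcomp w i \<notin> ?Q"] by auto
    have rz: "r \<otimes> z \<in> carrier R" using r z by simp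
    have rzc: "hcomp (r \<otimes> z) l = (if \<rho> \<le> l then r \<otimes> hcomp z (l - \<rho>) else \<zero>)" for l
      by (rule hcomp_mult_hom[OF \<rho> z(1)])
    have "hcomp w l \<otimes> hcomp (r \<otimes> z) (i + (\<rho> + k) - l) \<in> J" if "l \<noteq> i" "l \<le> i + (\<rho> + k)" for l
    proof (cases "l < i")
      case True
      have "hcomp w l \<in> H" using hcomp_mem[OF w(1)] by (auto simp: H_def)
      moreover have "hcomp w l \<otimes> h \<in> J" using i(2)[OF True] by blast
      ultimately have "hcomp w l \<otimes> r \<otimes> hcomp z j \<in> J" for j using kill_all by blast
      then show ?thesis unfolding rzc using ideal_zero_mem[OF J] w r z by (simp add: m_assoc)
    next
      case False
      then have "i + (\<rho> + k) - l < \<rho> + k" using that by linarith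
      then have "i + (\<rho> + k) - l - \<rho> < k \<or> \<not> \<rho> \<le> i + (\<rho> + k) - l" by linarith
      then have "hcomp (r \<otimes> z) (i + (\<rho> + k) - l) \<in> J"
        unfolding rzc using k(2) Sr ideal_zero_mem[OF J] by (auto simp: S_def)
      then show ?thesis using w by (simp add: ideal_lmult_mem[OF J])
    qed
    then have "hcomp (w \<otimes> (r \<otimes> z)) (i + (\<rho> + k)) \<in> J \<longleftrightarrow> hcomp w i \<otimes> hcomp (r \<otimes> z) (\<rho> + k) \<in> J"
      by (rule hcomp_mult_mem_iff[OF J w(1) rz])
    moreover have "w \<otimes> (r \<otimes> z) \<in> J"
      using ideal_lmult_mem[OF J w(2) r(2)] m_lcomm[of r w z] w r z by simp
    ultimately have "hcomp w i \<otimes> hcomp (r \<otimes> z) (\<rho> + k) \<in> J" using hideal_hcomp[OF Jh] by blast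
    then have "hcomp w i \<otimes> h \<in> J" unfolding rzc by (simp add: h_def)
    then show False using i(1) w by simp
  qed
  have "b \<otimes> h \<in> J" if b: "b \<in> \<G> i" "b \<otimes> z \<in> J" for b i
  proof -
    have bc: "b \<in> carrier R" using b component_carrier by blast
    have "hcomp (b \<otimes> z) (i + k) \<in> J" by (rule hideal_hcomp[OF Jh b(2)])
    then have "b \<otimes> hcomp z k \<in> J" using hcomp_mult_hom[OF b(1) z(1)] by simp
    then have "r \<otimes> (b \<otimes> hcomp z k) \<in> J" using r by (simp add: ideal_lmult_mem[OF J])
    then show ?thesis unfolding h_def using m_lcomm[of r b] r bc zk by simp
  qed
  then show ?thesis using h(1) Qh Qp wQ by blast
qed

text \<open>One element of \<open>P \<inter> W\<close> for each listed \<open>P\<close> meeting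
  \<open>W\<close> gives a product \<open>w\<close> that does not depend on \<open>Q\<close>. A
  listed prime disjoint from \<open>W\<close> is not inside \<open>Q\<close> and supplies a
  homogeneous factor outside \<open>Q\<close>; these factors make up \<open>b\<close>.\<close>

lemma prime_factors_split:
  assumes Ps: "prime_factors_list J Ps" and W: "submonoid W R"
  shows "\<exists>w\<in>W. \<forall>Q. primeideal Q R \<longrightarrow> (\<forall>P\<in>set Ps. P \<inter> W = {} \<longrightarrow> \<not> P \<subseteq> Q) \<longrightarrow>
    (\<exists>b k. b \<in> \<G> k \<and> b \<notin> Q \<and> w \<otimes> b \<in> J)"
proof -
  interpret cring_localization R W
    by (intro cring_localization.intro cring_localization_axioms.intro cring_axioms W)
  define v where "v = (\<lambda>P. if P \<inter> W = {} then \<one> else SOME a. a \<in> P \<inter> W)"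
  have vW: "v P \<in> W" for P using someI_ex[of "\<lambda>a. a \<in> P \<inter> W"] by (auto simp: v_def)
  have vP: "v P \<in> P" if "P \<inter> W \<noteq> {}" for P
    using that someI_ex[of "\<lambda>a. a \<in> P \<inter> W"] by (auto simp: v_def)
  have lW: "lprod (map v Xs) \<in> W" for Xs using vW by (induction Xs) auto
  have "\<exists>b k. b \<in> \<G> k \<and> b \<notin> Q \<and> lprod (map v Ps) \<otimes> b \<in> J"
    if Q: "primeideal Q R" and no: "\<forall>P\<in>set Ps. P \<inter> W = {} \<longrightarrow> \<not> P \<subseteq> Q" for Q
  proof -
    interpret Q: primeideal Q R by fact
    have "\<exists>b k cs. b \<in> \<G> k \<and> b \<notin> Q \<and> list_all2 (\<in>) cs Xs \<and> lprod cs = lprod (map v Xs) \<otimes> b"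
      if "set Xs \<subseteq> set Ps" for Xs
      using that
    proof (induction Xs)
      case Nil
      have "\<one> \<notin> Q" using Q.one_imp_carrier Q.I_notcarr by blast
      then show ?case using one_mem_component_zero
        by (intro exI[of _ \<one>] exI[of _ 0] exI[of _ "[]"]) simp
    next
      case (Cons P Xs)
      then obtain b k cs where b: "b \<in> \<G> k" "b \<notin> Q" "list_all2 (\<in>) cs Xs" "lprod cs = lprod (map v Xs) \<otimes> b"
        by auto
      have P: "P \<in> set Ps" using Cons.prems by simp
      have Ph: "hideal P" using prime_factors_listD[OF Ps P] by blast
      have "\<exists>a i. a \<in> \<G> i \<and> a \<notin> Q \<and> v P \<otimes> a \<in> P"
      proof (cases "v P \<in> P")
        case True
        have "\<one> \<notin> Q" using Q.one_imp_carrier Q.I_notcarr by blast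
        then show ?thesis using True one_mem_component_zero W_closed[OF vW]
          by (intro exI[of _ \<one>] exI[of _ 0]) simp
      next
        case False
        then have "P \<inter> W = {}" using vP by blast
        then have "\<not> P \<subseteq> Q" using no P by simp
        then obtain y where y: "y \<in> P" "y \<notin> Q" by blast
        have yc: "y \<in> carrier R" using y Ph ideal_mem_carrier hideal_ideal by blast
        obtain i where i: "hcomp y i \<notin> Q" using mem_of_hcomp_mem[OF Q.is_ideal yc] y by blast
        have "v P \<otimes> hcomp y i \<in> P"
          by (rule ideal_lmult_mem[OF hideal_ideal[OF Ph] hideal_hcomp[OF Ph y(1)] W_closed[OF vW]])
        then show ?thesis using i hcomp_mem[OF yc] by blast
      qed
      then obtain a i where a: "a \<in> \<G> i" "a \<notin> Q" "v P \<otimes> a \<in> P" by blast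
      have c: "a \<in> carrier R" "b \<in> carrier R" "v P \<in> carrier R"
        using a b component_carrier W_closed[OF vW] by auto
      have lc: "lprod (map v Xs) \<in> carrier R" by (rule W_closed[OF lW])
      have "a \<otimes> b \<in> \<G> (i + k)" using a b by (intro component_mult)
      moreover have "a \<otimes> b \<notin> Q" using Q.I_prime[OF c(1,2)] a b by blast
      moreover have "list_all2 (\<in>) ((v P \<otimes> a) # cs) (P # Xs)" using a b by simp
      moreover have "lprod ((v P \<otimes> a) # cs) = lprod (map v (P # Xs)) \<otimes> (a \<otimes> b)"
        using b(4) c lc by (simp add: m_ac)
      ultimately show ?case by blast
    qed
    then obtain b k cs where "b \<in> \<G> k" "b \<notin> Q" "list_all2 (\<in>) cs Ps" "lprod cs = lprod (map v Ps) \<otimes> b" by blast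
    then show ?thesis using Ps unfolding prime_factors_list_def by metis
  qed
  then show ?thesis using lW[of Ps] by blast
qed

text \<open>Even if \<open>w\<close> is not homogeneous, its components have positive degree, so
  those of its nth power have degree at least n. Thus powers of elements of \<open>W\<close> can be
  used as high-degree multipliers.\<close>

lemma irrelevant_pow_mem:
  assumes "w \<in> irrelevant_ideal R \<G>"
  shows "w [^] (n::nat) \<in> ideal_degree_ge R \<G> n"
proof (induction n)
  case 0
  have "\<one> \<in> ideal_degree_ge R \<G> 0" using ideal_degree_ge_mem[OF one_mem_component_zero] by simp
  then show ?case by simp
next
  case (Suc n)
  have w: "w \<in> carrier R" "hcomp w 0 = \<zero>" using assms by (simp_all add: irrelevant_ideal_iff)
  have I: "ideal (ideal_degree_ge R \<G> (Suc n)) R" by (rule ideal_degree_ge_ideal)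
  show ?case
  proof (simp, rule ideal_degree_ge_mult_mem[OF I w(1) _ Suc])
    fix k r assume k: "n \<le> k" and r: "r \<in> \<G> k"
    have rc: "r \<in> carrier R" using r component_carrier by blast
    have "hcomp (r \<otimes> w) i \<in> ideal_degree_ge R \<G> (Suc n)" for i
    proof (cases "k < i")
      case True
      then show ?thesis using k rc w hcomp_mem[of "r \<otimes> w" i] by (intro ideal_degree_ge_mem[of _ i]) auto
    next
      case False
      then have "hcomp (r \<otimes> w) i = \<zero>" using hcomp_mult_hom[OF r w(1), of i] w(2) rc
        by (cases "k = i") auto
      then show ?thesis using ideal_zero_mem[OF I] by simp
    qed
    then show "r \<otimes> w \<in> ideal_degree_ge R \<G> (Suc n)"
      by (rule mem_of_hcomp_mem[OF I m_closed[OF rc w(1)]])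
  qed
qed

lemma hideal_saturation:
  assumes Jh: "hideal J" and x: "x \<in> \<G> d"
  shows "hideal {a \<in> carrier R. \<exists>s::nat. x [^] s \<otimes> a \<in> J}"
proof -
  have J: "ideal J R" using Jh by (rule hideal_ideal)
  have xc: "x \<in> carrier R" using x component_carrier by blast
  let ?K = "{a \<in> carrier R. \<exists>s::nat. x [^] s \<otimes> a \<in> J}"
  have "ideal ?K R"
  proof (rule idealI')
    show "\<zero> \<in> ?K" using ideal_zero_mem[OF J] xc by simp
    show "a \<oplus> b \<in> ?K" if ab: "a \<in> ?K" "b \<in> ?K" for a b
    proof -
      obtain s t :: nat where st: "x [^] s \<otimes> a \<in> J" "x [^] t \<otimes> b \<in> J" using ab by blast
      have c: "a \<in> carrier R" "b \<in> carrier R" using ab by auto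
      have "x [^] t \<otimes> (x [^] s \<otimes> a) \<oplus> x [^] s \<otimes> (x [^] t \<otimes> b) \<in> J"
        using st xc by (simp add: ideal_add_mem[OF J] ideal_lmult_mem[OF J])
      also have "x [^] t \<otimes> (x [^] s \<otimes> a) \<oplus> x [^] s \<otimes> (x [^] t \<otimes> b) = x [^] (s + t) \<otimes> (a \<oplus> b)"
        using c xc m_lcomm[of "x [^] t" "x [^] s" a]
          by (simp add: nat_pow_mult[symmetric] r_distr m_assoc)
      finally show ?thesis using c by blast
    qed
    show "r \<otimes> a \<in> ?K" if ar: "a \<in> ?K" "r \<in> carrier R" for a r
    proof -
      obtain s :: nat where s: "x [^] s \<otimes> a \<in> J" using ar by blast
      have "r \<otimes> (x [^] s \<otimes> a) \<in> J" using s ar by (simp add: ideal_lmult_mem[OF J])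
      then have "x [^] s \<otimes> (r \<otimes> a) \<in> J" using m_lcomm[of r "x [^] s" a] ar xc by simp
      then show ?thesis using ar by blast
    qed
  qed auto
  moreover have "hcomp a i \<in> ?K" if a: "a \<in> ?K" for a i
  proof -
    obtain s :: nat where s: "x [^] s \<otimes> a \<in> J" using a by blast
    have "hcomp (x [^] s \<otimes> a) (s * d + i) \<in> J" by (rule hideal_hcomp[OF Jh s])
    then have "x [^] s \<otimes> hcomp a i \<in> J" using hcomp_mult_hom[OF component_pow[OF x], of a s] a by simp
    then show ?thesis using a by auto
  qed
  ultimately show ?thesis by (auto simp: hideal_def)
qed

text \<open>If \<open>W\<close> misses the irrelevant ideal, it meets no homogeneous associated
  prime of a Frobenius power and \<open>w0 = \<one>\<close> works. Otherwise \<open>w0\<close> is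
  \<open>wm [^] N \<otimes> wI\<close>, where \<open>wI\<close> handles the listed primes of
  \<open>I\<close> that meet \<open>W\<close>, and \<open>wm [^] N\<close> handles the irrelevant
  ideal.\<close>

lemma uniform_multiplier:
  assumes I: "hideal I" and dim: "krull_dim (R Quot I) = 1"
    and p: "Factorial_Ring.prime (p::nat)" "[p] \<cdot> \<one> = \<zero>" and W: "submonoid W R"
  shows "\<exists>w0\<in>W. \<forall>e. \<forall>y\<in>carrier R. (\<exists>w\<in>W. w \<otimes> y \<in> frobenius_power R I (p ^ e)) \<longrightarrow>
    w0 [^] (p ^ e) \<otimes> y \<in> frobenius_power R I (p ^ e)"
proof -
  let ?m = "irrelevant_ideal R \<G>"
  interpret cring_localization R W
    by (intro cring_localization.intro cring_localization_axioms.intro cring_axioms W)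
  have I': "ideal I R" using I by (rule hideal_ideal)
  note Jh = hideal_frobenius_power[OF p I]
  have sub: "Q \<subseteq> ?m" if "hideal Q" "primeideal Q R" for Q
    using hideal_subset_irrelevant[OF that(1)] primeideal.I_notcarr[OF that(2)] by blast
  show ?thesis
  proof (cases "W \<inter> ?m = {}")
    case True
    have "y \<in> frobenius_power R I (p ^ e)"
      if y: "y \<in> carrier R" "w \<in> W" "w \<otimes> y \<in> frobenius_power R I (p ^ e)" for e y w
    proof (rule ccontr)
      assume ny: "y \<notin> frobenius_power R I (p ^ e)"
      let ?Q = "\<lambda>h. {r \<in> carrier R. r \<otimes> h \<in> frobenius_power R I (p ^ e)}"
      have "\<exists>h. hideal (?Q h) \<and> primeideal (?Q h) R \<and> w \<otimes> h \<in> frobenius_power R I (p ^ e)"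
        using homogeneous_associated_prime[OF Jh y(1) ny W_closed[OF y(2)] y(3)]
          by (elim exE conjE) (intro exI conjI)
      then obtain h where h: "hideal (?Q h)" "primeideal (?Q h) R" "w \<otimes> h \<in> frobenius_power R I (p ^ e)"
        by (elim exE conjE)
      have "w \<in> ?Q h" using h(3) y(2) by simp
      then have "w \<in> ?m" using sub[OF h(1,2)] by blast
      then show False using True y(2) by blast
    qed
    then show ?thesis by (intro bexI[OF _ W_one] allI ballI impI) auto
  next
    case False
    then obtain wm where wm: "wm \<in> W" "wm \<in> ?m" by blast
    obtain x N d where x: "d > 0" "x \<in> \<G> d" and kill: "\<forall>e s. \<forall>u\<in>carrier R.
      x [^] (s::nat) \<otimes> u \<in> frobenius_power R I (p ^ e) \<longrightarrow>
      (\<forall>r\<in>ideal_degree_ge R \<G> (N * p ^ e). r \<otimes> u \<in> frobenius_power R I (p ^ e))"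
      using high_degree_kills_saturation[OF I dim p] by (elim exE conjE)
    have xc: "x \<in> carrier R" using x component_carrier by blast
    obtain Ps where Ps: "prime_factors_list I Ps" using ex_prime_factors_list[OF I] by blast
    note PsD = prime_factors_listD[OF Ps]
    obtain wI where wI: "wI \<in> W" "wI \<in> carrier R" and split: "\<forall>Q. primeideal Q R \<longrightarrow>
        (\<forall>P\<in>set Ps. P \<inter> W = {} \<longrightarrow> \<not> P \<subseteq> Q) \<longrightarrow> (\<exists>b k. b \<in> \<G> k \<and> b \<notin> Q \<and> wI \<otimes> b \<in> I)"
      using prime_factors_split[OF Ps W] by (elim bexE) (use W_closed in simp)
    have "(wm [^] N \<otimes> wI) [^] (p ^ e) \<otimes> y \<in> frobenius_power R I (p ^ e)"
      if y: "y \<in> carrier R" "w \<in> W" "w \<otimes> y \<in> frobenius_power R I (p ^ e)" for e y w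
    proof -
      let ?q = "p ^ e" and ?J = "frobenius_power R I (p ^ e)"
      have J: "ideal ?J R" by (rule hideal_ideal[OF Jh])
      \<comment> \<open>Saturation with respect to \<open>x\<close> keeps the irrelevant ideal from
        being an associated prime; it is dealt with afterwards by a power of
        \<open>wm\<close>.\<close>
      define K where "K = {a \<in> carrier R. \<exists>s::nat. x [^] s \<otimes> a \<in> ?J}"
      have Kh: "hideal K" unfolding K_def by (rule hideal_saturation[OF Jh x(2)])
      have K: "ideal K R" by (rule hideal_ideal[OF Kh])
      have JK: "?J \<subseteq> K"
      proof
        fix a assume "a \<in> ?J"
        moreover from this have "a \<in> carrier R" by (rule ideal_mem_carrier[OF J])
        ultimately show "a \<in> K" unfolding K_def by (auto intro!: exI[of _ "0::nat"])
      qed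
      define z where "z = wI [^] ?q \<otimes> y"
      have z: "z \<in> carrier R" using wI y by (simp add: z_def)
      have wc: "w \<in> carrier R" using y by simp
      have "wI [^] ?q \<otimes> (w \<otimes> y) \<in> ?J" using y wI by (simp add: ideal_lmult_mem[OF J])
      then have wz: "w \<otimes> z \<in> K" unfolding z_def using m_lcomm[of "wI [^] ?q" w y] JK wI y wc by auto
      have zK: "z \<in> K"
      proof (rule ccontr)
        assume nz: "z \<notin> K"
        obtain h k where h': "h \<in> \<G> k" and h: "hideal {r \<in> carrier R. r \<otimes> h \<in> K}"
          "primeideal {r \<in> carrier R. r \<otimes> h \<in> K} R"
          "w \<otimes> h \<in> K" "\<forall>b i. b \<in> \<G> i \<longrightarrow> b \<otimes> z \<in> K \<longrightarrow> b \<otimes> h \<in> K"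
          using homogeneous_associated_prime[OF Kh z nz wc wz] by (elim exE conjE)
        have hc: "h \<in> carrier R" by (rule component_carrier[OF h'])
        define Q where "Q = {r \<in> carrier R. r \<otimes> h \<in> K}"
        have Q: "hideal Q" "primeideal Q R" using h by (simp_all add: Q_def)
        have Q_iff: "a \<in> Q \<longleftrightarrow> a \<in> carrier R \<and> a \<otimes> h \<in> K" for a unfolding Q_def by blast
        interpret Q: primeideal Q R by (rule Q(2))
        have "I \<subseteq> Q"
        proof
          fix a assume a: "a \<in> I"
          have ac: "a \<in> carrier R" using a I' ideal_mem_carrier by blast
          have "a [^] ?q \<in> ?J" by (rule frobenius_power_mem[OF I' a])
          then have "a [^] ?q \<otimes> h \<in> K" by (intro ideal_rmult_mem[OF K set_mp[OF JK] hc])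
          then have "a [^] ?q \<in> Q" using nat_pow_closed[OF ac] Q_iff by blast
          then show "a \<in> Q" by (rule Q.pow_mem[OF ac])
        qed
        have "x \<notin> Q"
        proof
          assume "x \<in> Q"
          then have "x \<otimes> h \<in> K" using Q_iff by blast
          then obtain s :: nat where s: "x [^] s \<otimes> (x \<otimes> h) \<in> ?J" unfolding K_def by blast
          then have "x [^] Suc s \<otimes> h \<in> ?J" using xc hc by (simp add: m_assoc)
          then have "h \<in> K" unfolding K_def using hc by blast
          then have "\<one> \<in> Q" using hc Q_iff by simp
          then show False using Q.one_imp_carrier Q.I_notcarr by blast
        qed
        have wQ: "w \<in> Q" using h(3) wc Q_iff by blast
        \<comment> \<open>Otherwise some homogeneous \<open>b\<close> outside \<open>Q\<close>
          satisfies \<open>wI \<otimes> b \<in> I\<close>, so its qth power sends \<open>z\<close>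
          into \<open>K\<close>. Being homogeneous, this power also sends \<open>h\<close> into
          \<open>K\<close>, hence lies in \<open>Q\<close>, and so does \<open>b\<close>.\<close>
        have "\<exists>P\<in>set Ps. P \<inter> W = {} \<and> P \<subseteq> Q"
        proof (rule ccontr)
          assume no: "\<not> ?thesis"
          then have "\<forall>P\<in>set Ps. P \<inter> W = {} \<longrightarrow> \<not> P \<subseteq> Q" by simp
          from split[THEN spec, THEN mp, OF Q(2), THEN mp, OF this]
          obtain b k where b: "b \<in> \<G> k" "b \<notin> Q" "wI \<otimes> b \<in> I" by (elim exE conjE)
          have bc: "b \<in> carrier R" using b component_carrier by blast
          have "(wI \<otimes> b) [^] ?q \<in> ?J" by (rule frobenius_power_mem[OF I' b(3)])
          then have "wI [^] ?q \<otimes> b [^] ?q \<otimes> y \<in> ?J"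
            using wI bc y by (simp add: nat_pow_distrib ideal_rmult_mem[OF J])
          then have "b [^] ?q \<otimes> z \<in> K"
            unfolding z_def using JK m_lcomm[of "b [^] ?q" "wI [^] ?q" y] wI bc y
              by (auto simp: m_assoc)
          then have "b [^] ?q \<in> Q" 
            using h(4) component_pow[OF b(1), of ?q] nat_pow_closed[OF bc] Q_iff by blast
          then show False using Q.pow_mem[OF bc] b(2) by blast
        qed
        then obtain P where P: "P \<in> set Ps" "P \<inter> W = {}" "P \<subseteq> Q" by blast
        have "P \<subset> Q" using P wQ y(2) by blast
        moreover have "Q \<subset> ?m"
          using sub[OF Q] component_mem_irrelevant[OF x(2,1)] \<open>x \<notin> Q\<close> by blast
        ultimately show False
          using quot_dim_one_no_chain[OF dim I' PsD(2)[OF P(1)] Q(2) primeideal_irrelevant PsD(3)[OF P(1)]]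
          by blast
      qed
      then obtain s :: nat where "x [^] s \<otimes> z \<in> ?J" by (auto simp: K_def)
      then have "wm [^] (N * ?q) \<otimes> z \<in> ?J"
        using kill[rule_format, OF z _ irrelevant_pow_mem[OF wm(2)]] by blast
      moreover have "(wm [^] N \<otimes> wI) [^] ?q \<otimes> y = wm [^] (N * ?q) \<otimes> z"
        unfolding z_def using wm(1) wI y by (simp add: nat_pow_distrib nat_pow_pow m_assoc)
      ultimately show ?thesis by simp
    qed
    moreover have "wm [^] N \<otimes> wI \<in> W" using wm wI by simp
    ultimately show ?thesis by blast
  qed
qed

text \<open>A numerator may lie in minimal primes that meet \<open>W\<close>, as these disappear in
  the localization. It is moved out of them by adding elements of \<open>D\<close>, the kernel of
  the map to the localization, one minimal prime at a time.\<close>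

lemma off_minimal_primes_lift:
  assumes W: "submonoid W R" and c: "c \<in> carrier R"
    and avoid: "\<And>P. P \<in> minimal_primes R \<Longrightarrow> P \<inter> W = {} \<Longrightarrow> c \<notin> P"
  shows "\<exists>c'\<in>off_minimal_primes R. \<exists>w\<in>W. w \<otimes> c' = w \<otimes> c"
proof -
  interpret cring_localization R W
    by (intro cring_localization.intro cring_localization_axioms.intro cring_axioms W)
  have "hideal {\<zero>}" using zeroideal by (auto simp: hideal_def)
  then obtain Ps where Ps: "prime_factors_list {\<zero>} Ps" using ex_prime_factors_list by blast
  note PsD = prime_factors_listD[OF Ps]
  have minP: "P \<in> set Ps" if P: "P \<in> minimal_primes R" for P
  proof -
    have Pp: "primeideal P R" using P by (simp add: minimal_primes_def)
    have "{\<zero>} \<subseteq> P" using ideal_zero_mem[OF primeideal.axioms(1)[OF Pp]] by blast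
    then obtain P' where "P' \<in> set Ps" "P' \<subseteq> P" using prime_contains_factor[OF Ps Pp] by blast
    then show ?thesis using P PsD(2) by (auto simp: minimal_primes_def)
  qed
  then have fin: "finite (minimal_primes R)" by (meson finite_set finite_subset subsetI)
  define D where "D = {a \<in> carrier R. \<exists>w\<in>W. w \<otimes> a = \<zero>}"
  have Dadd: "a \<oplus> b \<in> D" if ab: "a \<in> D" "b \<in> D" for a b
  proof -
    obtain w w' where w: "w \<in> W" "w \<otimes> a = \<zero>" "w' \<in> W" "w' \<otimes> b = \<zero>" using ab by (auto simp: D_def)
    have c: "a \<in> carrier R" "b \<in> carrier R" using ab by (auto simp: D_def)
    have "(w \<otimes> w') \<otimes> (a \<oplus> b) = w' \<otimes> (w \<otimes> a) \<oplus> w \<otimes> (w' \<otimes> b)"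
      using c w(1,3) by (simp add: r_distr m_ac)
    also have "\<dots> = \<zero>" using w by simp
    finally show ?thesis using c w(1,3) W_mult unfolding D_def by blast
  qed
  have Dmult: "a \<otimes> r \<in> D" if ar: "a \<in> D" "r \<in> carrier R" for a r
  proof -
    obtain w where w: "w \<in> W" "w \<otimes> a = \<zero>" using ar by (auto simp: D_def)
    have "w \<otimes> (a \<otimes> r) = (w \<otimes> a) \<otimes> r" using ar w(1) by (simp add: D_def m_assoc)
    then have "w \<otimes> (a \<otimes> r) = \<zero>" using w ar by simp
    then show ?thesis using ar w by (auto simp: D_def)
  qed
  obtain wI where wI: "wI \<in> W" and split: "\<forall>Q. primeideal Q R \<longrightarrow>
      (\<forall>P\<in>set Ps. P \<inter> W = {} \<longrightarrow> \<not> P \<subseteq> Q) \<longrightarrow> (\<exists>b k. b \<in> \<G> k \<and> b \<notin> Q \<and> wI \<otimes> b \<in> {\<zero>})"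
    using prime_factors_split[OF Ps W] by (elim bexE)
  have "\<exists>d\<in>D. \<forall>P\<in>Y. c \<oplus> d \<notin> P" if "finite Y" "Y \<subseteq> minimal_primes R" for Y
    using that
  proof (induction Y rule: finite_induct)
    case empty
    have "\<one> \<otimes> \<zero> = \<zero>" by simp
    then have "\<zero> \<in> D" unfolding D_def using W_one zero_closed by blast
    then show ?case by blast
  next
    case (insert P Y)
    then obtain d where d: "d \<in> D" "\<forall>P\<in>Y. c \<oplus> d \<notin> P" by blast
    have dc: "d \<in> carrier R" using d by (simp add: D_def)
    have Pmin: "P \<in> minimal_primes R" using insert by blast
    then have Pp: "primeideal P R" by (simp add: minimal_primes_def)
    interpret P: primeideal P R by fact
    show ?case
    proof (cases "c \<oplus> d \<in> P")
      case False
      then show ?thesis using d by blast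
    next
      case True
      have PW: "P \<inter> W \<noteq> {}"
      proof
        assume disj: "P \<inter> W = {}"
        obtain w where w: "w \<in> W" "w \<otimes> d = \<zero>" using d(1) by (auto simp: D_def)
        then have "w \<otimes> d \<in> P" using ideal_zero_mem[OF P.is_ideal] by simp
        then have "d \<in> P" using P.I_prime[of w d] w(1) dc disj by auto
        then have "c \<in> P" using True ideal_add_cancel[OF P.is_ideal, of d c] c dc by (simp add: a_comm)
        then show False using avoid[OF Pmin disj] by blast
      qed
      have "\<not> P' \<subseteq> P" if P': "P' \<in> set Ps" "P' \<inter> W = {}" for P'
        using Pmin PsD(2)[OF P'(1)] P'(2) PW by (auto simp: minimal_primes_def)
      then have "\<forall>P'\<in>set Ps. P' \<inter> W = {} \<longrightarrow> \<not> P' \<subseteq> P" by simp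
      from split[THEN spec, THEN mp, OF Pp, THEN mp, OF this]
      obtain b k where b: "b \<notin> P" "wI \<otimes> b = \<zero>" "b \<in> \<G> k" by (elim exE conjE) simp
      have bc: "b \<in> carrier R" by (rule component_carrier[OF b(3)])
      have bD: "b \<in> D" unfolding D_def using b(2) bc wI by blast
      have "\<exists>t k. t \<in> \<G> k \<and> t \<notin> P \<and> (\<forall>Q\<in>Y. t \<in> Q)"
      proof (rule homogeneous_in_all_not_in_prime[OF insert.hyps(1) _ Pp])
        fix Q assume Q: "Q \<in> Y"
        then have Qm: "Q \<in> minimal_primes R" using insert.prems by blast
        have "Q = P" if "Q \<subseteq> P" using that Qm Pmin by (auto simp: minimal_primes_def)
        then show "hideal Q \<and> \<not> Q \<subseteq> P" using Q insert.hyps(2) PsD(1)[OF minP[OF Qm]] by blast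
      qed
      then obtain t where t: "t \<in> carrier R" "t \<notin> P" "\<forall>Q\<in>Y. t \<in> Q" using component_carrier by blast
      \<comment> \<open>The factor \<open>b\<close> puts \<open>d'\<close> into the kernel,
        \<open>t\<close> puts it into the primes already treated, and neither factor is in
        \<open>P\<close>. Adding \<open>d'\<close> therefore repairs \<open>P\<close> without
        disturbing the others.\<close>
      define d' where "d' = b \<otimes> t"
      have d': "d' \<in> D" "d' \<in> carrier R" "d' \<notin> P" "\<forall>Q\<in>Y. d' \<in> Q"
      proof -
        show "d' \<in> D" unfolding d'_def by (rule Dmult[OF bD t(1)])
        show "d' \<in> carrier R" using bc t by (simp add: d'_def)
        show "d' \<notin> P" unfolding d'_def using P.I_prime[OF bc t(1)] b(1) t(2) by blast
        show "\<forall>Q\<in>Y. d' \<in> Q"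
        proof
          fix Q assume Q: "Q \<in> Y"
          then have "ideal Q R" using insert.prems
            by (auto simp: minimal_primes_def intro: primeideal.axioms)
          then show "d' \<in> Q" unfolding d'_def using t(3) Q bc ideal_lmult_mem by blast
        qed
      qed
      have eq: "c \<oplus> (d \<oplus> d') = d' \<oplus> (c \<oplus> d)" using c dc d'(2) by (simp add: a_ac)
      have "c \<oplus> (d \<oplus> d') \<notin> Q" if Q: "Q \<in> insert P Y" for Q
      proof (cases "Q = P")
        case True
        have "c \<oplus> (d \<oplus> d') = (c \<oplus> d) \<oplus> d'" using c dc d'(2) by (simp add: a_assoc)
        then show ?thesis using True \<open>c \<oplus> d \<in> P\<close> ideal_add_cancel[OF P.is_ideal _ d'(2)] d'(3) by simp
      next
        case False
        then have QY: "Q \<in> Y" using Q by blast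
        then have Qi: "ideal Q R" using insert.prems
          by (auto simp: minimal_primes_def intro: primeideal.axioms)
        show ?thesis unfolding eq using ideal_add_cancel[OF Qi, of d' "c \<oplus> d"] d'(4) d(2) QY c dc by blast
      qed
      then show ?thesis using Dadd[OF d(1) d'(1)] by blast
    qed
  qed
  then obtain d where d: "d \<in> D" "\<forall>P\<in>minimal_primes R. c \<oplus> d \<notin> P" using fin by blast
  then obtain w where w: "w \<in> W" "w \<otimes> d = \<zero>" "d \<in> carrier R" by (auto simp: D_def)
  have "w \<otimes> (c \<oplus> d) = w \<otimes> c" using w c by (simp add: r_distr)
  moreover have "c \<oplus> d \<in> off_minimal_primes R" using d w c by (auto simp: off_minimal_primes_def)
  ultimately show ?thesis using w(1) by blast
qed

text \<open>Once the multiplier is lifted to \<open>c'\<close>, the element of \<open>W\<close> that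
  clears denominators still varies with \<open>e\<close>; \<open>uniform_multiplier\<close>
  exchanges it for \<open>w0 [^] (p ^ e)\<close>, which moves inside the power of
  \<open>a\<close>.\<close>

lemma tight_closure_localize:
  assumes I: "hideal I" and dim: "krull_dim (R Quot I) = 1"
    and p: "Factorial_Ring.prime (p::nat)" "[p] \<cdot> \<one> = \<zero>" and W: "submonoid W R"
  shows "localize_ideal R W (tight_closure R p I) =
    tight_closure (localization R W) p (localize_ideal R W I)"
proof
  interpret cring_localization R W
    by (intro cring_localization.intro cring_localization_axioms.intro cring_axioms W)
  have I': "ideal I R" using I by (rule hideal_ideal)
  show "localize_ideal R W (tight_closure R p I) \<subseteq> tight_closure L p (localize_ideal R W I)"
    by (rule localize_tight_closure_subset[OF I'])
  show "tight_closure L p (localize_ideal R W I) \<subseteq> localize_ideal R W (tight_closure R p I)"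
  proof
    fix A assume A: "A \<in> tight_closure L p (localize_ideal R W I)"
    then obtain a s where a: "a \<in> carrier R" "s \<in> W" "A = fr a s"
      by (auto simp: tight_closure_def elim: localization_carrierE)
    obtain C e0 where C: "C \<in> off_minimal_primes L"
      "\<And>e. e \<ge> e0 \<Longrightarrow> C \<otimes>\<^bsub>L\<^esub> A [^]\<^bsub>L\<^esub> (p ^ e) \<in> frobenius_power L (localize_ideal R W I) (p ^ e)"
      using A unfolding tight_closure_def by blast
    obtain c t where c: "c \<in> carrier R" "t \<in> W" "C = fr c t"
      using L.off_minimal_primes_closed[OF C(1)] by (elim localization_carrierE)
    have "c \<notin> P" if "P \<in> minimal_primes R" "P \<inter> W = {}" for P
      using off_minimal_primes_fr[OF _ c(1,2) that] C(1) c(3) by simp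
    then obtain c' w1 where c': "c' \<in> off_minimal_primes R" "w1 \<in> W" "w1 \<otimes> c' = w1 \<otimes> c"
      using off_minimal_primes_lift[OF W c(1)] by blast
    have c'c: "c' \<in> carrier R" using c'(1) off_minimal_primes_closed by blast
    obtain w0 where w0: "w0 \<in> W" and mult: "\<forall>e. \<forall>y\<in>carrier R.
      (\<exists>w\<in>W. w \<otimes> y \<in> frobenius_power R I (p ^ e)) \<longrightarrow> w0 [^] (p ^ e) \<otimes> y \<in> frobenius_power R I (p ^ e)"
      using uniform_multiplier[OF I dim p W] by (elim bexE)
    have "c' \<otimes> (w0 \<otimes> a) [^] (p ^ e) \<in> frobenius_power R I (p ^ e)" if e: "e \<ge> e0" for e
    proof -
      let ?q = "p ^ e" and ?J = "frobenius_power R I (p ^ e)"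
      have J: "ideal ?J R" by (rule frobenius_power_ideal[OF I'])
      have "fr (c \<otimes> a [^] ?q) (t \<otimes> s [^] ?q) \<in> localize_ideal R W ?J"
        using C(2)[OF e] a c unfolding frobenius_power_localize[OF I'] by (simp add: fr_pow fr_mult)
      then obtain w where w: "w \<in> W" "w \<otimes> (c \<otimes> a [^] ?q) \<in> ?J"
        using localize_ideal_mem_iff[OF J] a c by auto
      have "w1 \<otimes> (w \<otimes> (c \<otimes> a [^] ?q)) \<in> ?J" using w c'(2) by (simp add: ideal_lmult_mem[OF J])
      also have "w1 \<otimes> (w \<otimes> (c \<otimes> a [^] ?q)) = w \<otimes> ((w1 \<otimes> c) \<otimes> a [^] ?q)"
        using w(1) c'(2) c(1) a(1) by (simp add: m_ac)
      also have "\<dots> = (w \<otimes> w1) \<otimes> (c' \<otimes> a [^] ?q)"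
        unfolding c'(3)[symmetric] using w(1) c'(2) c'c a(1) by (simp add: m_assoc)
      finally have "w0 [^] ?q \<otimes> (c' \<otimes> a [^] ?q) \<in> ?J"
        using mult[rule_format, of "c' \<otimes> a [^] ?q" e] w(1) c'(2) c'c a(1) W_mult by blast
      then show ?thesis using m_lcomm[of c' "w0 [^] ?q"] w0 c'c a(1) by (simp add: nat_pow_distrib)
    qed
    then have "w0 \<otimes> a \<in> tight_closure R p I"
      unfolding tight_closure_def using c'(1) w0 a(1) by auto
    moreover have "A = fr (w0 \<otimes> a) (w0 \<otimes> s)"
      unfolding a(3) using a w0 by (intro fr_eqI) (auto simp: m_ac)
    ultimately show "A \<in> localize_ideal R W (tight_closure R p I)"
      using w0 a(2) W_mult fr_mem_localize_ideal by metis
  qed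
qed

end

theorem corollary3p2:
  fixes R :: "('a, 'b) ring_scheme" (structure)
    and \<G> :: "nat \<Rightarrow> 'a set" and p :: nat and I :: "'a set"
  assumes "noetherian_graded_ring_over_field R \<G>"
    and "has_char (R\<lparr>carrier := \<G> 0\<rparr>) p" and "p > 0"
    and "homogeneous_ideal R \<G> I"
    and "krull_dim (R Quot I) = 1"
  shows "(equidimensional R \<longrightarrow> LC_star R \<G> p I \<and> LC R \<G> p I) \<and>
    (\<forall>W. submonoid W R \<longrightarrow>
      localize_ideal R W (tight_closure R p I) =
        tight_closure (localization R W) p (localize_ideal R W I))"
proof -
  interpret noetherian_graded_ring_over_field R \<G> by fact
  note p = has_char_prime[OF assms(2,3)]
  have I: "hideal I" by (rule homogeneous_ideal_imp_hideal[OF assms(4)])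
  show ?thesis
    using LC_star_dim_one[OF I assms(5) p] LC_dim_one[OF I assms(5) p]
      tight_closure_localize[OF I assms(5) p] by blast
qed

end
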